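(* In the setting described in the context, assume that the auxiliary space $V_{\mathrm{aux}}$ satisfies, for every coarse element $K\in\mathcal T^H$, $$\|(I-\pi_K)u\|_{s(K)}^2\le C_\pi\|u\|_{a(K)}^2\qquad\text{for all }u\in H^1(K),$$ with $C_\pi$ independent of $H$ and of the contrast $\eta$. Let $\mathbf A^{-1}_{S,loc}:=\sum_{i=1}^N R_i^T(\mathbf A_i+\mathbf S_i)^{-1}R_i$. Then $$\operatorname{cond}\big(\mathbf A^{-1}_{S,loc}(\mathbf A+\mathbf S)\big)=O(1),$$ i.e. the condition number (the ratio of the largest to the smallest eigenvalue) is bounded by a constant independent of the contrast $\eta$, of the fine mesh size $h$ and of the coarse mesh size $H$.
   Context: **Domain and meshes.** $\Omega\subset\mathbb R^d$ ($d=2,3$) is a bounded domain; $\kappa\in L^\infty(\Omega)$ satisfies $0<\kappa_{\min}\le\kappa\le\kappa_{\max}$, with contrast $\eta=\kappa_{\max}/\kappa_{\min}$. $\mathcal T^h$ is a fine partition with mesh size $h$, $V_h=P_1(\mathcal T^h)$ is the space of continuous piecewise linear functions, and $V_{h,0}=\{v\in V_h: v=0\text{ on }\partial\Omega\}$. $\mathcal T^H$ is a coarse partition of $\Omega$ with mesh size $H$ and elements $K_1,\dots,K_N$. **Forms.** $a(u,v)=\int_\Omega\kappa\nabla u\cdot\nabla v\,dx$, $s(u,v)=H^{-2}\int_\Omega\kappa uv\,dx$, $\|u\|_a^2=a(u,u)$, $\|u\|_s^2=s(u,u)$; $\|\cdot\|_{a(K)},\|\cdot\|_{s(K)}$ are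 the same with integrals restricted to $K$. **Auxiliary space.** In each coarse element $K$ there are pairwise disjoint connected open Lipschitz subdomains $K_h^i\subset K$ (high-permeability components), and $K_l=K\setminus\bigcup_iK_h^i$. There are constants $\eta_0,\kappa_0$ with $\max_{K_h^i}\kappa/\min_{K_h^i}\kappa\le\eta_0$, $\min_{K_h^i}\kappa\ge\kappa_0$, $\max_{K_l}\kappa<\kappa_0$, and a constant $C$ independent of $H$ and $K$ with $\int_{K_h^i}|u|^2\le CH^2\int_{K_h^i}|\nabla u|^2$ whenever $\int_{K_h^i}u=0$. Let $V^K_{\mathrm{aux}}$ be the span of the characteristic functions of all the $K_h^i\subset K$ and of $K_l$, and $V_{\mathrm{aux}}=\bigoplus_KV_{\mathrm{aux}}^K$. $\pi_K$ is the projection onto $V_{\mathrm{aux}}^K$ orthogonal with respect to $s$ on $K$, and $\pi u=\sum_K\pi_K(u|_K)$. **Overlapping subdomains.** $\omega_i$ is obtained by extending $K_i$ by layers of fine elements; $\Omega=\bigcup_i\omega_i$, and each point of $\Omega$ lies in at most a fixed number of the $\omega_i$, independent of $h,H,\eta$. $V_i=V_{h,0}(\omega_i)$ is the space of fine finite element functions on $\omega_i$ vanishing on $\partial\omega_i$, $R_i^T:V_i\to V_{h,0}$ is extension by zero and $R_i$ its transpose. There is a partition of unity $\{\chi_i\}\subset V_h$ with $\chi_i$ supported in $\omega_i$, $\sum_i\chi_i=1$, $\sum_i\chi_i^2\le1$, $|\nabla\chi_i|\le CH^{-1}$. The fine nodal interpolant $I_h$ satisfies $\|I_hv\|_a\le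 C_I\|v\|_a$ and $\|I_hv\|_s\le C_I\|v\|_s$ for all continuous $v$ that are piecewise quadratic on $\mathcal T^h$, with $C_I$ independent of $h,H,\eta$. **Matrices.** With the nodal basis $v_{h,j}$ of $V_{h,0}$: $\mathbf A_{ji}=a(v_{h,i},v_{h,j})$, $\mathbf S_{ji}=s(\pi v_{h,i},\pi v_{h,j})$. $\mathbf A_i$, $\mathbf S_i$ are the corresponding matrices on $V_i$, i.e. $\mathbf A_i=R_i\mathbf AR_i^T$, $\mathbf S_i=R_i\mathbf SR_i^T$. *)

theory Defs
  imports
    "HOL-Analysis.Analysis"
    "HOL-Probability.Essential_Supremum"
    "Jordan_Normal_Form.Gauss_Jordan_Elimination"
    "Jordan_Normal_Form.Spectral_Radius"
begin

section \<open>Gradients and Sobolev functions\<close>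

text \<open>Pointwise gradient; for finite element functions it exists at almost every point.\<close>

definition grad :: "('a::euclidean_space \<Rightarrow> real) \<Rightarrow> 'a \<Rightarrow> 'a" where
  "grad f x = (\<Sum>b\<in>Basis. frechet_derivative f (at x) b *\<^sub>R b)"

coinductive smooth :: "('a::euclidean_space \<Rightarrow> real) \<Rightarrow> bool" where
  "(\<And>x. (f has_derivative f' x) (at x)) \<Longrightarrow> (\<And>v. smooth (\<lambda>x. f' x v)) \<Longrightarrow> smooth f"

definition test_function :: "'a::euclidean_space set \<Rightarrow> ('a \<Rightarrow> real) \<Rightarrow> bool" where
  "test_function U \<phi> \<longleftrightarrow>
     smooth \<phi> \<and> compact (closure {x. \<phi> x \<noteq> 0}) \<and> closure {x. \<phi> x \<noteq> 0} \<subseteq> U"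

definition L2_on :: "'a::euclidean_space set \<Rightarrow> ('a \<Rightarrow> 'b::euclidean_space) \<Rightarrow> bool" where
  "L2_on U f \<longleftrightarrow>
     f \<in> borel_measurable (lebesgue_on U) \<and> integrable (lebesgue_on U) (\<lambda>x. (norm (f x))\<^sup>2)"

text \<open>\<open>H1_on U u g\<close>: \<open>u\<close> belongs to $H^1(U)$ and \<open>g\<close> is (a representative of) its weak gradient.\<close>

definition H1_on :: "'a::euclidean_space set \<Rightarrow> ('a \<Rightarrow> real) \<Rightarrow> ('a \<Rightarrow> 'a) \<Rightarrow> bool" where
  "H1_on U u g \<longleftrightarrow> L2_on U u \<and> L2_on U g \<and>
     (\<forall>\<phi> b. test_function U \<phi> \<and> b \<in> Basis \<longrightarrow>
        integral\<^sup>L (lebesgue_on U) (\<lambda>x. u x * inner (grad \<phi> x) b) =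
        - integral\<^sup>L (lebesgue_on U) (\<lambda>x. inner (g x) b * \<phi> x))"

text \<open>A bounded open set that lies, near each of its boundary points, below the graph of a
  Lipschitz function in some rotated coordinate system; \<open>e\<close> is the vertical direction and
  \<open>\<gamma>\<close> depends only on the component orthogonal to \<open>e\<close>.\<close>

definition lipschitz_domain :: "'a::euclidean_space set \<Rightarrow> bool" where
  "lipschitz_domain U \<longleftrightarrow> open U \<and> bounded U \<and>
     (\<forall>x\<in>frontier U. \<exists>e \<gamma> L r. norm e = 1 \<and> 0 < r \<and> L-lipschitz_on UNIV \<gamma> \<and>
        (\<forall>y t. \<gamma> (y + t *\<^sub>R e) = \<gamma> y) \<and>
        U \<inter> ball x r = {y \<in> ball x r. inner y e < \<gamma> y})"

section \<open>Energy and weighted mass forms\<close>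

definition a_form :: "('a::euclidean_space \<Rightarrow> real) \<Rightarrow> 'a set \<Rightarrow> ('a \<Rightarrow> real) \<Rightarrow> ('a \<Rightarrow> real) \<Rightarrow> real"
  where
  "a_form \<kappa> U u v = integral\<^sup>L (lebesgue_on U) (\<lambda>x. \<kappa> x * inner (grad u x) (grad v x))"

definition s_form ::
    "('a::euclidean_space \<Rightarrow> real) \<Rightarrow> real \<Rightarrow> 'a set \<Rightarrow> ('a \<Rightarrow> real) \<Rightarrow> ('a \<Rightarrow> real) \<Rightarrow> real" where
  "s_form \<kappa> H U u v = integral\<^sup>L (lebesgue_on U) (\<lambda>x. \<kappa> x * u x * v x) / H\<^sup>2"

definition a_norm :: "('a::euclidean_space \<Rightarrow> real) \<Rightarrow> 'a set \<Rightarrow> ('a \<Rightarrow> real) \<Rightarrow> real" where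
  "a_norm \<kappa> U u = sqrt (a_form \<kappa> U u u)"

definition s_norm :: "('a::euclidean_space \<Rightarrow> real) \<Rightarrow> real \<Rightarrow> 'a set \<Rightarrow> ('a \<Rightarrow> real) \<Rightarrow> real" where
  "s_norm \<kappa> H U u = sqrt (s_form \<kappa> H U u u)"

section \<open>Meshes and finite element spaces\<close>

definition mesh_size :: "'a::euclidean_space set set \<Rightarrow> real" where
  "mesh_size M = Max (diameter ` M)"

text \<open>Conforming simplicial mesh of \<open>\<Omega>\<close> with closed elements. The condition that the boundary
  is a union of mesh faces only has content for domains with cracks, such as a slit square.\<close>

definition fine_mesh :: "'a::euclidean_space set \<Rightarrow> real \<Rightarrow> 'a set set \<Rightarrow> bool" where
  "fine_mesh \<Omega> h \<T> \<longleftrightarrow> triangulation \<T> \<and> (\<forall>T\<in>\<T>. int DIM('a) simplex T) \<and>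
     \<Union>\<T> = closure \<Omega> \<and>
     (\<exists>\<F>. (\<forall>F\<in>\<F>. \<exists>T\<in>\<T>. F face_of T) \<and> frontier \<Omega> = \<Union>\<F>) \<and>
     mesh_size \<T> = h"

definition nodes :: "'a::euclidean_space set set \<Rightarrow> 'a set" where
  "nodes \<T> = {x. \<exists>T\<in>\<T>. x extreme_point_of T}"

text \<open>Finite element functions are total functions that are set to zero outside
  the closed meshed region, so that they are determined by their nodal values.\<close>

definition P1 :: "'a::euclidean_space set set \<Rightarrow> ('a \<Rightarrow> real) set" where
  "P1 \<T> = {v. continuous_on (\<Union>\<T>) v \<and> (\<forall>T\<in>\<T>. \<exists>c b. \<forall>x\<in>T. v x = c + inner b x) \<and>
              (\<forall>x. x \<notin> \<Union>\<T> \<longrightarrow> v x = 0)}"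

text \<open>For an open union \<open>D\<close> of elements, \<open>P1_0 \<T> D\<close> consists of the finite element functions on
  \<open>D\<close> that vanish on the boundary of \<open>D\<close>, extended by zero. Its degrees of freedom are
  the values at the nodes in \<open>D\<close>.\<close>

definition P1_0 :: "'a::euclidean_space set set \<Rightarrow> 'a set \<Rightarrow> ('a \<Rightarrow> real) set" where
  "P1_0 \<T> D = {v \<in> P1 \<T>. \<forall>x. x \<notin> D \<longrightarrow> v x = 0}"

definition nodal_basis :: "'a::euclidean_space set set \<Rightarrow> 'a set \<Rightarrow> 'a \<Rightarrow> 'a \<Rightarrow> real" where
  "nodal_basis \<T> D z =
     (THE v. v \<in> P1_0 \<T> D \<and> (\<forall>y \<in> nodes \<T> \<inter> D. v y = (if y = z then 1 else 0)))"

definition nodal_interpolant :: "'a::euclidean_space set set \<Rightarrow> ('a \<Rightarrow> real) \<Rightarrow> 'a \<Rightarrow> real" where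
  "nodal_interpolant \<T> v = (THE w. w \<in> P1 \<T> \<and> (\<forall>z \<in> nodes \<T>. w z = v z))"

definition piecewise_quadratic :: "'a::euclidean_space set set \<Rightarrow> ('a \<Rightarrow> real) \<Rightarrow> bool" where
  "piecewise_quadratic \<T> v \<longleftrightarrow>
     (\<forall>T\<in>\<T>. \<exists>c b A. linear A \<and> (\<forall>x\<in>T. v x = c + inner b x + inner x (A x)))"

definition interpolation_stable ::
    "('a::euclidean_space \<Rightarrow> real) \<Rightarrow> real \<Rightarrow> 'a set \<Rightarrow> 'a set set \<Rightarrow> real \<Rightarrow> bool" where
  "interpolation_stable \<kappa> H \<Omega> \<T> C \<longleftrightarrow>
     (\<forall>v. continuous_on (closure \<Omega>) v \<and> piecewise_quadratic \<T> v \<longrightarrow>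
        a_norm \<kappa> \<Omega> (nodal_interpolant \<T> v) \<le> C * a_norm \<kappa> \<Omega> v \<and>
        s_norm \<kappa> H \<Omega> (nodal_interpolant \<T> v) \<le> C * s_norm \<kappa> H \<Omega> v)"

text \<open>The coarse elements \<open>K i\<close>, \<open>i < N\<close>, are open and of arbitrary shape; they need not be simplices.\<close>

definition coarse_mesh :: "'a::euclidean_space set \<Rightarrow> real \<Rightarrow> nat \<Rightarrow> (nat \<Rightarrow> 'a set) \<Rightarrow> bool" where
  "coarse_mesh \<Omega> H N K \<longleftrightarrow>
     (\<forall>i<N. open (K i) \<and> connected (K i) \<and> K i \<noteq> {} \<and> K i \<subseteq> \<Omega>) \<and>
     disjoint_family_on K {..<N} \<and> negligible (\<Omega> - (\<Union>i<N. K i)) \<and>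
     mesh_size (K ` {..<N}) = H"

section \<open>Coefficient and auxiliary space\<close>

definition coefficient :: "'a::euclidean_space set \<Rightarrow> real \<Rightarrow> real \<Rightarrow> ('a \<Rightarrow> real) \<Rightarrow> bool" where
  "coefficient \<Omega> \<kappa>min \<kappa>max \<kappa> \<longleftrightarrow> \<kappa> \<in> borel_measurable (lebesgue_on \<Omega>) \<and> 0 < \<kappa>min \<and>
     (AE x in lebesgue_on \<Omega>. \<kappa>min \<le> \<kappa> x \<and> \<kappa> x \<le> \<kappa>max)"

definition ess_max :: "('a::euclidean_space \<Rightarrow> real) \<Rightarrow> 'a set \<Rightarrow> ereal" where
  "ess_max \<kappa> U = esssup (lebesgue_on U) (\<lambda>x. ereal (\<kappa> x))"

definition ess_min :: "('a::euclidean_space \<Rightarrow> real) \<Rightarrow> 'a set \<Rightarrow> ereal" where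
  "ess_min \<kappa> U = - esssup (lebesgue_on U) (\<lambda>x. - ereal (\<kappa> x))"

text \<open>\<open>P\<close> is the set of high-permeability components of the coarse element \<open>K\<close>. If
  \<open>K - \<Union>P\<close> is a null set, the condition on it is void, since \<open>ess_max\<close> is then \<open>-\<infinity>\<close>.\<close>

definition high_components ::
    "('a::euclidean_space \<Rightarrow> real) \<Rightarrow> real \<Rightarrow> real \<Rightarrow> real \<Rightarrow> real \<Rightarrow> 'a set \<Rightarrow> 'a set set \<Rightarrow> bool" where
  "high_components \<kappa> H \<eta>0 \<kappa>0 CP K P \<longleftrightarrow>
     finite P \<and> disjoint P \<and>
     (\<forall>D\<in>P. D \<noteq> {} \<and> D \<subseteq> K \<and> connected D \<and> lipschitz_domain D \<and>
        ess_max \<kappa> D / ess_min \<kappa> D \<le> ereal \<eta>0 \<and> ereal \<kappa>0 \<le> ess_min \<kappa> D \<and>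
        (\<forall>u g. H1_on D u g \<and> integral\<^sup>L (lebesgue_on D) u = 0 \<longrightarrow>
           integral\<^sup>L (lebesgue_on D) (\<lambda>x. (u x)\<^sup>2) \<le>
           CP * H\<^sup>2 * integral\<^sup>L (lebesgue_on D) (\<lambda>x. (norm (g x))\<^sup>2))) \<and>
     ess_max \<kappa> (K - \<Union>P) < ereal \<kappa>0"

definition aux_space :: "'a set \<Rightarrow> 'a set set \<Rightarrow> ('a \<Rightarrow> real) set" where
  "aux_space K P =
     {w. \<exists>c. w = (\<lambda>x. \<Sum>D\<in>insert (K - \<Union>P) P. c D * indicat_real D x)}"

text \<open>The orthogonal projection is unique up to a null set: if \<open>K - \<Union>P\<close> is a nonempty null set,
  the value on it is arbitrary. Functions in the range vanish outside \<open>K\<close>.\<close>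

definition aux_proj_elem ::
    "('a::euclidean_space \<Rightarrow> real) \<Rightarrow> real \<Rightarrow> 'a set \<Rightarrow> 'a set set \<Rightarrow> ('a \<Rightarrow> real) \<Rightarrow> 'a \<Rightarrow> real" where
  "aux_proj_elem \<kappa> H K P u =
     (SOME w. w \<in> aux_space K P \<and> (\<forall>v \<in> aux_space K P. s_form \<kappa> H K (\<lambda>x. u x - w x) v = 0))"

definition aux_proj ::
    "('a::euclidean_space \<Rightarrow> real) \<Rightarrow> real \<Rightarrow> nat \<Rightarrow> (nat \<Rightarrow> 'a set) \<Rightarrow> (nat \<Rightarrow> 'a set set) \<Rightarrow>
     ('a \<Rightarrow> real) \<Rightarrow> 'a \<Rightarrow> real" where
  "aux_proj \<kappa> H N K P u = (\<lambda>x. \<Sum>i<N. aux_proj_elem \<kappa> H (K i) (P i) u x)"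

definition aux_approximation ::
    "('a::euclidean_space \<Rightarrow> real) \<Rightarrow> real \<Rightarrow> real \<Rightarrow> 'a set \<Rightarrow> 'a set set \<Rightarrow> bool" where
  "aux_approximation \<kappa> H C\<pi> K P \<longleftrightarrow>
     (\<forall>u g. H1_on K u g \<longrightarrow>
        (s_norm \<kappa> H K (\<lambda>x. u x - aux_proj_elem \<kappa> H K P u x))\<^sup>2 \<le>
        C\<pi> * integral\<^sup>L (lebesgue_on K) (\<lambda>x. \<kappa> x * (norm (g x))\<^sup>2))"

section \<open>Overlapping subdomains\<close>

fun extend_by_layers :: "'a::euclidean_space set set \<Rightarrow> 'a set \<Rightarrow> nat \<Rightarrow> 'a set" where
  "extend_by_layers \<T> U 0 = closure U"
| "extend_by_layers \<T> U (Suc m) = \<Union>{T\<in>\<T>. T \<inter> extend_by_layers \<T> U m \<noteq> {}}"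

definition subdomain :: "'a::euclidean_space set \<Rightarrow> 'a set set \<Rightarrow> 'a set \<Rightarrow> nat \<Rightarrow> 'a set" where
  "subdomain \<Omega> \<T> U m = \<Omega> \<inter> interior (extend_by_layers \<T> U m)"

definition overlapping_cover :: "'a set \<Rightarrow> nat \<Rightarrow> nat \<Rightarrow> (nat \<Rightarrow> 'a set) \<Rightarrow> bool" where
  "overlapping_cover \<Omega> M N \<omega> \<longleftrightarrow>
     \<Omega> = (\<Union>i<N. \<omega> i) \<and> (\<forall>x\<in>\<Omega>. card {i. i < N \<and> x \<in> \<omega> i} \<le> M)"

definition partition_of_unity ::
    "'a::euclidean_space set \<Rightarrow> 'a set set \<Rightarrow> real \<Rightarrow> real \<Rightarrow> nat \<Rightarrow> (nat \<Rightarrow> 'a set) \<Rightarrow>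
     (nat \<Rightarrow> 'a \<Rightarrow> real) \<Rightarrow> bool" where
  "partition_of_unity \<Omega> \<T> H C N \<omega> \<theta> \<longleftrightarrow>
     (\<forall>i<N. \<theta> i \<in> P1 \<T> \<and> (\<forall>x \<in> \<Omega> - \<omega> i. \<theta> i x = 0) \<and>
            (AE x in lebesgue_on \<Omega>. norm (grad (\<theta> i) x) \<le> C / H)) \<and>
     (\<forall>x\<in>\<Omega>. (\<Sum>i<N. \<theta> i x) = 1 \<and> (\<Sum>i<N. (\<theta> i x)\<^sup>2) \<le> 1)"

section \<open>Matrices\<close>

text \<open>The list \<open>xs\<close> enumerates the nodes in \<open>\<Omega>\<close>; it fixes the order of the nodal basis.\<close>

definition A_mat ::
    "('a::euclidean_space \<Rightarrow> real) \<Rightarrow> 'a set \<Rightarrow> 'a set set \<Rightarrow> 'a list \<Rightarrow> real mat" where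
  "A_mat \<kappa> \<Omega> \<T> xs = Matrix.mat (length xs) (length xs)
     (\<lambda>(j, i). a_form \<kappa> \<Omega> (nodal_basis \<T> \<Omega> (xs ! i)) (nodal_basis \<T> \<Omega> (xs ! j)))"

definition S_mat ::
    "('a::euclidean_space \<Rightarrow> real) \<Rightarrow> real \<Rightarrow> 'a set \<Rightarrow> 'a set set \<Rightarrow> nat \<Rightarrow> (nat \<Rightarrow> 'a set) \<Rightarrow>
     (nat \<Rightarrow> 'a set set) \<Rightarrow> 'a list \<Rightarrow> real mat" where
  "S_mat \<kappa> H \<Omega> \<T> N K P xs = Matrix.mat (length xs) (length xs)
     (\<lambda>(j, i). s_form \<kappa> H \<Omega> (aux_proj \<kappa> H N K P (nodal_basis \<T> \<Omega> (xs ! i)))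
                             (aux_proj \<kappa> H N K P (nodal_basis \<T> \<Omega> (xs ! j))))"

text \<open>Matrix of the extension by zero from \<open>P1_0 \<T> D\<close> to \<open>P1_0 \<T> \<Omega>\<close> in the nodal bases: column
  \<open>k\<close> holds the nodal values of the \<open>k\<close>-th basis function of \<open>P1_0 \<T> D\<close>.\<close>

definition RT_mat :: "'a::euclidean_space set set \<Rightarrow> 'a set \<Rightarrow> 'a list \<Rightarrow> real mat" where
  "RT_mat \<T> D xs = (let ys = filter (\<lambda>x. x \<in> D) xs in
     Matrix.mat (length xs) (length ys) (\<lambda>(j, k). nodal_basis \<T> D (ys ! k) (xs ! j)))"

definition local_solver :: "real mat \<Rightarrow> real mat \<Rightarrow> real mat \<Rightarrow> real mat" where
  "local_solver RT A S = (let R = transpose_mat RT in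
     RT * the (mat_inverse (R * A * RT + R * S * RT)) * R)"

definition schwarz_precond ::
    "'a::euclidean_space set set \<Rightarrow> nat \<Rightarrow> (nat \<Rightarrow> 'a set) \<Rightarrow> 'a list \<Rightarrow> real mat \<Rightarrow> real mat \<Rightarrow> real mat"
  where
  "schwarz_precond \<T> N \<omega> xs A S = Matrix.mat (length xs) (length xs)
     (\<lambda>(j, k). \<Sum>i<N. local_solver (RT_mat \<T> (\<omega> i) xs) A S $$ (j, k))"

definition positive_spectrum :: "real mat \<Rightarrow> bool" where
  "positive_spectrum B \<longleftrightarrow> spectrum (map_mat complex_of_real B) \<subseteq> complex_of_real ` {0<..}"

text \<open>Meaningful for nonempty matrices whose complex spectrum is real and positive.\<close>

definition cond_number :: "real mat \<Rightarrow> real" where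
  "cond_number B = Max (spectrum B) / Min (spectrum B)"

end

theory Submission
  imports Defs
begin

text \<open>Write b for the bilinear form of A + S. Each local solver, composed with A + S, is the b-orthogonal
  projection onto the local space, so the preconditioned operator is b-self-adjoint and its eigenvalues are
  bounded by an overlap constant from above and by the inverse of a stable-decomposition constant from below.
  The approximation property yields s(u,u) <= C a(u,u) + s(pi u, pi u), while conversely s(pi u, pi u) <= s(u,u),
  so b is equivalent to a + s on finite element functions. This replaces the nonlocal term s(pi u, pi u), to which
  local functions with disjoint supports in a common coarse element contribute jointly, by a local one: the
  overlap bound is then pointwise, and the decomposition into the interpolants of the products of u with the
  partition of unity is stable by the Leibniz rule. To apply the approximation property, one has to know that
  continuous piecewise linear functions belong to the Sobolev space of every coarse element.\<close>

section \<open>Spectral bounds for additive Schwarz preconditioners\<close>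

text \<open>The bound is free of the contrast because the proved estimates are either pointwise,
  before multiplication by \<kappa> and integration, or orthogonality relations in the
  \<kappa>-weighted inner product itself; the approximation property and the stability of
  interpolation are assumed with constants of this kind. It is free of H because the factor H^-2 in
  s absorbs the square of the bound C/H on the gradients of the partition of unity. Several
  obstacles shape the details. The projection onto the auxiliary space is a choice that is unique
  only up to null sets and therefore not visibly linear; it is traded for an explicit weighted
  average. Gradients are pointwise Frechet derivatives with a known value only inside fine elements,
  so identities between them hold almost everywhere. The positivity claim concerns the complex
  spectrum, whereas symmetry is available for a real bilinear form, so the eigenvalues have to be
  shown real. Products with the partition of unity are quadratic on elements and must be
  interpolated back.\<close>

definition vec_family_sum :: "nat \<Rightarrow> nat \<Rightarrow> (nat \<Rightarrow> real Matrix.vec) \<Rightarrow> real Matrix.vec" where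
  "vec_family_sum n N y = Matrix.vec n (\<lambda>j. \<Sum>i<N. vec_index (y i) j)"

lemma vec_family_sum_carrier [simp]: "vec_family_sum n N y \<in> carrier_vec n"
  by (simp add: vec_family_sum_def)

lemma scalar_prod_family_sum_left:
  assumes "w \<in> carrier_vec n"
  shows "scalar_prod (vec_family_sum n N y) w = (\<Sum>i<N. scalar_prod (y i) w)"
  using assms
  by (simp add: vec_family_sum_def scalar_prod_def sum_distrib_right sum.swap[of _ "{..<N}"])

lemma scalar_prod_mat_symmetric:
  fixes G :: "real mat"
  assumes "G \<in> carrier_mat n n" "transpose_mat G = G" "x \<in> carrier_vec n" "y \<in> carrier_vec n"
  shows "scalar_prod x (mult_mat_vec G y) = scalar_prod y (mult_mat_vec G x)"
  using transpose_vec_mult_scalar[OF assms(1,4,3)] comm_scalar_prod[of "mult_mat_vec G x" n y] assms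
  by simp

lemma mult_mat_vec_assoc3:
  assumes "A \<in> carrier_mat n k" "B \<in> carrier_mat k l" "C \<in> carrier_mat l m" "v \<in> carrier_vec m"
  shows "mult_mat_vec (A * B * C) v = mult_mat_vec A (mult_mat_vec B (mult_mat_vec C v))"
proof -
  have "mult_mat_vec (A * B * C) v = mult_mat_vec (A * B) (mult_mat_vec C v)"
    using assms by (intro assoc_mult_mat_vec) auto
  also have "\<dots> = mult_mat_vec A (mult_mat_vec B (mult_mat_vec C v))"
    using assms by (intro assoc_mult_mat_vec) auto
  finally show ?thesis .
qed

text \<open>A kernel vector would contradict positivity, so the determinant is nonzero and
  \<open>G\<close> is a unit of the matrix ring. This is what gives meaning to the
  \<open>the\<close> in \<open>local_solver\<close>.\<close>

lemma positive_definite_mat_inverse: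
  fixes G :: "real mat"
  assumes G: "G \<in> carrier_mat k k"
    and pd: "\<And>x. x \<in> carrier_vec k \<Longrightarrow> x \<noteq> 0\<^sub>v k \<Longrightarrow> 0 < scalar_prod x (mult_mat_vec G x)"
  obtains Gi where "mat_inverse G = Some Gi" "Gi \<in> carrier_mat k k" "G * Gi = 1\<^sub>m k"
proof -
  have "det G \<noteq> 0"
    using det_0_iff_vec_prod_zero_field[OF G] pd by fastforce
  then have "G \<in> Units (ring_mat TYPE(real) k ())"
    by (rule det_non_zero_imp_unit[OF G])
  then obtain Gi where "mat_inverse G = Some Gi"
    using mat_inverse(1)[OF G, of "()"] by blast
  with mat_inverse(2)[OF G this] that show ?thesis by blast
qed

text \<open>Injectivity of \<open>RT\<close> lets the compressed matrix inherit positive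
  definiteness, so its inverse exists. The vector \<open>z\<close> holds local coefficients, and the
  identity for all \<open>y\<close> is Galerkin orthogonality: the residual is tested against the
  whole range of \<open>RT\<close>.\<close>

lemma local_solver_projection:
  fixes A S RT :: "real mat"
  assumes A: "A \<in> carrier_mat n n" and S: "S \<in> carrier_mat n n" and RT: "RT \<in> carrier_mat n k"
    and pd: "\<And>x. x \<in> carrier_vec n \<Longrightarrow> x \<noteq> 0\<^sub>v n \<Longrightarrow> 0 < scalar_prod x (mult_mat_vec (A + S) x)"
    and inj: "\<And>z. z \<in> carrier_vec k \<Longrightarrow> mult_mat_vec RT z = 0\<^sub>v n \<Longrightarrow> z = 0\<^sub>v k"
  shows "local_solver RT A S \<in> carrier_mat n n"
    and "u \<in> carrier_vec n \<Longrightarrow> \<exists>z\<in>carrier_vec k.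
      mult_mat_vec (local_solver RT A S) (mult_mat_vec (A + S) u) = mult_mat_vec RT z \<and>
      (\<forall>y\<in>carrier_vec k. scalar_prod (mult_mat_vec RT y) (mult_mat_vec (A + S) (mult_mat_vec RT z)) =
         scalar_prod (mult_mat_vec RT y) (mult_mat_vec (A + S) u))"
proof -
  define G where "G = A + S"
  define R where "R = transpose_mat RT"
  define Gl where "Gl = R * G * RT"
  have G: "G \<in> carrier_mat n n" and R: "R \<in> carrier_mat k n" and Gl: "Gl \<in> carrier_mat k k"
    using A S RT by (auto simp: G_def R_def Gl_def)
  have Gl_eq: "R * A * RT + R * S * RT = Gl"
    using A S R RT by (simp add: Gl_def G_def mult_add_distrib_mat[of R k n A n S]
        add_mult_distrib_mat[of "R * A" k n "R * S" RT k])
  have R_scalar: "scalar_prod y (mult_mat_vec R w) = scalar_prod (mult_mat_vec RT y) w"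
    if "y \<in> carrier_vec k" "w \<in> carrier_vec n" for y w
    using transpose_vec_mult_scalar[OF RT that] that R RT
    by (metis R_def comm_scalar_prod mult_mat_vec_carrier)
  have Gl_apply: "mult_mat_vec Gl z = mult_mat_vec R (mult_mat_vec G (mult_mat_vec RT z))"
    if "z \<in> carrier_vec k" for z
    unfolding Gl_def by (rule mult_mat_vec_assoc3[OF R G RT that])
  have Gl_pd: "0 < scalar_prod z (mult_mat_vec Gl z)" if z: "z \<in> carrier_vec k" "z \<noteq> 0\<^sub>v k" for z
  proof -
    have "mult_mat_vec RT z \<in> carrier_vec n" "mult_mat_vec RT z \<noteq> 0\<^sub>v n"
      using z RT inj by auto
    then show ?thesis
      using pd G z by (auto simp: Gl_apply R_scalar G_def[symmetric])
  qed
  obtain Gi where Gi: "mat_inverse Gl = Some Gi" "Gi \<in> carrier_mat k k" "Gl * Gi = 1\<^sub>m k"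
    using positive_definite_mat_inverse[OF Gl] Gl_pd by metis
  have solver: "local_solver RT A S = RT * Gi * R"
    using Gi Gl_eq by (simp add: local_solver_def R_def Let_def)
  then show "local_solver RT A S \<in> carrier_mat n n"
    using RT Gi R by auto
  assume u: "u \<in> carrier_vec n"
  define z where "z = mult_mat_vec Gi (mult_mat_vec R (mult_mat_vec G u))"
  have z: "z \<in> carrier_vec k" using Gi R G u by (simp add: z_def)
  have 1: "mult_mat_vec (local_solver RT A S) (mult_mat_vec G u) = mult_mat_vec RT z"
    unfolding solver z_def by (rule mult_mat_vec_assoc3[OF RT Gi(2) R]) (use G u in simp)
  have "mult_mat_vec Gl z = mult_mat_vec R (mult_mat_vec G u)"
    using assoc_mult_mat_vec[OF Gl Gi(2), of "mult_mat_vec R (mult_mat_vec G u)"] Gi(3) R G u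
    unfolding z_def by simp
  then have 2: "scalar_prod (mult_mat_vec RT y) (mult_mat_vec G (mult_mat_vec RT z)) =
      scalar_prod (mult_mat_vec RT y) (mult_mat_vec G u)" if "y \<in> carrier_vec k" for y
    using that z G RT u by (simp add: Gl_apply flip: R_scalar)
  show "\<exists>z\<in>carrier_vec k.
      mult_mat_vec (local_solver RT A S) (mult_mat_vec (A + S) u) = mult_mat_vec RT z \<and>
      (\<forall>y\<in>carrier_vec k. scalar_prod (mult_mat_vec RT y) (mult_mat_vec (A + S) (mult_mat_vec RT z)) =
         scalar_prod (mult_mat_vec RT y) (mult_mat_vec (A + S) u))"
    using 1 2 z unfolding G_def by blast
qed

text \<open>A real matrix acts separately on real and imaginary parts. This carries complex
  eigenvectors over to real vectors, on which the symmetric form is defined.\<close>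

lemma eigenvector_of_real_parts:
  fixes B :: "real mat"
  assumes B: "B \<in> carrier_mat n n" and ev: "eigenvector (map_mat complex_of_real B) v l"
  shows "mult_mat_vec B (map_vec Re v) = Re l \<cdot>\<^sub>v map_vec Re v - Im l \<cdot>\<^sub>v map_vec Im v"
    and "mult_mat_vec B (map_vec Im v) = Re l \<cdot>\<^sub>v map_vec Im v + Im l \<cdot>\<^sub>v map_vec Re v"
    and "map_vec Re v \<noteq> 0\<^sub>v n \<or> map_vec Im v \<noteq> 0\<^sub>v n"
proof -
  have v: "v \<in> carrier_vec n" "v \<noteq> 0\<^sub>v n"
    and eq: "mult_mat_vec (map_mat complex_of_real B) v = l \<cdot>\<^sub>v v"
    using ev B by (auto simp: eigenvector_def)
  have comp: "(\<Sum>k<n. complex_of_real (B $$ (j, k)) * vec_index v k) = l * vec_index v j" if "j < n" for j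
    using arg_cong[OF eq, of "\<lambda>w. vec_index w j"] that v B
    by (simp add: scalar_prod_def atLeast0LessThan)
  show "mult_mat_vec B (map_vec Re v) = Re l \<cdot>\<^sub>v map_vec Re v - Im l \<cdot>\<^sub>v map_vec Im v"
    using v B by (intro eq_vecI)
      (auto simp: scalar_prod_def atLeast0LessThan dest!: arg_cong[OF comp, of _ Re])
  show "mult_mat_vec B (map_vec Im v) = Re l \<cdot>\<^sub>v map_vec Im v + Im l \<cdot>\<^sub>v map_vec Re v"
    using v B by (intro eq_vecI)
      (auto simp: scalar_prod_def atLeast0LessThan dest!: arg_cong[OF comp, of _ Im])
  show "map_vec Re v \<noteq> 0\<^sub>v n \<or> map_vec Im v \<noteq> 0\<^sub>v n"
  proof (rule ccontr)
    assume "\<not> ?thesis"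
    then have "Re (vec_index v j) = 0 \<and> Im (vec_index v j) = 0" if "j < n" for j
      using that v by (metis carrier_vecD index_map_vec(1) index_zero_vec(1))
    then have "v = 0\<^sub>v n"
      using v by (intro eq_vecI) (auto simp: complex_eq_iff)
    with v show False by simp
  qed
qed

text \<open>For an eigenvector x with eigenvalue \<alpha>, the energies of its projections onto the
  local spaces add up to \<alpha> b(x,x). Testing a decomposition from \<open>split\<close> against
  the projections bounds \<alpha> from below by 1/\<open>C1\<close>; \<open>overlap\<close>, applied
  to the projections, whose sum is \<alpha> x, bounds it from above by \<open>C2\<close>.\<close>

lemma schwarz_condition_number:
  fixes A S B :: "real mat" and RT :: "nat \<Rightarrow> real mat"
  assumes n: "0 < n" and A: "A \<in> carrier_mat n n" and S: "S \<in> carrier_mat n n"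
    and sym: "transpose_mat (A + S) = A + S"
    and pd: "\<And>x. x \<in> carrier_vec n \<Longrightarrow> x \<noteq> 0\<^sub>v n \<Longrightarrow> 0 < scalar_prod x (mult_mat_vec (A + S) x)"
    and RT: "\<And>i. i < N \<Longrightarrow> RT i \<in> carrier_mat n (k i)"
    and inj: "\<And>i z. i < N \<Longrightarrow> z \<in> carrier_vec (k i) \<Longrightarrow> mult_mat_vec (RT i) z = 0\<^sub>v n \<Longrightarrow> z = 0\<^sub>v (k i)"
    and B: "B = Matrix.mat n n (\<lambda>(j, l). \<Sum>i<N. local_solver (RT i) A S $$ (j, l)) * (A + S)"
    and C1: "0 < C1"
    and overlap: "\<And>z. (\<And>i. i < N \<Longrightarrow> z i \<in> carrier_vec (k i)) \<Longrightarrow>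
      scalar_prod (vec_family_sum n N (\<lambda>i. mult_mat_vec (RT i) (z i)))
        (mult_mat_vec (A + S) (vec_family_sum n N (\<lambda>i. mult_mat_vec (RT i) (z i))))
      \<le> C2 * (\<Sum>i<N. scalar_prod (mult_mat_vec (RT i) (z i)) (mult_mat_vec (A + S) (mult_mat_vec (RT i) (z i))))"
    and split: "\<And>x. x \<in> carrier_vec n \<Longrightarrow> \<exists>z. (\<forall>i<N. z i \<in> carrier_vec (k i)) \<and>
      x = vec_family_sum n N (\<lambda>i. mult_mat_vec (RT i) (z i)) \<and>
      (\<Sum>i<N. scalar_prod (mult_mat_vec (RT i) (z i)) (mult_mat_vec (A + S) (mult_mat_vec (RT i) (z i))))
      \<le> C1 * scalar_prod x (mult_mat_vec (A + S) x)"
  shows "positive_spectrum B \<and> cond_number B \<le> C1 * C2"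
proof -
  define G where "G = A + S"
  have G: "G \<in> carrier_mat n n" using A S by (simp add: G_def)
  define b where "b x y = scalar_prod x (mult_mat_vec G y)" for x y
  note [simp] = mult_mat_vec_carrier[OF G]
  have b_sym: "b x y = b y x" if "x \<in> carrier_vec n" "y \<in> carrier_vec n" for x y
    using scalar_prod_mat_symmetric[OF G] sym that by (simp add: b_def G_def)
  have b_pos: "0 < b x x" if "x \<in> carrier_vec n" "x \<noteq> 0\<^sub>v n" for x
    using pd that by (simp add: b_def G_def)
  have b_sum: "b (vec_family_sum n N y) x = (\<Sum>i<N. b (y i) x)" if "x \<in> carrier_vec n" for x y
    using that G by (simp add: b_def scalar_prod_family_sum_left)
  have b_add: "b x (y + z) = b x y + b x z" if "x \<in> carrier_vec n" "y \<in> carrier_vec n" "z \<in> carrier_vec n" for x y z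
    using that G by (simp add: b_def mult_add_distrib_mat_vec scalar_prod_add_distrib)
  have b_diff: "b x (y - z) = b x y - b x z" if "x \<in> carrier_vec n" "y \<in> carrier_vec n" "z \<in> carrier_vec n" for x y z
    using that G by (simp add: b_def mult_minus_distrib_mat_vec scalar_prod_minus_distrib)
  have b_smult: "b x (c \<cdot>\<^sub>v y) = c * b x y" if "x \<in> carrier_vec n" "y \<in> carrier_vec n" for x y c
    using that G by (simp add: b_def mult_mat_vec)
  have b_nonneg: "0 \<le> b x x" if "x \<in> carrier_vec n" for x
    using b_pos[OF that] that G by (cases "x = 0\<^sub>v n") (auto simp: b_def)
  have Bc: "B \<in> carrier_mat n n" using B A S by auto
  define Q where "Q i = mult_mat_vec (RT i)" for i
  have Q [simp]: "Q i z \<in> carrier_vec n" if "i < N" for i z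
    using RT that unfolding Q_def by (metis carrier_matD(1) carrier_vecI dim_mult_mat_vec)
  have "\<exists>p. \<forall>i<N. p i \<in> carrier_vec (k i) \<and>
      mult_mat_vec (local_solver (RT i) A S) (mult_mat_vec G x) = Q i (p i) \<and>
      (\<forall>y\<in>carrier_vec (k i). b (Q i y) (Q i (p i)) = b (Q i y) x)" if "x \<in> carrier_vec n" for x
  proof -
    have "\<exists>z. z \<in> carrier_vec (k i) \<and>
      mult_mat_vec (local_solver (RT i) A S) (mult_mat_vec G x) = Q i z \<and>
      (\<forall>y\<in>carrier_vec (k i). b (Q i y) (Q i z) = b (Q i y) x)" if "i < N" for i
      using local_solver_projection(2)[OF A S RT[OF that] pd inj[OF that] \<open>x \<in> carrier_vec n\<close>]
      unfolding Q_def G_def b_def Bex_def .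
    then show ?thesis by metis
  qed
  \<comment> \<open>\<open>p x i\<close> collects the local coefficients of the b-orthogonal
    projection of x onto the i-th local space; the projection itself is
    \<open>Q i (p x i)\<close>.\<close>
  then obtain p where p: "p x i \<in> carrier_vec (k i)"
      "mult_mat_vec (local_solver (RT i) A S) (mult_mat_vec G x) = Q i (p x i)"
      "\<forall>y\<in>carrier_vec (k i). b (Q i y) (Q i (p x i)) = b (Q i y) x"
    if "x \<in> carrier_vec n" "i < N" for x i by metis
  have Bx: "mult_mat_vec B x = vec_family_sum n N (\<lambda>i. Q i (p x i))" if x: "x \<in> carrier_vec n" for x
  proof (intro eq_vecI)
    fix j assume "j < dim_vec (vec_family_sum n N (\<lambda>i. Q i (p x i)))"
    then have j: "j < n" by (simp add: vec_family_sum_def)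
    have ls: "local_solver (RT i) A S \<in> carrier_mat n n" if "i < N" for i
      using local_solver_projection(1)[OF A S RT pd inj] that by blast
    define w where "w = mult_mat_vec G x"
    have w: "w \<in> carrier_vec n" using x by (simp add: w_def)
    define M where "M = Matrix.mat n n (\<lambda>(j, l). \<Sum>i<N. local_solver (RT i) A S $$ (j, l))"
    have "mult_mat_vec B x = mult_mat_vec M w"
      using x G unfolding B M_def w_def G_def by (intro assoc_mult_mat_vec) auto
    then have "vec_index (mult_mat_vec B x) j
        = (\<Sum>l<n. (\<Sum>i<N. local_solver (RT i) A S $$ (j, l)) * vec_index w l)"
      using j w by (simp add: M_def scalar_prod_def atLeast0LessThan)
    also have "\<dots> = (\<Sum>i<N. \<Sum>l<n. local_solver (RT i) A S $$ (j, l) * vec_index w l)"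
      by (simp add: sum_distrib_right sum.swap[of _ "{..<N}"])
    also have "\<dots> = (\<Sum>i<N. vec_index (mult_mat_vec (local_solver (RT i) A S) w) j)"
      using carrier_matD[OF ls] j carrier_vecD[OF w]
      by (intro sum.cong) (auto simp: scalar_prod_def atLeast0LessThan)
    also have "\<dots> = vec_index (vec_family_sum n N (\<lambda>i. Q i (p x i))) j"
      using p(2) x j by (simp add: vec_family_sum_def w_def)
    finally show "vec_index (mult_mat_vec B x) j = vec_index (vec_family_sum n N (\<lambda>i. Q i (p x i))) j" .
  qed (use Bc in \<open>simp add: vec_family_sum_def\<close>)
  \<comment> \<open>Orthogonality allows the projection to be applied to both arguments, which makes
    the self-adjointness of \<open>B\<close> with respect to \<open>b\<close> visible.\<close>
  have B_b: "b x (mult_mat_vec B y) = (\<Sum>i<N. b (Q i (p x i)) (Q i (p y i)))"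
    if x: "x \<in> carrier_vec n" and y: "y \<in> carrier_vec n" for x y
  proof -
    have "b x (mult_mat_vec B y) = (\<Sum>i<N. b (Q i (p y i)) x)"
      using x y by (simp add: Bx b_sym[of x] b_sum)
    also have "\<dots> = (\<Sum>i<N. b (Q i (p x i)) (Q i (p y i)))"
      using p(3)[OF x] p(1)[OF y] by (intro sum.cong) (auto simp: b_sym[of "Q _ (p x _)"])
    finally show ?thesis .
  qed
  have B_sym: "b x (mult_mat_vec B y) = b y (mult_mat_vec B x)"
    if "x \<in> carrier_vec n" "y \<in> carrier_vec n" for x y
    using that by (simp add: B_b b_sym[of "Q _ (p x _)"])
  have bounds: "1 / C1 \<le> \<alpha> \<and> \<alpha> \<le> C2"
    if x: "x \<in> carrier_vec n" "x \<noteq> 0\<^sub>v n" and ev: "mult_mat_vec B x = \<alpha> \<cdot>\<^sub>v x" for x \<alpha>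
  proof -
    define q where "q i = Q i (p x i)" for i
    have bx: "0 < b x x" using b_pos x by blast
    have q [simp]: "q i \<in> carrier_vec n" if "i < N" for i using that by (simp add: q_def)
    have energy: "(\<Sum>i<N. b (q i) (q i)) = \<alpha> * b x x"
      using B_b[OF x(1) x(1)] x ev by (simp add: b_smult q_def)
    obtain z where z: "\<forall>i<N. z i \<in> carrier_vec (k i)" "x = vec_family_sum n N (\<lambda>i. Q i (z i))"
      "(\<Sum>i<N. b (Q i (z i)) (Q i (z i))) \<le> C1 * b x x"
      using split[OF x(1)] unfolding b_def Q_def G_def by blast
    have "b x x = (\<Sum>i<N. b (Q i (z i)) x)"
      using b_sum[OF x(1), of "\<lambda>i. Q i (z i)"] z(2) by simp
    also have "\<dots> = (\<Sum>i<N. b (Q i (z i)) (q i))"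
      using p(3)[OF x(1)] z(1) by (intro sum.cong) (auto simp: q_def)
    finally have bxx: "(\<Sum>i<N. b (Q i (z i)) (q i)) = b x x" by simp
    \<comment> \<open>Nonnegativity of \<open>b\<close> on these differences takes the place of the
      Cauchy-Schwarz inequality. With the weight \<open>C1\<close>, the bound on the decomposition
      turns the total into at most C1 b(x,x) (C1 \<alpha> - 1).\<close>
    have "0 \<le> (\<Sum>i<N. b (Q i (z i) - C1 \<cdot>\<^sub>v q i) (Q i (z i) - C1 \<cdot>\<^sub>v q i))"
      by (intro sum_nonneg b_nonneg) (auto simp: intro!: minus_carrier_vec)
    also have "\<dots> = (\<Sum>i<N. b (Q i (z i)) (Q i (z i)) - 2 * C1 * b (Q i (z i)) (q i) + C1\<^sup>2 * b (q i) (q i))"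
    proof (intro sum.cong refl)
      fix i assume "i \<in> {..<N}"
      then have i: "i < N" by simp
      let ?d = "Q i (z i) - C1 \<cdot>\<^sub>v q i"
      have d: "?d \<in> carrier_vec n" using i by (intro minus_carrier_vec) auto
      have "b ?d ?d = b ?d (Q i (z i)) - C1 * b ?d (q i)"
        using i d by (simp add: b_diff b_smult)
      also have "b ?d (Q i (z i)) = b (Q i (z i)) (Q i (z i)) - C1 * b (Q i (z i)) (q i)"
        using i d by (simp add: b_sym[of ?d] b_diff b_smult)
      also have "b ?d (q i) = b (Q i (z i)) (q i) - C1 * b (q i) (q i)"
        using i d by (simp add: b_sym[of ?d] b_diff b_smult b_sym[of "Q i (z i)"])
      finally show "b ?d ?d = b (Q i (z i)) (Q i (z i)) - 2 * C1 * b (Q i (z i)) (q i) + C1\<^sup>2 * b (q i) (q i)"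
        by (simp add: algebra_simps power2_eq_square)
    qed
    also have "\<dots> = (\<Sum>i<N. b (Q i (z i)) (Q i (z i))) - 2 * C1 * b x x + C1\<^sup>2 * (\<alpha> * b x x)"
      by (simp add: sum.distrib sum_subtractf energy bxx flip: sum_distrib_left)
    also have "\<dots> \<le> C1 * b x x * (C1 * \<alpha> - 1)"
      using z(3) by (simp add: algebra_simps power2_eq_square)
    finally have "0 \<le> C1 * \<alpha> - 1"
      using zero_le_mult_iff[of "C1 * b x x" "C1 * \<alpha> - 1"] mult_pos_pos[OF C1 bx] by linarith
    then have lower: "1 / C1 \<le> \<alpha>" using C1 by (simp add: field_simps)
    \<comment> \<open>The projections of x sum to B x = \<alpha> x, so the overlap bound compares
      \<alpha>^2 b(x,x) with C2 \<alpha> b(x,x); the lower bound just obtained makes \<alpha>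
      positive and allows division.\<close>
    have "b (mult_mat_vec B x) (mult_mat_vec B x) \<le> C2 * (\<Sum>i<N. b (q i) (q i))"
      using overlap[of "p x"] p(1)[OF x(1)] Bx[OF x(1)] unfolding b_def Q_def G_def q_def by simp
    then have "\<alpha>\<^sup>2 * b x x \<le> C2 * (\<alpha> * b x x)"
      using energy x ev by (simp add: b_smult b_sym[of "\<alpha> \<cdot>\<^sub>v x"] power2_eq_square)
    then have "\<alpha> * (\<alpha> * b x x) \<le> C2 * (\<alpha> * b x x)"
      by (simp add: power2_eq_square mult.assoc)
    moreover have "0 < 1 / C1" using C1 by simp
    then have "0 < \<alpha> * b x x" using lower bx by (intro mult_pos_pos) linarith+
    ultimately have "\<alpha> \<le> C2" by (rule mult_right_le_imp_le)
    with lower show ?thesis by blast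
  qed
  have real: "Im l = 0 \<and> eigenvalue B (Re l)"
    if ev: "eigenvector (map_mat complex_of_real B) v l" for v l
  proof -
    have v: "v \<in> carrier_vec n" using ev Bc by (auto simp: eigenvector_def)
    define x where "x = map_vec Re v"
    define y where "y = map_vec Im v"
    have xy [simp]: "x \<in> carrier_vec n" "y \<in> carrier_vec n" using v by (simp_all add: x_def y_def)
    note parts = eigenvector_of_real_parts[OF Bc ev, folded x_def y_def]
    \<comment> \<open>In the difference of the two sides the terms with Re l cancel, and Im l
      (b(x,x) + b(y,y)) remains.\<close>
    have "b x (mult_mat_vec B y) = b y (mult_mat_vec B x)" by (rule B_sym) simp_all
    then have "Im l * (b x x + b y y) = 0"
      unfolding parts(1,2) by (simp add: b_add b_diff b_smult b_sym[of y x] algebra_simps)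
    moreover have "0 < b x x + b y y"
      using parts(3) b_pos[of x] b_pos[of y] b_nonneg[of x] b_nonneg[of y] xy by fastforce
    ultimately have "Im l = 0" by simp
    have dims: "dim_vec x = n" "dim_vec y = n" using carrier_vecD xy by blast+
    have "mult_mat_vec B x = Re l \<cdot>\<^sub>v x" "mult_mat_vec B y = Re l \<cdot>\<^sub>v y"
      unfolding parts(1,2) \<open>Im l = 0\<close> by (auto intro!: eq_vecI simp: dims)
    then have "eigenvector B x (Re l) \<or> eigenvector B y (Re l)"
      using parts(3) Bc xy by (auto simp: eigenvector_def)
    with \<open>Im l = 0\<close> show ?thesis by (auto simp: eigenvalue_def)
  qed
  have spec: "1 / C1 \<le> \<alpha> \<and> \<alpha> \<le> C2" if "\<alpha> \<in> spectrum B" for \<alpha>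
    using that bounds Bc by (auto simp: spectrum_def eigenvalue_def eigenvector_def)
  have "positive_spectrum B"
    unfolding positive_spectrum_def
  proof
    fix l assume "l \<in> spectrum (map_mat complex_of_real B)"
    then have "Im l = 0" "Re l \<in> spectrum B"
      using real by (auto simp: spectrum_def eigenvalue_def)
    then have "l = complex_of_real (Re l)" "0 < Re l"
      using spec[of "Re l"] C1 by (auto simp: complex_eq_iff intro: less_le_trans[of 0 "1 / C1"])
    then show "l \<in> complex_of_real ` {0<..}" by blast
  qed
  moreover have "cond_number B \<le> C1 * C2"
  proof -
    \<comment> \<open>Existence of an eigenvalue is a complex fact; since all complex eigenvalues
      are real, the real spectrum is nonempty too, and \<open>Max\<close> and \<open>Min\<close> are
      attained.\<close>
    have "map_mat complex_of_real B \<in> carrier_mat n n" using Bc by simp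
    from spectrum_non_empty[OF this n] have ne: "spectrum B \<noteq> {}"
      using real unfolding spectrum_def eigenvalue_def by blast
    note fin = card_finite_spectrum(1)[OF Bc]
    have "Max (spectrum B) \<le> C2" "1 / C1 \<le> Min (spectrum B)" and pos: "0 < Max (spectrum B)"
      using spec Max_in[OF fin ne] Min_in[OF fin ne] C1
      by (auto intro: less_le_trans[of 0 "1 / C1"])
    then have "Max (spectrum B) / Min (spectrum B) \<le> C2 / (1 / C1)"
      using C1 by (intro frac_le) auto
    then show ?thesis by (simp add: cond_number_def mult.commute)
  qed
  ultimately show ?thesis ..
qed

section \<open>Piecewise linear functions on a triangulation\<close>

text \<open>With one point moved to the origin, the others become linearly independent, so the
  increments of \<open>g\<close> extend to a linear form; its adjoint at 1 is the vector
  representing it.\<close>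

lemma affine_independent_affine_interpolation:
  fixes C :: "'a::euclidean_space set"
  assumes "\<not> affine_dependent C"
  obtains c b where "\<And>z. z \<in> C \<Longrightarrow> c + inner b z = g z"
proof (cases "C = {}")
  case False
  then obtain a where a: "a \<in> C" by blast
  let ?S = "(\<lambda>x. - a + x) ` (C - {a})"
  have "independent ?S"
    using assms affine_dependent_iff_dependent2[OF a] by blast
  then obtain f :: "'a \<Rightarrow> real" where f: "linear f" "\<And>x. x \<in> ?S \<Longrightarrow> f x = g (a + x) - g a"
    using linear_independent_extend[of ?S "\<lambda>x. g (a + x) - g a"] by blast
  define b where "b = adjoint f 1"
  have b: "inner b x = f x" for x
    using adjoint_works[OF f(1), of x 1] by (simp add: b_def inner_commute)
  have "(g a - inner b a) + inner b z = g z" if "z \<in> C" for z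
  proof (cases "z = a")
    case False
    then have "f (- a + z) = g z - g a"
      using f(2)[of "- a + z"] that by auto
    then show ?thesis by (simp add: b linear_diff[OF f(1)])
  qed simp
  then show thesis using that by blast
qed (use that in auto)

lemma affine_eq_on_convex_hull:
  fixes b b' :: "'a::real_inner"
  assumes "\<And>z. z \<in> C \<Longrightarrow> c + inner b z = c' + inner b' z" "x \<in> convex hull C"
  shows "c + inner b x = c' + inner b' x"
proof -
  have "{x. inner (b - b') x = c' - c} = {x. c + inner b x = c' + inner b' x}"
    by (auto simp: inner_diff_left)
  then have "convex {x. c + inner b x = c' + inner b' x}"
    using convex_hyperplane[of "b - b'" "c' - c"] by simp
  then have "convex hull C \<subseteq> {x. c + inner b x = c' + inner b' x}"
    using assms(1) by (intro hull_minimal) auto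
  with assms(2) show ?thesis by auto
qed

section \<open>Vector space operations on finite element functions\<close>

lemma P1_zero: "(\<lambda>x. 0) \<in> P1 \<T>"
  unfolding P1_def by (auto intro!: exI[of _ 0])

lemma P1_add: "u \<in> P1 \<T> \<Longrightarrow> v \<in> P1 \<T> \<Longrightarrow> (\<lambda>x. u x + v x) \<in> P1 \<T>"
  unfolding P1_def
proof (clarsimp, intro conjI ballI)
  fix T
  assume "\<forall>T\<in>\<T>. \<exists>c b. \<forall>x\<in>T. u x = c + inner b x" "\<forall>T\<in>\<T>. \<exists>c b. \<forall>x\<in>T. v x = c + inner b x" "T \<in> \<T>"
  then obtain c b c' b' where "\<forall>x\<in>T. u x = c + inner b x" "\<forall>x\<in>T. v x = c' + inner b' x" by meson
  then show "\<exists>c b. \<forall>x\<in>T. u x + v x = c + inner b x"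
    by (intro exI[of _ "c + c'"] exI[of _ "b + b'"]) (simp add: inner_add_left)
qed (intro continuous_intros)

lemma P1_scale: "u \<in> P1 \<T> \<Longrightarrow> (\<lambda>x. r * u x) \<in> P1 \<T>"
  unfolding P1_def
proof (clarsimp, intro conjI ballI)
  fix T
  assume "\<forall>T\<in>\<T>. \<exists>c b. \<forall>x\<in>T. u x = c + inner b x" "T \<in> \<T>"
  then obtain c b where "\<forall>x\<in>T. u x = c + inner b x" by meson
  then show "\<exists>c b. \<forall>x\<in>T. r * u x = c + inner b x"
    by (intro exI[of _ "r * c"] exI[of _ "r *\<^sub>R b"]) (simp add: distrib_left)
qed (intro continuous_intros)

lemma P1_sum: "(\<And>i. i \<in> I \<Longrightarrow> u i \<in> P1 \<T>) \<Longrightarrow> (\<lambda>x. \<Sum>i\<in>I. u i x) \<in> P1 \<T>"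
  by (induction I rule: infinite_finite_induct) (auto simp: P1_zero intro: P1_add)

lemma P1_outside: "u \<in> P1 \<T> \<Longrightarrow> x \<notin> \<Union>\<T> \<Longrightarrow> u x = 0"
  by (simp add: P1_def)

lemma P1_affine: "u \<in> P1 \<T> \<Longrightarrow> T \<in> \<T> \<Longrightarrow> \<exists>c b. \<forall>x\<in>T. u x = c + inner b x"
  by (simp add: P1_def)

lemma grad_eqI: "GDERIV f x :> D \<Longrightarrow> grad f x = D"
proof -
  assume "GDERIV f x :> D"
  then have "frechet_derivative f (at x) = (\<lambda>h. inner h D)"
    unfolding gderiv_def by (metis frechet_derivative_at)
  then show ?thesis
    using euclidean_representation[of D] by (simp add: grad_def inner_commute[of _ D])
qed

text \<open>The property of \<open>D\<close> that makes the nodes in \<open>D\<close> degrees of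
  freedom: hat functions of these nodes then lie in \<open>P1_0 \<T> D\<close>. It is established
  for \<Omega> and for the layered subdomains.\<close>

definition mesh_resolves :: "'a::euclidean_space set set \<Rightarrow> 'a set \<Rightarrow> bool" where
  "mesh_resolves \<T> D \<longleftrightarrow>
     (\<forall>w\<in>P1 \<T>. (\<forall>z\<in>nodes \<T> - D. w z = 0) \<longrightarrow> (\<forall>x. x \<notin> D \<longrightarrow> w x = 0))"

section \<open>Conforming meshes, nodal interpolation and the geometry of subdomains\<close>

locale fe_mesh =
  fixes \<Omega> :: "'a::euclidean_space set" and h :: real and \<T> :: "'a set set"
  assumes open_dom: "open \<Omega>" and bounded_dom: "bounded \<Omega>" and mesh: "fine_mesh \<Omega> h \<T>"
begin

lemma finite_mesh: "finite \<T>"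
  using mesh by (auto simp: fine_mesh_def triangulation_def)

lemma simplex_mesh: "T \<in> \<T> \<Longrightarrow> int DIM('a) simplex T"
  using mesh by (auto simp: fine_mesh_def)

lemma Union_mesh: "\<Union>\<T> = closure \<Omega>"
  using mesh by (auto simp: fine_mesh_def)

lemma face_mesh: "T \<in> \<T> \<Longrightarrow> T' \<in> \<T> \<Longrightarrow> (T \<inter> T') face_of T"
  using mesh by (auto simp: fine_mesh_def triangulation_def)

lemma compact_element: "T \<in> \<T> \<Longrightarrow> compact T"
  using simplex_mesh compact_simplex by blast

lemma closed_element: "T \<in> \<T> \<Longrightarrow> closed T"
  using compact_element compact_imp_closed by blast

lemma convex_element: "T \<in> \<T> \<Longrightarrow> convex T"
  using simplex_mesh convex_simplex by blast

text \<open>A simplex of full dimension has nonempty interior, and a closed convex set with nonempty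
  interior is the closure of that interior.\<close>

lemma interior_element: "T \<in> \<T> \<Longrightarrow> closure (interior T) = T"
proof -
  assume T: "T \<in> \<T>"
  have "affine hull T = UNIV"
    using aff_dim_simplex[OF simplex_mesh[OF T]] by (simp add: aff_dim_eq_full)
  then have "interior T \<noteq> {}"
    using rel_interior_interior rel_interior_eq_empty[OF convex_element[OF T]] by fastforce
  then show ?thesis
    using convex_closure_interior[OF convex_element[OF T]] closed_element[OF T] by simp
qed

text \<open>By conformity the intersection is a face of \<open>T\<close>, and a face that meets the
  interior is all of \<open>T\<close>.\<close>

lemma element_subset_of_interior_point:
  assumes "T \<in> \<T>" "T' \<in> \<T>" "x \<in> interior T" "x \<in> T'"
  shows "T \<subseteq> T'"
proof -
  have "(T \<inter> T') \<inter> interior T \<noteq> {}" using assms interior_subset by blast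
  then have "T \<inter> T' = T"
    using face_of_disjoint_interior[OF face_mesh[OF assms(1,2)]] by blast
  then show ?thesis by blast
qed

lemma extreme_points_element:
  assumes "T \<in> \<T>" "F face_of T"
  shows "F = Convex.convex hull {z. z extreme_point_of F}" and "{z. z extreme_point_of F} \<subseteq> nodes \<T>"
proof -
  have "compact F" "convex F"
    using assms compact_element convex_element face_of_imp_compact face_of_imp_convex by blast+
  then show "F = Convex.convex hull {z. z extreme_point_of F}"
    using Krein_Milman_Minkowski by blast
  show "{z. z extreme_point_of F} \<subseteq> nodes \<T>"
    using assms extreme_point_of_face by (auto simp: nodes_def)
qed

lemma P1_zero_on_face:
  assumes w: "w \<in> P1 \<T>" and T: "T \<in> \<T>" and F: "F face_of T"
    and zero: "\<And>z. z \<in> nodes \<T> \<Longrightarrow> z \<in> F \<Longrightarrow> w z = 0" and x: "x \<in> F"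
  shows "w x = 0"
proof -
  obtain c b where cb: "\<And>x. x \<in> T \<Longrightarrow> w x = c + inner b x"
    using P1_affine[OF w T] by blast
  have FT: "F \<subseteq> T" using F face_of_imp_subset by blast
  have "c + inner b z = 0 + inner 0 z" if "z extreme_point_of F" for z
    using that zero extreme_points_element(2)[OF T F] cb FT extreme_point_of_def
    by (metis add.right_neutral inner_zero_left mem_Collect_eq subsetD)
  then have "c + inner b x = 0 + inner 0 x"
    using affine_eq_on_convex_hull[of "{z. z extreme_point_of F}" c b 0 0 x] x extreme_points_element(1)[OF T F]
    by auto
  then show ?thesis using cb FT x by auto
qed

lemma P1_eqI:
  assumes u: "u \<in> P1 \<T>" and v: "v \<in> P1 \<T>" and eq: "\<And>z. z \<in> nodes \<T> \<Longrightarrow> u z = v z"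
  shows "u = v"
proof
  fix x
  have w: "(\<lambda>x. u x + (-1) * v x) \<in> P1 \<T>" using u v by (intro P1_add P1_scale)
  show "u x = v x"
  proof (cases "x \<in> \<Union>\<T>")
    case True
    then obtain T where T: "T \<in> \<T>" "x \<in> T" by blast
    have "u x + (-1) * v x = 0"
      using P1_zero_on_face[OF w T(1) face_of_refl[OF convex_element[OF T(1)]] _ T(2)] eq by simp
    then show ?thesis by simp
  next
    case False
    then show ?thesis using P1_outside u v by metis
  qed
qed

text \<open>Each simplex has its own affine interpolant. Two of them agree where elements meet,
  because the intersection is a common face and its vertices are nodes of both; gluing finitely many
  closed pieces then keeps continuity.\<close>

lemma P1_interpolation: "\<exists>w\<in>P1 \<T>. \<forall>z\<in>nodes \<T>. w z = g z"
proof -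
  have "\<exists>c b. \<forall>z. z extreme_point_of T \<longrightarrow> c + inner b z = g z" if T: "T \<in> \<T>" for T
  proof -
    obtain C where C: "\<not> affine_dependent C" "T = Convex.convex hull C"
      using simplex_mesh[OF T] by (auto simp: simplex_def)
    obtain c b where "\<And>z. z \<in> C \<Longrightarrow> c + inner b z = g z"
      using affine_independent_affine_interpolation[OF C(1), of g] by blast
    then show ?thesis using C extreme_point_of_convex_hull by blast
  qed
  then obtain c b where cb: "\<And>T z. T \<in> \<T> \<Longrightarrow> z extreme_point_of T \<Longrightarrow> c T + inner (b T) z = g z"
    by metis
  have agree: "c T + inner (b T) x = c T' + inner (b T') x" if TT: "T \<in> \<T>" "T' \<in> \<T>" "x \<in> T" "x \<in> T'" for T T' x
  proof -
    let ?F = "T \<inter> T'"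
    have F: "?F face_of T" "?F face_of T'"
      using face_mesh TT by (simp, metis Int_commute)
    show ?thesis
    proof (rule affine_eq_on_convex_hull)
      show "c T + inner (b T) z = c T' + inner (b T') z" if "z \<in> {z. z extreme_point_of ?F}" for z
        using that cb TT extreme_point_of_face F by (metis mem_Collect_eq)
      show "x \<in> Convex.convex hull {z. z extreme_point_of ?F}"
        using extreme_points_element(1)[OF TT(1) F(1)] TT by blast
    qed
  qed
  \<comment> \<open>An arbitrary element containing the point will do: by \<open>agree\<close> the
    value does not depend on the choice.\<close>
  define el where "el x = (SOME T. T \<in> \<T> \<and> x \<in> T)" for x
  define w where "w x = (if x \<in> \<Union>\<T> then c (el x) + inner (b (el x)) x else 0)" for x
  have w: "w x = c T + inner (b T) x" if "T \<in> \<T>" "x \<in> T" for T x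
  proof -
    have "el x \<in> \<T> \<and> x \<in> el x" unfolding el_def using that by (metis (mono_tags, lifting) someI)
    then show ?thesis using that agree[of "el x" T x] unfolding w_def by (metis UnionI)
  qed
  have "continuous_on (\<Union>T\<in>\<T>. T) w"
  proof (rule continuous_on_closed_Union)
    show "continuous_on T w" if "T \<in> \<T>" for T
      using w[OF that] by (subst continuous_on_cong[OF refl, of _ _ "\<lambda>x. c T + inner (b T) x"])
        (auto intro!: continuous_intros)
  qed (auto simp: finite_mesh closed_element)
  then have "w \<in> P1 \<T>" unfolding P1_def using w by (auto simp: w_def)
  moreover have "w z = g z" if "z \<in> nodes \<T>" for z
    using that w cb by (auto simp: nodes_def extreme_point_of_def)
  ultimately show ?thesis by blast
qed

lemma nodal_interpolant: "nodal_interpolant \<T> g \<in> P1 \<T>" "z \<in> nodes \<T> \<Longrightarrow> nodal_interpolant \<T> g z = g z"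
proof -
  have "\<exists>!w. w \<in> P1 \<T> \<and> (\<forall>z\<in>nodes \<T>. w z = g z)"
    using P1_interpolation[of g] P1_eqI by metis
  from theI'[OF this] show "nodal_interpolant \<T> g \<in> P1 \<T>" "z \<in> nodes \<T> \<Longrightarrow> nodal_interpolant \<T> g z = g z"
    by (simp_all add: nodal_interpolant_def)
qed

text \<open>Among resolved sets containing a node, its basis function is always the same global hat
  function. Hence extension by zero will turn out to be a plain selection of coefficients.\<close>

lemma nodal_basis_eq:
  assumes D: "mesh_resolves \<T> D" and z: "z \<in> nodes \<T> \<inter> D"
  shows "nodal_basis \<T> D z = nodal_interpolant \<T> (\<lambda>y. if y = z then 1 else 0)" (is "_ = ?w")
    and "nodal_basis \<T> D z \<in> P1_0 \<T> D"
proof -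
  have "\<forall>y\<in>nodes \<T> - D. ?w y = 0" using nodal_interpolant(2) z by auto
  then have "?w x = 0" if "x \<notin> D" for x
    using D nodal_interpolant(1) that unfolding mesh_resolves_def by blast
  then have w: "?w \<in> P1_0 \<T> D" by (simp add: P1_0_def nodal_interpolant(1))
  show "nodal_basis \<T> D z = ?w"
    unfolding nodal_basis_def
  proof (rule the_equality)
    show "?w \<in> P1_0 \<T> D \<and> (\<forall>y\<in>nodes \<T> \<inter> D. ?w y = (if y = z then 1 else 0))"
      using w nodal_interpolant(2) by auto
    fix v assume v: "v \<in> P1_0 \<T> D \<and> (\<forall>y\<in>nodes \<T> \<inter> D. v y = (if y = z then 1 else 0))"
    show "v = ?w"
    proof (rule P1_eqI)
      fix y assume "y \<in> nodes \<T>"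
      then show "v y = ?w y" using v w z nodal_interpolant(2)[of y] by (cases "y \<in> D") (auto simp: P1_0_def)
    qed (use v nodal_interpolant in \<open>auto simp: P1_0_def\<close>)
  qed
  with w show "nodal_basis \<T> D z \<in> P1_0 \<T> D" by simp
qed

text \<open>A boundary point lies in a mesh face contained in the boundary of \<Omega>, and all
  nodes of that face avoid the open set \<Omega>, so \<open>P1_zero_on_face\<close> applies. Off the
  closed mesh, functions are zero by convention.\<close>

lemma mesh_resolves_domain: "mesh_resolves \<T> \<Omega>"
  unfolding mesh_resolves_def
proof (intro ballI impI allI)
  fix w x assume w: "w \<in> P1 \<T>" and zero: "\<forall>z\<in>nodes \<T> - \<Omega>. w z = 0" and x: "x \<notin> \<Omega>"
  show "w x = 0"
  proof (cases "x \<in> \<Union>\<T>")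
    case True
    then have "x \<in> frontier \<Omega>"
      using x Union_mesh open_dom by (auto simp: frontier_def interior_open)
    moreover obtain \<F> where "\<forall>F\<in>\<F>. \<exists>T\<in>\<T>. F face_of T" "frontier \<Omega> = \<Union>\<F>"
      using mesh by (auto simp: fine_mesh_def)
    ultimately obtain T F where F: "T \<in> \<T>" "F face_of T" "F \<subseteq> frontier \<Omega>" "x \<in> F"
      by (metis Union_iff Union_upper)
    moreover have "frontier \<Omega> \<inter> \<Omega> = {}" using open_dom by (auto simp: frontier_def interior_open)
    ultimately show ?thesis using P1_zero_on_face[OF w F(1,2)] zero by blast
  qed (use w P1_outside in blast)
qed

text \<open>With at least one layer the extended region is a finite union of closed elements, so its
  complement is open. A point interior to an element cannot lie in the region without that whole
  element belonging to it, which would put the point in the subdomain. The neighbourhood obtained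
  makes gradients of local functions vanish at such points.\<close>

lemma off_subdomain:
  assumes "1 \<le> m" "T \<in> \<T>" "x \<in> interior T" "x \<in> \<Omega>" "x \<notin> subdomain \<Omega> \<T> U m"
  obtains N where "open N" "x \<in> N" "N \<subseteq> \<Omega> - subdomain \<Omega> \<T> U m"
proof -
  obtain k where m: "m = Suc k" using \<open>1 \<le> m\<close> by (cases m) auto
  define \<S> where "\<S> = {T\<in>\<T>. T \<inter> extend_by_layers \<T> U k \<noteq> {}}"
  have E: "extend_by_layers \<T> U m = \<Union>\<S>" by (simp add: m \<S>_def)
  have "x \<notin> \<Union>\<S>"
  proof
    assume "x \<in> \<Union>\<S>"
    then obtain S where S: "S \<in> \<S>" "x \<in> S" by blast
    then have "T \<subseteq> S" using element_subset_of_interior_point assms by (auto simp: \<S>_def)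
    then have "x \<in> interior (\<Union>\<S>)" using S assms(3) by (meson Union_upper interior_mono subsetD)
    then show False using assms by (simp add: subdomain_def E)
  qed
  moreover have "closed (\<Union>\<S>)"
    using finite_mesh closed_element by (intro closed_Union) (auto simp: \<S>_def)
  moreover have "\<Omega> \<inter> - \<Union>\<S> \<subseteq> \<Omega> - subdomain \<Omega> \<T> U m"
    using interior_subset by (auto simp: subdomain_def E)
  ultimately show thesis
    using that[of "\<Omega> \<inter> - \<Union>\<S>"] assms open_dom by (auto simp: open_Compl)
qed

text \<open>A point of \<Omega> off the subdomain lies in some element that is not absorbed by the
  layered region. Such an element is disjoint from the subdomain, so all its nodes carry the value
  zero.\<close>

lemma mesh_resolves_subdomain:
  assumes "1 \<le> m"
  shows "mesh_resolves \<T> (subdomain \<Omega> \<T> U m)"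
  unfolding mesh_resolves_def
proof (intro ballI impI allI)
  obtain k where m: "m = Suc k" using \<open>1 \<le> m\<close> by (cases m) auto
  define \<S> where "\<S> = {T\<in>\<T>. T \<inter> extend_by_layers \<T> U k \<noteq> {}}"
  have D: "subdomain \<Omega> \<T> U m = \<Omega> \<inter> interior (\<Union>\<S>)" by (simp add: m \<S>_def subdomain_def)
  fix w x assume w: "w \<in> P1 \<T>" and zero: "\<forall>z\<in>nodes \<T> - subdomain \<Omega> \<T> U m. w z = 0"
    and x: "x \<notin> subdomain \<Omega> \<T> U m"
  show "w x = 0"
  proof (cases "x \<in> \<Omega>")
    case False
    have "\<forall>z\<in>nodes \<T> - \<Omega>. w z = 0" using zero by (auto simp: D)
    then show ?thesis using mesh_resolves_domain w False by (auto simp: mesh_resolves_def)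
  next
    case True
    then have xE: "x \<notin> interior (\<Union>\<S>)" using x D by blast
    have "\<exists>T\<in>\<T>. x \<in> T \<and> \<not> T \<subseteq> \<Union>\<S>"
    proof (rule ccontr)
      assume all: "\<not> ?thesis"
      \<comment> \<open>A neighbourhood of x that meets only elements containing x; if all of these
        were absorbed, x would be interior to the region.\<close>
      let ?N = "\<Omega> \<inter> - \<Union>{T\<in>\<T>. x \<notin> T}"
      have "closed (\<Union>{T\<in>\<T>. x \<notin> T})" using finite_mesh closed_element by (intro closed_Union) auto
      then have "open ?N" using open_dom by auto
      moreover have "?N \<subseteq> \<Union>\<S>"
      proof
        fix y assume y: "y \<in> ?N"
        then obtain T where "T \<in> \<T>" "y \<in> T" using Union_mesh closure_subset by blast
        with y all show "y \<in> \<Union>\<S>" by blast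
      qed
      ultimately have "?N \<subseteq> interior (\<Union>\<S>)" by (simp add: interior_maximal)
      then show False using xE True by blast
    qed
    then obtain T where T: "T \<in> \<T>" "x \<in> T" "\<not> T \<subseteq> \<Union>\<S>" by blast
    \<comment> \<open>Since \<open>T\<close> is the closure of its interior, an open set that meets
      \<open>T\<close> meets its interior, and this forces \<open>T\<close> into one of the selected
      elements.\<close>
    have "z \<notin> subdomain \<Omega> \<T> U m" if z: "z \<in> T" for z
    proof
      assume "z \<in> subdomain \<Omega> \<T> U m"
      then have "interior (\<Union>\<S>) \<inter> closure (interior T) \<noteq> {}"
        using z interior_element[OF T(1)] by (auto simp: D)
      then obtain y where y: "y \<in> interior (\<Union>\<S>)" "y \<in> interior T"
        using open_Int_closure_eq_empty by (metis disjoint_iff open_interior)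
      then obtain S where S: "S \<in> \<S>" "y \<in> S" using interior_subset by blast
      then have "T \<subseteq> S" using element_subset_of_interior_point T y by (auto simp: \<S>_def)
      then show False using T S by blast
    qed
    then show ?thesis
      using P1_zero_on_face[OF w T(1) face_of_refl[OF convex_element[OF T(1)]] _ T(2)] zero by blast
  qed
qed

section \<open>Gradients inside the elements\<close>

lemma P1_gderiv:
  assumes "w \<in> P1 \<T>" "T \<in> \<T>"
  obtains b where "\<And>x. x \<in> interior T \<Longrightarrow> GDERIV w x :> b"
    and "\<And>x y. x \<in> T \<Longrightarrow> y \<in> T \<Longrightarrow> w x - w y = inner b (x - y)"
proof -
  obtain c b where cb: "\<And>x. x \<in> T \<Longrightarrow> w x = c + inner b x" using P1_affine[OF assms] by blast
  show thesis
  proof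
    show "GDERIV w x :> b" if x: "x \<in> interior T" for x
    proof -
      have "((\<lambda>x. c + inner b x) has_derivative (\<lambda>h. inner h b)) (at x)"
        by (auto intro!: derivative_eq_intros simp: inner_commute)
      then show ?thesis unfolding gderiv_def
        by (rule has_derivative_transform_within_open[OF _ open_interior x])
          (use cb interior_subset in force)
    qed
    show "w x - w y = inner b (x - y)" if "x \<in> T" "y \<in> T" for x y
      using that by (simp add: cb inner_diff_right)
  qed
qed

lemma P1_gderiv_grad: "w \<in> P1 \<T> \<Longrightarrow> T \<in> \<T> \<Longrightarrow> x \<in> interior T \<Longrightarrow> GDERIV w x :> grad w x"
  using P1_gderiv[of w T] grad_eqI by metis

text \<open>Boundaries of convex sets are null sets, and there are finitely many elements. Gradient
  identities are therefore checked only in element interiors.\<close>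

lemma AE_element_interior: "AE x in lebesgue_on \<Omega>. \<exists>T\<in>\<T>. x \<in> interior T"
proof -
  have "negligible (\<Union>T\<in>\<T>. frontier T)"
    using finite_mesh by (intro negligible_Union) (auto simp: negligible_convex_frontier convex_element)
  then have "AE x in lebesgue. x \<notin> (\<Union>T\<in>\<T>. frontier T)"
    using AE_not_in negligible_iff_null_sets by blast
  then have "AE x in lebesgue. x \<in> \<Omega> \<longrightarrow> (\<exists>T\<in>\<T>. x \<in> interior T)"
  proof eventually_elim
    case (elim x)
    show ?case
    proof
      assume "x \<in> \<Omega>"
      then obtain T where "T \<in> \<T>" "x \<in> T" using Union_mesh closure_subset by blast
      with elim closed_element show "\<exists>T\<in>\<T>. x \<in> interior T" by (auto simp: frontier_def)
    qed
  qed
  then show ?thesis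
    using open_dom by (simp add: AE_restrict_space_iff borel_open)
qed

end

section \<open>Essentially bounded functions and the weighted inner product\<close>

text \<open>A class that contains \<kappa>, finite element functions, their gradients and auxiliary
  functions, and that is closed under sums and products; on sets of finite measure it makes all
  integrands of the two forms integrable.\<close>

definition Linf_on :: "'a::euclidean_space set \<Rightarrow> ('a \<Rightarrow> 'b::euclidean_space) \<Rightarrow> bool" where
  "Linf_on U f \<longleftrightarrow> f \<in> borel_measurable (lebesgue_on U) \<and> (\<exists>C. AE x in lebesgue_on U. norm (f x) \<le> C)"

lemma Linf_onI:
  "f \<in> borel_measurable (lebesgue_on U) \<Longrightarrow> AE x in lebesgue_on U. norm (f x) \<le> C \<Longrightarrow> Linf_on U f"
  by (auto simp: Linf_on_def)

lemma Linf_on_nonneg_bound: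
  assumes "Linf_on U f"
  obtains C where "0 \<le> C" "AE x in lebesgue_on U. norm (f x) \<le> C"
proof -
  obtain C where "AE x in lebesgue_on U. norm (f x) \<le> C" using assms by (auto simp: Linf_on_def)
  then have "AE x in lebesgue_on U. norm (f x) \<le> max C 0" by eventually_elim auto
  then show thesis using that[of "max C 0"] by simp
qed

lemma Linf_on_measurable: "Linf_on U f \<Longrightarrow> f \<in> borel_measurable (lebesgue_on U)"
  by (simp add: Linf_on_def)

lemma Linf_on_const: "Linf_on U (\<lambda>x. c)"
  by (rule Linf_onI[where C = "norm c"]) auto

lemma Linf_on_add:
  assumes "Linf_on U f" "Linf_on U g" shows "Linf_on U (\<lambda>x. f x + g x)"
proof -
  obtain C D where CD: "AE x in lebesgue_on U. norm (f x) \<le> C" "AE x in lebesgue_on U. norm (g x) \<le> D"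
    using assms by (auto simp: Linf_on_def)
  show ?thesis
  proof (rule Linf_onI)
    show "AE x in lebesgue_on U. norm (f x + g x) \<le> C + D"
      using CD by eventually_elim (rule norm_triangle_mono)
  qed (intro borel_measurable_add Linf_on_measurable assms)
qed

lemma Linf_on_scaleR:
  assumes "Linf_on U f" "Linf_on U g" shows "Linf_on U (\<lambda>x. f x *\<^sub>R g x)"
proof -
  obtain C D where C: "0 \<le> C" "AE x in lebesgue_on U. norm (f x) \<le> C"
    and D: "0 \<le> D" "AE x in lebesgue_on U. norm (g x) \<le> D"
    using Linf_on_nonneg_bound assms by metis
  show ?thesis
  proof (rule Linf_onI)
    show "AE x in lebesgue_on U. norm (f x *\<^sub>R g x) \<le> C * D"
      using C(2) D(2) by eventually_elim (use C(1) in \<open>auto intro!: mult_mono\<close>)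
  qed (intro borel_measurable_scaleR Linf_on_measurable assms)
qed

lemma Linf_on_mult: "Linf_on U f \<Longrightarrow> Linf_on U g \<Longrightarrow> Linf_on U (\<lambda>x. f x * g x :: real)"
  using Linf_on_scaleR[of U f g] by simp

lemma Linf_on_inner:
  assumes "Linf_on U f" "Linf_on U g" shows "Linf_on U (\<lambda>x. inner (f x) (g x))"
proof -
  obtain C D where C: "0 \<le> C" "AE x in lebesgue_on U. norm (f x) \<le> C"
    and D: "0 \<le> D" "AE x in lebesgue_on U. norm (g x) \<le> D"
    using Linf_on_nonneg_bound assms by metis
  show ?thesis
  proof (rule Linf_onI)
    show "AE x in lebesgue_on U. norm (inner (f x) (g x)) \<le> C * D"
      using C(2) D(2)
    proof eventually_elim
      case (elim x)
      have "norm (inner (f x) (g x)) \<le> norm (f x) * norm (g x)" using Cauchy_Schwarz_ineq2 by simp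
      also have "\<dots> \<le> C * D" using elim C(1) by (intro mult_mono) auto
      finally show ?case .
    qed
  qed (intro borel_measurable_inner Linf_on_measurable assms)
qed

lemma Linf_on_sum: "(\<And>i. i \<in> I \<Longrightarrow> Linf_on U (f i)) \<Longrightarrow> Linf_on U (\<lambda>x. \<Sum>i\<in>I. f i x)"
  by (induction I rule: infinite_finite_induct) (auto simp: Linf_on_const intro: Linf_on_add)

lemma Linf_on_cmult: "Linf_on U f \<Longrightarrow> Linf_on U (\<lambda>x. c *\<^sub>R f x)"
  using Linf_on_scaleR[OF Linf_on_const] .

lemma Linf_on_diff: "Linf_on U f \<Longrightarrow> Linf_on U g \<Longrightarrow> Linf_on U (\<lambda>x. f x - g x)"
  using Linf_on_add[of U f "\<lambda>x. (-1) *\<^sub>R g x"] Linf_on_cmult[of U g "-1"] by simp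

lemma Linf_on_indicator:
  assumes "S \<in> sets lebesgue" shows "Linf_on U (indicat_real S)"
proof (rule Linf_onI)
  have "indicat_real S \<in> borel_measurable lebesgue" using assms by simp
  then show "indicat_real S \<in> borel_measurable (lebesgue_on U)" by (rule measurable_restrict_space1)
  show "AE x in lebesgue_on U. norm (indicat_real S x) \<le> 1" by (auto simp: indicator_def)
qed

text \<open>Completeness of Lebesgue measure, applied after extension by zero. It supplies
  measurability of pointwise gradients, which are only known off a null set.\<close>

lemma measurable_AE_lebesgue_on:
  fixes f g :: "'a::euclidean_space \<Rightarrow> 'b::euclidean_space"
  assumes U: "U \<in> sets lebesgue" and f: "f \<in> borel_measurable (lebesgue_on U)"
    and eq: "AE x in lebesgue_on U. f x = g x"
  shows "g \<in> borel_measurable (lebesgue_on U)"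
proof -
  have "(\<lambda>x. if x \<in> U then f x else 0) \<in> borel_measurable lebesgue"
    using borel_measurable_if[OF U] f by blast
  moreover have "AE x in lebesgue. (if x \<in> U then f x else 0) = (if x \<in> U then g x else 0)"
    using eq U by (auto simp: AE_restrict_space_iff elim!: eventually_mono)
  ultimately have "(\<lambda>x. if x \<in> U then g x else 0) \<in> borel_measurable lebesgue"
    by (rule borel_measurable_AE)
  then show ?thesis using borel_measurable_if[OF U] by blast
qed

lemma Linf_on_AE_cong:
  fixes f g :: "'a::euclidean_space \<Rightarrow> 'b::euclidean_space"
  assumes U: "U \<in> sets lebesgue" and f: "Linf_on U f" and eq: "AE x in lebesgue_on U. f x = g x"
  shows "Linf_on U g"
proof -
  obtain C where C: "AE x in lebesgue_on U. norm (f x) \<le> C" using f by (auto simp: Linf_on_def)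
  show ?thesis
  proof (rule Linf_onI)
    show "g \<in> borel_measurable (lebesgue_on U)"
      using measurable_AE_lebesgue_on[OF U Linf_on_measurable[OF f] eq] .
    show "AE x in lebesgue_on U. norm (g x) \<le> C"
      using C eq by eventually_elim simp
  qed
qed

lemma AE_lebesgue_on_subset:
  assumes "V \<in> sets lebesgue" "U \<in> sets lebesgue" "V \<subseteq> U" "AE x in lebesgue_on U. Q x"
  shows "AE x in lebesgue_on V. Q x"
  using assms by (auto simp: AE_restrict_space_iff elim!: eventually_mono)

lemma Linf_on_subset:
  assumes "V \<in> sets lebesgue" "U \<in> sets lebesgue" "V \<subseteq> U" "Linf_on U f" shows "Linf_on V f"
  using assms AE_lebesgue_on_subset[OF assms(1-3)] measurable_restrict_mono[of f lebesgue U borel V]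
  unfolding Linf_on_def by blast

lemma Linf_on_integrable:
  assumes "U \<in> lmeasurable" "Linf_on U f" shows "integrable (lebesgue_on U) f"
proof -
  obtain C where "AE x in lebesgue_on U. norm (f x) \<le> C" using assms by (auto simp: Linf_on_def)
  then show ?thesis
    using finite_measure.integrable_const_bound[OF finite_measure_lebesgue_on[OF assms(1)]] assms
    by (auto simp: Linf_on_def)
qed

lemma Linf_on_L2_on:
  assumes "U \<in> lmeasurable" "Linf_on U f" shows "L2_on U f"
  using Linf_on_integrable[OF assms(1) Linf_on_inner[OF assms(2,2)]] assms(2)
  by (simp add: L2_on_def Linf_on_measurable power2_norm_eq_inner)

text \<open>The common form behind \<open>a_form\<close> (vector values, applied to gradients) and
  \<open>s_form\<close> (real values, up to the factor \<open>H\<close>^2), so that bilinearity,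
  overlap and summation estimates are proved once for both.\<close>

definition weighted_inner ::
    "('a::euclidean_space \<Rightarrow> real) \<Rightarrow> 'a set \<Rightarrow> ('a \<Rightarrow> 'b::euclidean_space) \<Rightarrow> ('a \<Rightarrow> 'b) \<Rightarrow> real" where
  "weighted_inner \<kappa> U p q = integral\<^sup>L (lebesgue_on U) (\<lambda>x. \<kappa> x * inner (p x) (q x))"

lemma a_form_weighted: "a_form \<kappa> U u v = weighted_inner \<kappa> U (grad u) (grad v)"
  by (simp add: a_form_def weighted_inner_def)

lemma s_form_weighted: "s_form \<kappa> H U u v = weighted_inner \<kappa> U u v / H\<^sup>2"
  by (simp add: s_form_def weighted_inner_def mult.assoc)

lemma weighted_inner_commute: "weighted_inner \<kappa> U p q = weighted_inner \<kappa> U q p"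
  by (simp add: weighted_inner_def inner_commute)

lemma integral_lebesgue_on_subset:
  fixes f :: "'a::euclidean_space \<Rightarrow> real"
  assumes "V \<in> sets lebesgue" "U \<in> sets lebesgue" "V \<subseteq> U"
  shows "integral\<^sup>L (lebesgue_on V) f = integral\<^sup>L (lebesgue_on U) (\<lambda>x. indicat_real V x * f x)"
proof -
  have "integral\<^sup>L (lebesgue_on U) (\<lambda>x. indicat_real V x * f x)
      = integral\<^sup>L (lebesgue_on U) (\<lambda>x. if x \<in> V then f x else 0)"
    by (intro Bochner_Integration.integral_cong) (auto simp: indicator_def)
  also have "\<dots> = integral\<^sup>L (lebesgue_on V) f"
    using Lebesgue_Measure.integral_restrict_Int[OF assms(1,2), of f] assms(3) by (simp add: Int_absorb2)
  finally show ?thesis by simp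
qed

locale weight =
  fixes U :: "'a::euclidean_space set" and \<kappa> :: "'a \<Rightarrow> real"
  assumes U: "U \<in> lmeasurable" and \<kappa>: "Linf_on U \<kappa>" and \<kappa>_pos: "AE x in lebesgue_on U. 0 < \<kappa> x"
begin

lemma U_sets: "U \<in> sets lebesgue"
  using U by (rule fmeasurableD)

lemma weighted_integrable:
  "Linf_on U p \<Longrightarrow> Linf_on U q \<Longrightarrow> integrable (lebesgue_on U) (\<lambda>x. \<kappa> x * inner (p x) (q x))"
  by (intro Linf_on_integrable U Linf_on_mult \<kappa> Linf_on_inner)

lemma weighted_inner_add:
  "Linf_on U p \<Longrightarrow> Linf_on U p' \<Longrightarrow> Linf_on U q \<Longrightarrow>
   weighted_inner \<kappa> U (\<lambda>x. p x + p' x) q = weighted_inner \<kappa> U p q + weighted_inner \<kappa> U p' q"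
  using weighted_integrable[of p q] weighted_integrable[of p' q]
  by (simp add: weighted_inner_def inner_add_left distrib_left)

lemma weighted_inner_scale:
  "weighted_inner \<kappa> U (\<lambda>x. c *\<^sub>R p x) q = c * weighted_inner \<kappa> U p q"
  by (simp add: weighted_inner_def mult.left_commute[of _ c])

lemma weighted_inner_diff:
  "Linf_on U p \<Longrightarrow> Linf_on U p' \<Longrightarrow> Linf_on U q \<Longrightarrow>
   weighted_inner \<kappa> U (\<lambda>x. p x - p' x) q = weighted_inner \<kappa> U p q - weighted_inner \<kappa> U p' q"
  using weighted_integrable[of p q] weighted_integrable[of p' q]
  by (simp add: weighted_inner_def inner_diff_left right_diff_distrib)

lemma weighted_inner_sum:
  "(\<And>i. i \<in> I \<Longrightarrow> Linf_on U (p i)) \<Longrightarrow> Linf_on U q \<Longrightarrow>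
   weighted_inner \<kappa> U (\<lambda>x. \<Sum>i\<in>I. c i *\<^sub>R p i x) q = (\<Sum>i\<in>I. c i * weighted_inner \<kappa> U (p i) q)"
proof (induction I rule: infinite_finite_induct)
  case (insert i I)
  then show ?case
    by (simp add: weighted_inner_add Linf_on_sum Linf_on_cmult weighted_inner_scale)
qed (simp_all add: weighted_inner_def)

lemma weighted_inner_double_sum:
  assumes "\<And>i. i \<in> I \<Longrightarrow> Linf_on U (p i)" "finite I"
  shows "weighted_inner \<kappa> U (\<lambda>x. \<Sum>i\<in>I. c i *\<^sub>R p i x) (\<lambda>x. \<Sum>j\<in>I. d j *\<^sub>R p j x)
    = (\<Sum>i\<in>I. \<Sum>j\<in>I. c i * d j * weighted_inner \<kappa> U (p i) (p j))"
proof -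
  have "weighted_inner \<kappa> U (p i) (\<lambda>x. \<Sum>j\<in>I. d j *\<^sub>R p j x)
      = (\<Sum>j\<in>I. d j * weighted_inner \<kappa> U (p i) (p j))" if "i \<in> I" for i
    using weighted_inner_sum[of I p "p i" d] that assms by (simp add: weighted_inner_commute[of _ _ "p i"])
  then show ?thesis
    using assms by (simp add: weighted_inner_sum Linf_on_sum Linf_on_cmult sum_distrib_left mult.assoc)
qed

lemma weighted_inner_cong:
  assumes "Linf_on U p" "Linf_on U q" "AE x in lebesgue_on U. p x = p' x" "AE x in lebesgue_on U. q x = q' x"
  shows "weighted_inner \<kappa> U p q = weighted_inner \<kappa> U p' q'"
  unfolding weighted_inner_def
proof (rule integral_cong_AE)
  show "AE x in lebesgue_on U. \<kappa> x * inner (p x) (q x) = \<kappa> x * inner (p' x) (q' x)"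
    using assms(3,4) by eventually_elim simp
qed (use Linf_on_AE_cong[OF U_sets assms(1,3)] Linf_on_AE_cong[OF U_sets assms(2,4)] assms(1,2) \<kappa>
    in \<open>auto intro!: Linf_on_measurable Linf_on_mult Linf_on_inner\<close>)

text \<open>A non-integrable integrand has integral 0 by convention, so the bound is available for
  the mass and energy of arbitrary functions.\<close>

lemma weighted_inner_nonneg: "0 \<le> weighted_inner \<kappa> U p p"
  unfolding weighted_inner_def
proof (rule integral_nonneg_AE)
  show "AE x in lebesgue_on U. 0 \<le> \<kappa> x * inner (p x) (p x)"
    using \<kappa>_pos by eventually_elim simp
qed

lemma weighted_inner_zero:
  assumes "Linf_on U p" "weighted_inner \<kappa> U p p = 0" shows "AE x in lebesgue_on U. p x = 0"
proof -
  have nn: "AE x in lebesgue_on U. 0 \<le> \<kappa> x * inner (p x) (p x)"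
    using \<kappa>_pos by eventually_elim simp
  have "AE x in lebesgue_on U. \<kappa> x * inner (p x) (p x) = 0"
    using assms integral_nonneg_eq_0_iff_AE[OF weighted_integrable[OF assms(1,1)] nn]
    by (simp add: weighted_inner_def)
  with \<kappa>_pos show ?thesis by eventually_elim auto
qed

text \<open>The weight multiplies both sides of the pointwise inequality, so \<alpha> and \<beta>
  survive integration unchanged. The two terms on the right have the shape produced by the Leibniz
  rule, one with a gradient and one with the function itself.\<close>

lemma weighted_inner_sum_squares_le:
  assumes I: "finite I" and p: "\<And>i. i \<in> I \<Longrightarrow> Linf_on U (p i)"
    and q: "Linf_on U q" and r: "Linf_on U r" and nn: "0 \<le> \<alpha>" "0 \<le> \<beta>"
    and le: "AE x in lebesgue_on U. (\<Sum>i\<in>I. (norm (p i x))\<^sup>2) \<le> \<alpha> * (norm (q x))\<^sup>2 + \<beta> * (norm (r x))\<^sup>2"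
  shows "(\<Sum>i\<in>I. weighted_inner \<kappa> U (p i) (p i)) \<le> \<alpha> * weighted_inner \<kappa> U q q + \<beta> * weighted_inner \<kappa> U r r"
proof -
  have "(\<Sum>i\<in>I. weighted_inner \<kappa> U (p i) (p i))
      = integral\<^sup>L (lebesgue_on U) (\<lambda>x. \<Sum>i\<in>I. \<kappa> x * inner (p i x) (p i x))"
    unfolding weighted_inner_def
    by (rule Bochner_Integration.integral_sum[symmetric]) (use weighted_integrable p in auto)
  also have "\<dots> \<le> integral\<^sup>L (lebesgue_on U)
      (\<lambda>x. \<alpha> * (\<kappa> x * inner (q x) (q x)) + \<beta> * (\<kappa> x * inner (r x) (r x)))"
  proof (rule integral_mono_AE)
    show "AE x in lebesgue_on U. (\<Sum>i\<in>I. \<kappa> x * inner (p i x) (p i x))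
        \<le> \<alpha> * (\<kappa> x * inner (q x) (q x)) + \<beta> * (\<kappa> x * inner (r x) (r x))"
      using \<kappa>_pos le
    proof eventually_elim
      case (elim x)
      then have "\<kappa> x * (\<Sum>i\<in>I. (norm (p i x))\<^sup>2) \<le> \<kappa> x * (\<alpha> * (norm (q x))\<^sup>2 + \<beta> * (norm (r x))\<^sup>2)"
        by (intro mult_left_mono) auto
      then show ?case
        by (simp add: power2_norm_eq_inner sum_distrib_left algebra_simps)
    qed
  qed (intro Bochner_Integration.integrable_sum Bochner_Integration.integrable_add
      integrable_mult_right weighted_integrable p q r; assumption)+
  also have "\<dots> = \<alpha> * weighted_inner \<kappa> U q q + \<beta> * weighted_inner \<kappa> U r r"
    using weighted_integrable[OF q q] weighted_integrable[OF r r] by (simp add: weighted_inner_def)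
  finally show ?thesis .
qed

text \<open>At almost every point at most \<open>M\<close> summands are nonzero, so the
  Cauchy-Schwarz inequality for finite sums costs the factor \<open>M\<close> and not the number of
  summands.\<close>

lemma weighted_inner_overlap:
  assumes I: "finite I" and p: "\<And>i. i \<in> I \<Longrightarrow> Linf_on U (p i)"
    and M: "AE x in lebesgue_on U. card {i\<in>I. p i x \<noteq> 0} \<le> M"
  shows "weighted_inner \<kappa> U (\<lambda>x. \<Sum>i\<in>I. p i x) (\<lambda>x. \<Sum>i\<in>I. p i x)
    \<le> real M * (\<Sum>i\<in>I. weighted_inner \<kappa> U (p i) (p i))"
proof -
  have "weighted_inner \<kappa> U (\<lambda>x. \<Sum>i\<in>I. p i x) (\<lambda>x. \<Sum>i\<in>I. p i x)
      \<le> integral\<^sup>L (lebesgue_on U) (\<lambda>x. real M * (\<Sum>i\<in>I. \<kappa> x * inner (p i x) (p i x)))"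
    unfolding weighted_inner_def
  proof (rule integral_mono_AE)
    show "AE x in lebesgue_on U. \<kappa> x * inner (\<Sum>i\<in>I. p i x) (\<Sum>i\<in>I. p i x)
        \<le> real M * (\<Sum>i\<in>I. \<kappa> x * inner (p i x) (p i x))"
      using \<kappa>_pos M
    proof eventually_elim
      case (elim x)
      let ?J = "{i\<in>I. p i x \<noteq> 0}"
      have "norm (\<Sum>i\<in>I. p i x) = norm (\<Sum>i\<in>?J. p i x)"
        using I by (intro arg_cong[of _ _ norm] sum.mono_neutral_right) auto
      also have "\<dots> \<le> (\<Sum>i\<in>?J. norm (p i x))" by (rule norm_sum)
      finally have "(norm (\<Sum>i\<in>I. p i x))\<^sup>2 \<le> (\<Sum>i\<in>?J. norm (p i x))\<^sup>2"
        by (intro power_mono) auto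
      also have "\<dots> \<le> (\<Sum>i\<in>?J. (norm (p i x))\<^sup>2) * real (card ?J)"
        by (rule sum_squared_le_sum_of_squares)
      also have "\<dots> \<le> (\<Sum>i\<in>I. (norm (p i x))\<^sup>2) * real M"
        using elim I by (intro mult_mono sum_mono2) (auto intro: sum_nonneg)
      finally have "\<kappa> x * (norm (\<Sum>i\<in>I. p i x))\<^sup>2 \<le> \<kappa> x * ((\<Sum>i\<in>I. (norm (p i x))\<^sup>2) * real M)"
        using elim by (intro mult_left_mono) auto
      then show ?case
        by (simp add: power2_norm_eq_inner sum_distrib_left sum_distrib_right mult_ac)
    qed
  qed (intro Bochner_Integration.integrable_sum integrable_mult_right weighted_integrable
      Linf_on_sum p; assumption)+
  also have "\<dots> = real M * (\<Sum>i\<in>I. weighted_inner \<kappa> U (p i) (p i))"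
    unfolding weighted_inner_def integral_mult_right_zero
    by (subst Bochner_Integration.integral_sum) (auto intro!: weighted_integrable p)
  finally show ?thesis .
qed

end

section \<open>Finite element functions are weakly differentiable\<close>

lemma smooth_has_derivative:
  assumes "smooth \<phi>"
  obtains f' where "\<And>x. (\<phi> has_derivative f' x) (at x)" "\<And>v. smooth (\<lambda>x. f' x v)"
  using assms by cases blast

lemma smooth_continuous: "smooth \<phi> \<Longrightarrow> continuous_on S \<phi>"
  by (metis smooth_has_derivative has_derivative_continuous continuous_at_imp_continuous_on)

lemma continuous_compact_support_bounded:
  fixes f :: "'a::euclidean_space \<Rightarrow> real"
  assumes "continuous_on UNIV f" "compact S" "\<And>x. x \<notin> S \<Longrightarrow> f x = 0"
  obtains C where "0 \<le> C" "\<And>x. \<bar>f x\<bar> \<le> C"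
proof -
  have "compact (f ` S)"
    using assms continuous_on_subset by (metis compact_continuous_image subset_UNIV)
  then obtain C where "\<And>x. x \<in> S \<Longrightarrow> norm (f x) \<le> C"
    by (metis bounded_iff compact_imp_bounded imageI)
  then have "\<bar>f x\<bar> \<le> max C 0" for x
    using assms(3)[of x] by (cases "x \<in> S") (auto simp: max_def, force)
  then show thesis using that[of "max C 0"] by simp
qed

lemma smooth_directional_derivative:
  assumes "smooth \<phi>" "b \<in> Basis"
  shows "continuous_on UNIV (\<lambda>x. inner (grad \<phi> x) b)"
    and "((\<lambda>s. \<phi> (x + s *\<^sub>R b)) has_real_derivative inner (grad \<phi> (x + s *\<^sub>R b)) b) (at s)"
proof -
  obtain f' where f': "\<And>x. (\<phi> has_derivative f' x) (at x)" "\<And>v. smooth (\<lambda>x. f' x v)"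
    using smooth_has_derivative[OF assms(1)] by blast
  have eq: "inner (grad \<phi> x) b = f' x b" for x
    using frechet_derivative_at[OF f'(1)[of x]] assms(2)
    by (simp add: grad_def inner_sum_left_Basis)
  then show "continuous_on UNIV (\<lambda>x. inner (grad \<phi> x) b)"
    using smooth_continuous[OF f'(2)[of b], of UNIV] by simp
  have "((\<lambda>s. \<phi> (x + s *\<^sub>R b)) has_derivative (\<lambda>h. f' (x + s *\<^sub>R b) (h *\<^sub>R b))) (at s)"
    by (rule has_derivative_compose[of "\<lambda>s. x + s *\<^sub>R b", OF _ f'(1)]) (auto intro!: derivative_eq_intros)
  then show "((\<lambda>s. \<phi> (x + s *\<^sub>R b)) has_real_derivative inner (grad \<phi> (x + s *\<^sub>R b)) b) (at s)"
    unfolding has_field_derivative_def eq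
    using linear_scale[OF has_derivative_linear[OF f'(1)]] by (simp add: mult.commute[of _ "f' _ _"])
qed

lemma grad_zero_if_locally_zero:
  assumes "open N" "x \<in> N" "\<And>y. y \<in> N \<Longrightarrow> f y = 0"
  shows "grad f x = 0"
proof (rule grad_eqI)
  have "((\<lambda>y. 0) has_derivative (\<lambda>h. inner h 0)) (at x)" by simp
  then show "GDERIV f x :> 0"
    unfolding gderiv_def by (rule has_derivative_transform_within_open[OF _ assms(1,2)]) (use assms(3) in simp)
qed

text \<open>The directional derivative is continuous and vanishes off the compact support, hence is
  bounded; the mean value theorem passes this bound on to difference quotients. It serves as a
  dominating constant, uniform in the step size.\<close>

lemma test_function_difference_bound:
  assumes \<phi>: "test_function K \<phi>" and b: "b \<in> Basis"
  obtains L where "0 \<le> L" "\<And>x. \<bar>inner (grad \<phi> x) b\<bar> \<le> L"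
    "\<And>x t. 0 < t \<Longrightarrow> \<bar>\<phi> (x + t *\<^sub>R b) - \<phi> x\<bar> \<le> L * t"
proof -
  have sm: "smooth \<phi>" and cpt: "compact (closure {x. \<phi> x \<noteq> 0})"
    using \<phi> by (auto simp: test_function_def)
  have "inner (grad \<phi> x) b = 0" if "x \<notin> closure {x. \<phi> x \<noteq> 0}" for x
  proof -
    have "grad \<phi> x = 0"
    proof (rule grad_zero_if_locally_zero)
      show "\<phi> y = 0" if "y \<in> - closure {x. \<phi> x \<noteq> 0}" for y
        using that closure_subset[of "{x. \<phi> x \<noteq> 0}"] by auto
    qed (use that in auto)
    then show ?thesis by simp
  qed
  then obtain L where L: "0 \<le> L" "\<And>x. \<bar>inner (grad \<phi> x) b\<bar> \<le> L"
    using continuous_compact_support_bounded[OF smooth_directional_derivative(1)[OF sm b] cpt] by blast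
  have "\<bar>\<phi> (x + t *\<^sub>R b) - \<phi> x\<bar> \<le> L * t" if t: "0 < t" for x t
  proof -
    obtain z where "\<phi> (x + t *\<^sub>R b) - \<phi> (x + 0 *\<^sub>R b) = (t - 0) * inner (grad \<phi> (x + z *\<^sub>R b)) b"
      using MVT2[OF t smooth_directional_derivative(2)[OF sm b, of x]] by blast
    then have "\<bar>\<phi> (x + t *\<^sub>R b) - \<phi> x\<bar> = t * \<bar>inner (grad \<phi> (x + z *\<^sub>R b)) b\<bar>"
      using t by (simp add: abs_mult)
    also have "\<dots> \<le> t * L" using L(2) t by (intro mult_left_mono) auto
    finally show ?thesis by (simp add: mult.commute)
  qed
  with L that show thesis by blast
qed

lemma directional_difference_quotient:
  assumes "(f has_real_derivative D) (at 0)" "X \<longlonglongrightarrow> 0" "\<And>n. X n \<noteq> (0::real)"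
  shows "(\<lambda>n. (f (X n) - f 0) / X n) \<longlonglongrightarrow> D"
proof -
  have "((\<lambda>h. (f (0 + h) - f 0) / h) \<longlongrightarrow> D) (at 0)"
    using assms(1) by (simp add: DERIV_def)
  moreover have "filterlim X (at 0) sequentially"
    using assms(2,3) by (simp add: filterlim_at)
  ultimately show ?thesis using filterlim_compose by fastforce
qed

section \<open>Bounds on finite element functions and integration by parts\<close>

context fe_mesh
begin

lemma dom_lmeasurable: "\<Omega> \<in> lmeasurable"
  using bounded_dom open_dom by (rule lmeasurable_open)

lemma P1_bounded:
  assumes "u \<in> P1 \<T>" obtains C where "0 \<le> C" "\<And>x. \<bar>u x\<bar> \<le> C"
proof -
  have "compact (\<Union>\<T>)" using Union_mesh bounded_dom by (simp add: compact_closure)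
  then have "bounded (u ` \<Union>\<T>)"
    using assms compact_continuous_image compact_imp_bounded unfolding P1_def by blast
  then obtain C where C: "\<And>x. x \<in> \<Union>\<T> \<Longrightarrow> norm (u x) \<le> C"
    by (metis bounded_iff imageI)
  have "\<bar>u x\<bar> \<le> max C 0" for x
    using C[of x] P1_outside[OF assms, of x] by (cases "x \<in> \<Union>\<T>") auto
  then show thesis using that[of "max C 0"] by simp
qed

lemma P1_borel_measurable: "u \<in> P1 \<T> \<Longrightarrow> u \<in> borel_measurable borel"
proof -
  assume u: "u \<in> P1 \<T>"
  have "(\<lambda>x. indicator (closure \<Omega>) x *\<^sub>R u x) \<in> borel_measurable borel"
    using u Union_mesh by (intro borel_measurable_continuous_on_indicator) (auto simp: P1_def)
  also have "(\<lambda>x. indicator (closure \<Omega>) x *\<^sub>R u x) = u"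
    using P1_outside[OF u] Union_mesh by (intro ext) (auto simp: indicator_def)
  finally show ?thesis .
qed

lemma P1_Linf_on: "u \<in> P1 \<T> \<Longrightarrow> Linf_on U u"
proof -
  assume u: "u \<in> P1 \<T>"
  obtain C where "\<And>x. \<bar>u x\<bar> \<le> C" using P1_bounded[OF u] by blast
  moreover have "u \<in> borel_measurable (lebesgue_on U)"
    using P1_borel_measurable[OF u] by (intro measurable_restrict_space1 measurable_completion) simp
  ultimately show ?thesis by (intro Linf_onI[where C = C]) auto
qed

text \<open>Off the element boundaries the gradient coincides with a step function that is constant
  on each element interior, because distinct elements have disjoint interiors. Boundedness and
  measurability are read off from this step function.\<close>

lemma grad_P1_Linf_on: "u \<in> P1 \<T> \<Longrightarrow> Linf_on \<Omega> (grad u)"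
proof -
  assume u: "u \<in> P1 \<T>"
  have "\<exists>b. \<forall>x\<in>interior T. grad u x = b" if "T \<in> \<T>" for T
    using P1_gderiv[OF u that] grad_eqI by metis
  then obtain b where b: "\<And>T x. T \<in> \<T> \<Longrightarrow> x \<in> interior T \<Longrightarrow> grad u x = b T" by metis
  define g where "g x = (\<Sum>T\<in>\<T>. indicat_real (interior T) x *\<^sub>R b T)" for x
  have "g x = grad u x" if T: "T \<in> \<T>" "x \<in> interior T" for T x
  proof -
    have "indicat_real (interior T') x *\<^sub>R b T' = 0" if T': "T' \<in> \<T> - {T}" for T'
    proof -
      have "x \<notin> interior T'"
      proof
        assume "x \<in> interior T'"
        then have "T \<subseteq> T'" "T' \<subseteq> T"
          using element_subset_of_interior_point T T' interior_subset by blast+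
        then show False using T' by blast
      qed
      then show ?thesis by simp
    qed
    then have "g x = indicat_real (interior T) x *\<^sub>R b T"
      unfolding g_def sum.remove[OF finite_mesh T(1)] by (simp only: sum.neutral_const sum.cong[OF refl] add_0_right)
    then show ?thesis using T b by simp
  qed
  then have "AE x in lebesgue_on \<Omega>. g x = grad u x"
    using AE_element_interior by (auto elim!: eventually_mono)
  moreover have "Linf_on \<Omega> g" unfolding g_def
    by (intro Linf_on_sum Linf_on_scaleR Linf_on_indicator Linf_on_const) (simp add: borel_open)
  ultimately show ?thesis
    using Linf_on_AE_cong fmeasurableD[OF dom_lmeasurable] by blast
qed

text \<open>A segment inside \<Omega> is covered by finitely many closed pieces, one for each
  element, and on each piece the function is affine. The segment has to stay in \<Omega> because the
  function is set to zero outside the closed mesh and may jump there.\<close>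

lemma P1_difference_bound:
  assumes u: "u \<in> P1 \<T>"
  obtains L where "0 \<le> L"
    "\<And>x b t. norm b = 1 \<Longrightarrow> 0 < t \<Longrightarrow> (\<And>s. 0 \<le> s \<Longrightarrow> s \<le> t \<Longrightarrow> x - s *\<^sub>R b \<in> \<Omega>) \<Longrightarrow>
      \<bar>u (x - t *\<^sub>R b) - u x\<bar> \<le> L * t"
proof -
  obtain g where g: "\<And>T x y. T \<in> \<T> \<Longrightarrow> x \<in> T \<Longrightarrow> y \<in> T \<Longrightarrow> u x - u y = inner (g T) (x - y)"
  proof -
    have "\<forall>T\<in>\<T>. \<exists>b. \<forall>x\<in>T. \<forall>y\<in>T. u x - u y = inner b (x - y)"
      using P1_gderiv[OF u] by metis
    then show thesis using that by metis
  qed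
  \<comment> \<open>The sum dominates the slope on every element and is nonnegative by
    construction.\<close>
  define L where "L = (\<Sum>T\<in>\<T>. norm (g T))"
  have L: "0 \<le> L" "\<And>T. T \<in> \<T> \<Longrightarrow> norm (g T) \<le> L"
    using finite_mesh by (auto simp: L_def intro: sum_nonneg member_le_sum)
  have "\<bar>u (x - t *\<^sub>R b) - u x\<bar> \<le> L * t"
    if b: "norm b = 1" and t: "0 < t" and seg: "\<And>s. 0 \<le> s \<Longrightarrow> s \<le> t \<Longrightarrow> x - s *\<^sub>R b \<in> \<Omega>" for x b t
  proof -
    have "L-lipschitz_on {0..t} (\<lambda>s. u (x - s *\<^sub>R b))"
    proof (rule lipschitz_on_closed_Union[where I = \<T> and U = "\<lambda>T. {s. x - s *\<^sub>R b \<in> T}"])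
      fix T assume T: "T \<in> \<T>"
      show "closed {s. x - s *\<^sub>R b \<in> T}"
        using continuous_closed_vimage[OF closed_element[OF T], of "\<lambda>s. x - s *\<^sub>R b"]
        by (auto simp: vimage_def intro!: continuous_intros)
      show "L-lipschitz_on {s. x - s *\<^sub>R b \<in> T} (\<lambda>s. u (x - s *\<^sub>R b))"
      proof (rule lipschitz_onI)
        fix r s assume "r \<in> {s. x - s *\<^sub>R b \<in> T}" "s \<in> {s. x - s *\<^sub>R b \<in> T}"
        then have "u (x - r *\<^sub>R b) - u (x - s *\<^sub>R b) = inner (g T) ((s - r) *\<^sub>R b)"
          using g[OF T, of "x - r *\<^sub>R b" "x - s *\<^sub>R b"] by (simp flip: scaleR_diff_left)
        then have "dist (u (x - r *\<^sub>R b)) (u (x - s *\<^sub>R b)) \<le> norm (g T) * norm ((s - r) *\<^sub>R b)"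
          using Cauchy_Schwarz_ineq2[of "g T" "(s - r) *\<^sub>R b"] by (simp add: dist_real_def)
        also have "\<dots> \<le> L * dist r s"
          using L T b by (auto simp: dist_real_def abs_minus_commute intro!: mult_right_mono)
        finally show "dist (u (x - r *\<^sub>R b)) (u (x - s *\<^sub>R b)) \<le> L * dist r s" .
      qed (rule L)
    next
      show "{0..t} \<subseteq> (\<Union>T\<in>\<T>. {s. x - s *\<^sub>R b \<in> T})"
      proof
        fix s assume "s \<in> {0..t}"
        then have "x - s *\<^sub>R b \<in> \<Union>\<T>" using seg[of s] Union_mesh closure_subset[of \<Omega>] by auto
        then show "s \<in> (\<Union>T\<in>\<T>. {s. x - s *\<^sub>R b \<in> T})" by auto
      qed
    qed (use finite_mesh L in auto)
    from lipschitz_onD[OF this, of t 0] t show ?thesis by (simp add: dist_real_def)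
  qed
  with L that show thesis by blast
qed

text \<open>The weak gradient is obtained as a limit of difference quotients, which are shifted from the test function
  to \<open>u\<close> by translation invariance of the Lebesgue measure; \<open>u\<close> need not be Lipschitz on \<open>K\<close>, but it is so on
  segments.\<close>

lemma integral_by_parts_P1:
  assumes u: "u \<in> P1 \<T>" and K: "open K" "K \<subseteq> \<Omega>" and \<phi>: "test_function K \<phi>" and b: "b \<in> Basis"
  shows "integral\<^sup>L (lebesgue_on K) (\<lambda>x. u x * inner (grad \<phi> x) b) =
    - integral\<^sup>L (lebesgue_on K) (\<lambda>x. inner (grad u x) b * \<phi> x)"
proof -
  define S where "S = closure {x. \<phi> x \<noteq> 0}"
  have S: "compact S" "S \<subseteq> K" and sm: "smooth \<phi>" using \<phi> by (auto simp: test_function_def S_def)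
  have \<phi>0: "\<phi> x = 0" if "x \<notin> S" for x using that closure_subset[of "{x. \<phi> x \<noteq> 0}"] by (auto simp: S_def)
  have K_sets: "K \<in> sets lebesgue" using K(1) by (simp add: borel_open)
  have K_lm: "K \<in> lmeasurable" using K bounded_dom bounded_subset lmeasurable_open by blast
  \<comment> \<open>Shifts by at most \<delta> keep the support of the test function inside
    \<open>K\<close>; all step sizes \<open>t n\<close> respect this limit.\<close>
  obtain \<delta> where \<delta>: "0 < \<delta>" "\<And>x y. x \<in> S \<Longrightarrow> dist x y \<le> \<delta> \<Longrightarrow> y \<in> K"
  proof -
    obtain d where "0 < d" "\<forall>x\<in>S. \<forall>y\<in>- K. d \<le> dist x y"
      using separate_compact_closed[of S "- K"] S K(1) by (auto simp: closed_Compl)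
    then show thesis using that[of "d / 2"] by force
  qed
  define t where "t n = \<delta> / real (Suc n)" for n
  have t: "0 < t n" "t n \<le> \<delta>" for n
    using \<delta>(1) by (auto simp: t_def field_simps)
  have t0: "t \<longlonglongrightarrow> 0" unfolding t_def
    using LIMSEQ_Suc[OF lim_const_over_n[of \<delta>]] by simp
  obtain Cu where Cu: "0 \<le> Cu" "\<And>x. \<bar>u x\<bar> \<le> Cu" using P1_bounded[OF u] by blast
  obtain Lu where Lu: "0 \<le> Lu" "\<And>x b t. norm b = 1 \<Longrightarrow> 0 < t \<Longrightarrow>
      (\<And>s. 0 \<le> s \<Longrightarrow> s \<le> t \<Longrightarrow> x - s *\<^sub>R b \<in> \<Omega>) \<Longrightarrow> \<bar>u (x - t *\<^sub>R b) - u x\<bar> \<le> Lu * t"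
    using P1_difference_bound[OF u] by blast
  obtain C\<phi> where C\<phi>: "0 \<le> C\<phi>" "\<And>x. \<bar>\<phi> x\<bar> \<le> C\<phi>"
    using continuous_compact_support_bounded[OF smooth_continuous[OF sm] S(1)] \<phi>0 by blast
  obtain L\<phi> where L\<phi>: "0 \<le> L\<phi>" "\<And>x. \<bar>inner (grad \<phi> x) b\<bar> \<le> L\<phi>"
    "\<And>x t. 0 < t \<Longrightarrow> \<bar>\<phi> (x + t *\<^sub>R b) - \<phi> x\<bar> \<le> L\<phi> * t"
    using test_function_difference_bound[OF \<phi> b] by blast
  have nb: "norm b = 1" using b by simp
  have in_K: "x - s *\<^sub>R b \<in> K" "x + s *\<^sub>R b \<in> K" if "x \<in> S" "0 \<le> s" "s \<le> \<delta>" for x s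
    using \<delta>(2)[of x] that nb by (auto simp: dist_norm)
  have borel [measurable]: "u \<in> borel_measurable borel" "\<phi> \<in> borel_measurable borel"
    using P1_borel_measurable[OF u] smooth_continuous[OF sm, of UNIV]
    by (auto intro: borel_measurable_continuous_onI)
  have leb: "f \<in> borel_measurable (lebesgue_on K)" if "f \<in> borel_measurable borel" for f :: "'a \<Rightarrow> real"
    using that by (intro measurable_restrict_space1 measurable_completion) simp
  \<comment> \<open>\<open>F\<close> contains the forward difference quotient of the test function
    and \<open>G\<close> the backward one of \<open>u\<close>; the translation by \<open>t n\<close>
    in direction \<open>b\<close> converts the integral of one into that of the other.\<close>
  define F where "F n x = u x * ((\<phi> (x + t n *\<^sub>R b) - \<phi> x) / t n)" for n x
  define G where "G n x = (u (x - t n *\<^sub>R b) - u x) / t n * \<phi> x" for n x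
  \<comment> \<open>Passing to the Borel measure on the whole space makes translation invariance
    applicable; nothing is lost, as the integrands vanish off \<open>K\<close>.\<close>
  have on_K: "integral\<^sup>L (lebesgue_on K) f = integral\<^sup>L lborel f"
    if "f \<in> borel_measurable borel" "\<And>x. x \<notin> K \<Longrightarrow> f x = 0" for f :: "'a \<Rightarrow> real"
  proof -
    have "integral\<^sup>L (lebesgue_on K) f = integral\<^sup>L lebesgue (\<lambda>x. indicator K x *\<^sub>R f x)"
      using K_sets by (subst integral_restrict_space) auto
    also have "(\<lambda>x. indicator K x *\<^sub>R f x) = f" using that(2) by (intro ext) (auto simp: indicator_def)
    finally show ?thesis using that(1) by (simp add: integral_completion)
  qed
  have F_borel: "F n \<in> borel_measurable borel" and G_borel: "G n \<in> borel_measurable borel" for n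
    unfolding F_def[abs_def] G_def[abs_def] by measurable
  have FG: "integral\<^sup>L (lebesgue_on K) (F n) = integral\<^sup>L (lebesgue_on K) (G n)" for n
  proof -
    have integrable: "integrable lborel (\<lambda>x. f x * g x)"
      if "bounded A" "\<And>x. x \<notin> A \<Longrightarrow> g x = 0" "f \<in> borel_measurable borel" "g \<in> borel_measurable borel"
        "\<And>x. \<bar>f x\<bar> \<le> c" "\<And>x. \<bar>g x\<bar> \<le> d" "A \<in> sets borel" for f g :: "'a \<Rightarrow> real" and A c d
    proof (rule integrableI_bounded_set[where A = A and B = "c * d"])
      show "emeasure lborel A < \<infinity>" using that(1) by (rule emeasure_bounded_finite)
      show "AE x in lborel. x \<in> A \<longrightarrow> norm (f x * g x) \<le> c * d"
      proof (intro AE_I2 impI)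
        fix x
        have "0 \<le> c" using that(5)[of x] by linarith
        then show "norm (f x * g x) \<le> c * d" using that(5,6)[of x] by (simp add: abs_mult mult_mono)
      qed
    qed (use that in auto)
    have bS: "bounded S" "S \<in> sets borel" using S by (auto simp: compact_imp_bounded borel_compact)
    have bO: "bounded (closure \<Omega>)" "closure \<Omega> \<in> sets borel" using bounded_dom by auto
    have i0: "integrable lborel (\<lambda>x. u x * \<phi> x)"
      by (rule integrable[OF bS(1) \<phi>0 _ _ Cu(2) C\<phi>(2) bS(2)]) simp_all
    have i1: "integrable lborel (\<lambda>x. u (x - t n *\<^sub>R b) * \<phi> x)"
      by (rule integrable[OF bS(1) \<phi>0 _ _ Cu(2) C\<phi>(2) bS(2)]) simp_all
    have i2: "integrable lborel (\<lambda>x. \<phi> (x + t n *\<^sub>R b) * u x)"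
      by (rule integrable[OF bO(1) _ _ _ C\<phi>(2) Cu(2) bO(2)]) (use P1_outside[OF u] Union_mesh in auto)
    have "integral\<^sup>L lborel (\<lambda>x. u (x - t n *\<^sub>R b) * \<phi> x)
        = integral\<^sup>L (distr lborel borel ((+) (t n *\<^sub>R b))) (\<lambda>x. u (x - t n *\<^sub>R b) * \<phi> x)"
      by (simp add: lborel_distr_plus)
    also have "\<dots> = integral\<^sup>L lborel (\<lambda>x. \<phi> (x + t n *\<^sub>R b) * u x)"
      by (subst integral_distr) (simp_all add: add.commute mult.commute)
    finally have shift: "integral\<^sup>L lborel (\<lambda>x. u (x - t n *\<^sub>R b) * \<phi> x)
        = integral\<^sup>L lborel (\<lambda>x. \<phi> (x + t n *\<^sub>R b) * u x)" .
    have "integral\<^sup>L (lebesgue_on K) (F n) = integral\<^sup>L lborel (F n)"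
    proof (rule on_K)
      show "F n x = 0" if x: "x \<notin> K" for x
      proof -
        have "x + t n *\<^sub>R b \<notin> S" using in_K(1)[of "x + t n *\<^sub>R b" "t n"] t[of n] x by auto
        then show ?thesis using \<phi>0 x S by (auto simp: F_def)
      qed
    qed (rule F_borel)
    also have "\<dots> = integral\<^sup>L lborel (\<lambda>x. (\<phi> (x + t n *\<^sub>R b) * u x - u x * \<phi> x) / t n)"
      by (intro Bochner_Integration.integral_cong) (auto simp: F_def algebra_simps)
    also have "\<dots> = integral\<^sup>L lborel (\<lambda>x. (u (x - t n *\<^sub>R b) * \<phi> x - u x * \<phi> x) / t n)"
      using i0 i1 i2 shift by simp
    also have "\<dots> = integral\<^sup>L lborel (G n)"
      by (intro Bochner_Integration.integral_cong) (auto simp: G_def algebra_simps diff_divide_distrib)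
    also have "\<dots> = integral\<^sup>L (lebesgue_on K) (G n)"
      by (rule on_K[symmetric]) (use G_borel \<phi>0 S in \<open>auto simp: G_def\<close>)
    finally show ?thesis .
  qed
  have gu: "Linf_on K (grad u)"
    using Linf_on_subset[OF K_sets fmeasurableD[OF dom_lmeasurable] K(2) grad_P1_Linf_on[OF u]] .
  \<comment> \<open>Both families of difference quotients are dominated by constants, which are
    integrable because \<open>K\<close> has finite measure.\<close>
  have const: "integrable (lebesgue_on K) (\<lambda>x. c)" for c :: real
    using Linf_on_integrable[OF K_lm Linf_on_const] .
  have limF: "(\<lambda>n. integral\<^sup>L (lebesgue_on K) (F n))
      \<longlonglongrightarrow> integral\<^sup>L (lebesgue_on K) (\<lambda>x. u x * inner (grad \<phi> x) b)"
  proof (rule integral_dominated_convergence[where w = "\<lambda>x. Cu * L\<phi>"])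
    show "AE x in lebesgue_on K. (\<lambda>n. F n x) \<longlonglongrightarrow> u x * inner (grad \<phi> x) b"
    proof (rule AE_I2)
      fix x
      show "(\<lambda>n. F n x) \<longlonglongrightarrow> u x * inner (grad \<phi> x) b"
        using directional_difference_quotient[OF _ t0, of "\<lambda>s. \<phi> (x + s *\<^sub>R b)" "inner (grad \<phi> x) b"]
          smooth_directional_derivative(2)[OF sm b, of x 0] t(1) unfolding F_def
        by (intro tendsto_mult tendsto_const) (simp add: less_imp_neq[symmetric])
    qed
    show "AE x in lebesgue_on K. norm (F n x) \<le> Cu * L\<phi>" for n
    proof (rule AE_I2)
      fix x
      have "\<bar>\<phi> (x + t n *\<^sub>R b) - \<phi> x\<bar> / t n \<le> L\<phi>" using L\<phi>(3)[OF t(1), of x n] t(1)[of n] by (simp add: field_simps)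
      then have "\<bar>u x\<bar> * (\<bar>\<phi> (x + t n *\<^sub>R b) - \<phi> x\<bar> / t n) \<le> Cu * L\<phi>"
        using Cu t(1)[of n] by (intro mult_mono) auto
      then show "norm (F n x) \<le> Cu * L\<phi>"
        using t(1)[of n] by (simp add: F_def abs_mult)
    qed
    show "(\<lambda>x. u x * inner (grad \<phi> x) b) \<in> borel_measurable (lebesgue_on K)"
      using smooth_directional_derivative(1)[OF sm b]
      by (intro leb borel_measurable_times borel borel_measurable_continuous_onI)
    show "F n \<in> borel_measurable (lebesgue_on K)" for n
      by (rule leb[OF F_borel])
  qed (rule const)
  have limG: "(\<lambda>n. integral\<^sup>L (lebesgue_on K) (G n))
      \<longlonglongrightarrow> integral\<^sup>L (lebesgue_on K) (\<lambda>x. - (inner (grad u x) b * \<phi> x))"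
  proof (rule integral_dominated_convergence[where w = "\<lambda>x. Lu * C\<phi>"])
    have "AE x in lebesgue_on K. \<exists>T\<in>\<T>. x \<in> interior T"
      using AE_lebesgue_on_subset[OF K_sets fmeasurableD[OF dom_lmeasurable] K(2) AE_element_interior] .
    then show "AE x in lebesgue_on K. (\<lambda>n. G n x) \<longlonglongrightarrow> - (inner (grad u x) b * \<phi> x)"
    proof eventually_elim
      case (elim x)
      then obtain T where "T \<in> \<T>" "x \<in> interior T" by blast
      then have "(u has_derivative (\<lambda>h. inner h (grad u x))) (at (x - 0 *\<^sub>R b))"
        using P1_gderiv_grad[OF u] by (simp add: gderiv_def)
      then have "((\<lambda>s. u (x - s *\<^sub>R b)) has_derivative (\<lambda>h. inner (- (h *\<^sub>R b)) (grad u x))) (at 0)"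
        by (rule has_derivative_compose[rotated]) (auto intro!: derivative_eq_intros)
      then have "((\<lambda>s. u (x - s *\<^sub>R b)) has_real_derivative - inner (grad u x) b) (at 0)"
        unfolding has_field_derivative_def
        by (rule has_derivative_eq_rhs) (simp add: fun_eq_iff inner_commute)
      from directional_difference_quotient[OF this t0] t(1)
      have "(\<lambda>n. (u (x - t n *\<^sub>R b) - u x) / t n) \<longlonglongrightarrow> - inner (grad u x) b"
        by (simp add: less_imp_neq[symmetric])
      from tendsto_mult[OF this tendsto_const[of "\<phi> x"]] show ?case by (simp add: G_def)
    qed
    show "AE x in lebesgue_on K. norm (G n x) \<le> Lu * C\<phi>" for n
    proof (rule AE_I2)
      fix x
      show "norm (G n x) \<le> Lu * C\<phi>"
      proof (cases "x \<in> S")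
        case True
        \<comment> \<open>By the choice of \<delta> the whole segment stays in \<open>K\<close>, so
          the Lipschitz bound along segments applies.\<close>
        have "\<bar>u (x - t n *\<^sub>R b) - u x\<bar> \<le> Lu * t n"
          using Lu(2)[OF nb t(1), of n x] in_K(1)[OF True] t(2)[of n] K(2) by (meson order_trans subsetD)
        then have "\<bar>u (x - t n *\<^sub>R b) - u x\<bar> / t n \<le> Lu" using t(1)[of n] by (simp add: field_simps)
        then have "\<bar>u (x - t n *\<^sub>R b) - u x\<bar> / t n * \<bar>\<phi> x\<bar> \<le> Lu * C\<phi>"
          using C\<phi> Lu(1) t(1)[of n] by (intro mult_mono) auto
        then show ?thesis
          using t(1)[of n] by (simp add: G_def abs_mult)
      qed (use \<phi>0 Lu(1) C\<phi>(1) in \<open>simp add: G_def\<close>)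
    qed
    show "(\<lambda>x. - (inner (grad u x) b * \<phi> x)) \<in> borel_measurable (lebesgue_on K)"
      using Linf_on_measurable[OF gu]
      by (intro borel_measurable_uminus borel_measurable_times leb borel borel_measurable_inner) auto
    show "G n \<in> borel_measurable (lebesgue_on K)" for n
      by (rule leb[OF G_borel])
  qed (rule const)
  have "integral\<^sup>L (lebesgue_on K) (\<lambda>x. u x * inner (grad \<phi> x) b)
      = integral\<^sup>L (lebesgue_on K) (\<lambda>x. - (inner (grad u x) b * \<phi> x))"
    using LIMSEQ_unique limF limG unfolding FG by blast
  then show ?thesis by simp
qed

lemma H1_on_P1:
  assumes "u \<in> P1 \<T>" "open K" "K \<subseteq> \<Omega>"
  shows "H1_on K u (grad u)"
proof -
  have "K \<in> lmeasurable" using assms bounded_dom bounded_subset lmeasurable_open by blast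
  moreover have "Linf_on K (grad u)"
    using Linf_on_subset[OF _ fmeasurableD[OF dom_lmeasurable] assms(3) grad_P1_Linf_on[OF assms(1)]]
      \<open>K \<in> lmeasurable\<close> by blast
  ultimately show ?thesis
    using P1_Linf_on[OF assms(1)] unfolding H1_on_def
    by (intro conjI allI impI Linf_on_L2_on integral_by_parts_P1[OF assms]) auto
qed

end

section \<open>The projection onto the auxiliary space\<close>

text \<open>The orthogonal projection written out: on each piece it is the \<kappa>-weighted mean of
  \<open>u\<close>, with value 0 on pieces of zero weight since division by zero gives 0. Unlike a
  chosen projection, it is visibly linear in \<open>u\<close>.\<close>

definition aux_average :: "('a::euclidean_space \<Rightarrow> real) \<Rightarrow> 'a set \<Rightarrow> 'a set set \<Rightarrow> ('a \<Rightarrow> real) \<Rightarrow> 'a \<Rightarrow> real" where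
  "aux_average \<kappa> K P u x = (\<Sum>D\<in>insert (K - \<Union>P) P.
     weighted_inner \<kappa> K u (indicat_real D) / weighted_inner \<kappa> K (indicat_real D) (indicat_real D) * indicat_real D x)"

locale coarse_element = weight K \<kappa> for K :: "'a::euclidean_space set" and \<kappa> +
  fixes P :: "'a set set"
  assumes finite_P: "finite P" and disjoint_P: "disjoint P"
    and P_open: "D \<in> P \<Longrightarrow> open D" and P_subset: "D \<in> P \<Longrightarrow> D \<subseteq> K"
begin

abbreviation "pieces \<equiv> insert (K - \<Union>P) P"

lemma pieces_sets: "D \<in> pieces \<Longrightarrow> D \<in> sets lebesgue"
  using P_open U_sets finite_P by (auto intro!: sets.Diff sets.finite_Union borel_open)

lemma pieces_subset: "D \<in> pieces \<Longrightarrow> D \<subseteq> K"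
  using P_subset by auto

lemma pieces_disjoint: "D \<in> pieces \<Longrightarrow> D' \<in> pieces \<Longrightarrow> D \<noteq> D' \<Longrightarrow> D \<inter> D' = {}"
  using disjoint_P by (auto simp: disjoint_def)

lemma piece_Linf_on: "D \<in> pieces \<Longrightarrow> Linf_on U' (indicat_real D)"
  using pieces_sets Linf_on_indicator by blast

lemma aux_average_in_aux_space: "aux_average \<kappa> K P u \<in> aux_space K P"
  unfolding aux_space_def aux_average_def[abs_def] by (intro CollectI exI) (rule refl)

lemma aux_space_Linf_on: "w \<in> aux_space K P \<Longrightarrow> Linf_on U' w"
  unfolding aux_space_def using piece_Linf_on by (auto intro!: Linf_on_sum Linf_on_mult Linf_on_const)

lemma aux_average_Linf_on: "Linf_on U' (aux_average \<kappa> K P u)"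
  using aux_space_Linf_on aux_average_in_aux_space .

lemma aux_space_outside: "w \<in> aux_space K P \<Longrightarrow> x \<notin> K \<Longrightarrow> w x = 0"
proof -
  assume "w \<in> aux_space K P" "x \<notin> K"
  then obtain c where w: "w = (\<lambda>x. \<Sum>D\<in>pieces. c D * indicat_real D x)" by (auto simp: aux_space_def)
  have "c D * indicat_real D x = 0" if "D \<in> pieces" for D
    using pieces_subset[OF that] \<open>x \<notin> K\<close> by (auto simp: indicator_def)
  then show ?thesis unfolding w by (intro sum.neutral) blast
qed

lemma aux_space_diff: "v \<in> aux_space K P \<Longrightarrow> w \<in> aux_space K P \<Longrightarrow> (\<lambda>x. v x - w x) \<in> aux_space K P"
proof -
  assume "v \<in> aux_space K P" "w \<in> aux_space K P"
  then obtain c d where "v = (\<lambda>x. \<Sum>D\<in>pieces. c D * indicat_real D x)" "w = (\<lambda>x. \<Sum>D\<in>pieces. d D * indicat_real D x)"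
    by (auto simp: aux_space_def)
  then have "(\<lambda>x. v x - w x) = (\<lambda>x. \<Sum>D\<in>pieces. (c D - d D) * indicat_real D x)"
    by (simp add: sum_subtractf left_diff_distrib)
  then show ?thesis unfolding aux_space_def by (intro CollectI exI)
qed

lemma aux_average_orthogonal_piece:
  assumes u: "Linf_on K u" and D: "D \<in> pieces"
  shows "weighted_inner \<kappa> K (aux_average \<kappa> K P u) (indicat_real D) = weighted_inner \<kappa> K u (indicat_real D)"
proof -
  define c where "c D' = weighted_inner \<kappa> K u (indicat_real D') / weighted_inner \<kappa> K (indicat_real D') (indicat_real D')" for D'
  have off: "weighted_inner \<kappa> K (indicat_real D') (indicat_real D) = 0" if "D' \<in> pieces - {D}" for D'
  proof -
    have "(\<lambda>x. \<kappa> x * inner (indicat_real D' x) (indicat_real D x)) = (\<lambda>x. 0)"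
      using pieces_disjoint[of D' D] that D by (intro ext) (auto simp: indicator_def)
    then show ?thesis by (simp add: weighted_inner_def)
  qed
  have "weighted_inner \<kappa> K (aux_average \<kappa> K P u) (indicat_real D)
      = (\<Sum>D'\<in>pieces. c D' * weighted_inner \<kappa> K (indicat_real D') (indicat_real D))"
    using weighted_inner_sum[of pieces indicat_real "indicat_real D" c] piece_Linf_on D
    unfolding aux_average_def[abs_def] c_def by simp
  also have "\<dots> = c D * weighted_inner \<kappa> K (indicat_real D) (indicat_real D)"
    using off D finite_P by (subst sum.remove[of _ D]) auto
  also have "\<dots> = weighted_inner \<kappa> K u (indicat_real D)"
  proof (cases "weighted_inner \<kappa> K (indicat_real D) (indicat_real D) = 0")
    \<comment> \<open>A piece of measure zero: its coefficient does not matter, since both sides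
      vanish.\<close>
    case True
    then have "AE x in lebesgue_on K. indicat_real D x = 0"
      using weighted_inner_zero piece_Linf_on[OF D] by blast
    then have "weighted_inner \<kappa> K u (indicat_real D) = weighted_inner \<kappa> K u (\<lambda>x. 0)"
      by (intro weighted_inner_cong u piece_Linf_on D) auto
    then show ?thesis using True by (simp add: weighted_inner_def)
  qed (simp add: c_def)
  finally show ?thesis .
qed

lemma aux_average_orthogonal:
  assumes u: "Linf_on K u" and v: "v \<in> aux_space K P"
  shows "weighted_inner \<kappa> K (\<lambda>x. u x - aux_average \<kappa> K P u x) v = 0"
proof -
  obtain c where c: "v = (\<lambda>x. \<Sum>D\<in>pieces. c D * indicat_real D x)" using v by (auto simp: aux_space_def)
  define r where "r = (\<lambda>x. u x - aux_average \<kappa> K P u x)"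
  have r: "Linf_on K r" unfolding r_def by (intro Linf_on_diff u aux_average_Linf_on)
  have "weighted_inner \<kappa> K v r = (\<Sum>D\<in>pieces. c D * weighted_inner \<kappa> K (indicat_real D) r)"
    using weighted_inner_sum[of pieces indicat_real r c] piece_Linf_on r unfolding c by simp
  also have "\<dots> = 0"
  proof (intro sum.neutral ballI)
    fix D assume D: "D \<in> pieces"
    have "weighted_inner \<kappa> K r (indicat_real D) = 0"
      unfolding r_def using weighted_inner_diff[OF u aux_average_Linf_on piece_Linf_on[OF D]]
        aux_average_orthogonal_piece[OF u D] by simp
    then show "c D * weighted_inner \<kappa> K (indicat_real D) r = 0"
      by (simp add: weighted_inner_commute)
  qed
  finally show ?thesis by (simp add: weighted_inner_commute r_def)
qed

text \<open>Two solutions of the orthogonality condition differ by an auxiliary function that is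
  orthogonal to itself and so vanishes almost everywhere. For \<open>H\<close> = 0 the form would be
  identically 0 by the division convention, and the condition would say nothing.\<close>

lemma aux_proj_elem_eq_average:
  assumes u: "Linf_on K u" and H: "H \<noteq> 0"
  shows "aux_proj_elem \<kappa> H K P u \<in> aux_space K P"
    and "AE x in lebesgue_on K. aux_proj_elem \<kappa> H K P u x = aux_average \<kappa> K P u x"
proof -
  let ?w = "aux_proj_elem \<kappa> H K P u" and ?a = "aux_average \<kappa> K P u"
  have "\<exists>w. w \<in> aux_space K P \<and> (\<forall>v\<in>aux_space K P. s_form \<kappa> H K (\<lambda>x. u x - w x) v = 0)"
    using aux_average_in_aux_space aux_average_orthogonal[OF u] by (auto simp: s_form_weighted)
  from someI_ex[OF this] have w: "?w \<in> aux_space K P"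
    and orth: "\<And>v. v \<in> aux_space K P \<Longrightarrow> weighted_inner \<kappa> K (\<lambda>x. u x - ?w x) v = 0"
    using H unfolding aux_proj_elem_def by (auto simp: s_form_weighted)
  show "?w \<in> aux_space K P" by fact
  define d where "d = (\<lambda>x. ?w x - ?a x)"
  have d: "d \<in> aux_space K P" unfolding d_def by (intro aux_space_diff w aux_average_in_aux_space)
  note wL = aux_space_Linf_on[OF w, of K] and dL = aux_space_Linf_on[OF d, of K]
  have "weighted_inner \<kappa> K d d = weighted_inner \<kappa> K (\<lambda>x. (u x - ?a x) - (u x - ?w x)) d"
    by (simp add: d_def)
  also have "\<dots> = 0"
    using orth[OF d] aux_average_orthogonal[OF u d]
    by (simp add: weighted_inner_diff Linf_on_diff u wL dL aux_average_Linf_on)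
  finally have "AE x in lebesgue_on K. d x = 0" using weighted_inner_zero dL by blast
  then show "AE x in lebesgue_on K. ?w x = ?a x" by eventually_elim (simp add: d_def)
qed

lemma aux_average_pythagoras:
  assumes u: "Linf_on K u"
  shows "weighted_inner \<kappa> K u u =
    weighted_inner \<kappa> K (\<lambda>x. u x - aux_average \<kappa> K P u x) (\<lambda>x. u x - aux_average \<kappa> K P u x) +
    weighted_inner \<kappa> K (aux_average \<kappa> K P u) (aux_average \<kappa> K P u)"
proof -
  let ?a = "aux_average \<kappa> K P u"
  have a: "Linf_on K ?a" by (rule aux_average_Linf_on)
  have 0: "weighted_inner \<kappa> K u ?a = weighted_inner \<kappa> K ?a ?a"
    using aux_average_orthogonal[OF u aux_average_in_aux_space, of u] by (simp add: weighted_inner_diff u a)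
  have "weighted_inner \<kappa> K (\<lambda>x. u x - ?a x) (\<lambda>x. u x - ?a x)
      = weighted_inner \<kappa> K u (\<lambda>x. u x - ?a x) - weighted_inner \<kappa> K ?a (\<lambda>x. u x - ?a x)"
    by (intro weighted_inner_diff Linf_on_diff u a)
  also have "\<dots> = weighted_inner \<kappa> K u u - weighted_inner \<kappa> K ?a ?a"
    using 0 by (simp add: weighted_inner_commute[of _ _ _ "\<lambda>x. u x - ?a x"] weighted_inner_diff u a
        weighted_inner_commute[of _ _ ?a u])
  finally show ?thesis by simp
qed

lemma aux_average_sum:
  assumes "\<And>i. i \<in> I \<Longrightarrow> Linf_on K (u i)"
  shows "aux_average \<kappa> K P (\<lambda>x. \<Sum>i\<in>I. c i *\<^sub>R u i x) = (\<lambda>x. \<Sum>i\<in>I. c i *\<^sub>R aux_average \<kappa> K P (u i) x)"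
proof
  fix x
  have "weighted_inner \<kappa> K (\<lambda>x. \<Sum>i\<in>I. c i *\<^sub>R u i x) (indicat_real D)
      = (\<Sum>i\<in>I. c i * weighted_inner \<kappa> K (u i) (indicat_real D))" if "D \<in> pieces" for D
    using that by (intro weighted_inner_sum assms piece_Linf_on)
  then have "aux_average \<kappa> K P (\<lambda>x. \<Sum>i\<in>I. c i *\<^sub>R u i x) x
      = (\<Sum>D\<in>pieces. (\<Sum>i\<in>I. c i * weighted_inner \<kappa> K (u i) (indicat_real D))
          / weighted_inner \<kappa> K (indicat_real D) (indicat_real D) * indicat_real D x)"
    unfolding aux_average_def by (intro sum.cong) auto
  also have "\<dots> = (\<Sum>i\<in>I. c i *\<^sub>R aux_average \<kappa> K P (u i) x)"
    unfolding aux_average_def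
    by (simp only: sum_divide_distrib sum_distrib_right sum_distrib_left real_scaleR_def mult.assoc
        times_divide_eq_right times_divide_eq_left sum.swap[of _ pieces])
  finally show "aux_average \<kappa> K P (\<lambda>x. \<Sum>i\<in>I. c i *\<^sub>R u i x) x = (\<Sum>i\<in>I. c i *\<^sub>R aux_average \<kappa> K P (u i) x)" .
qed

end

section \<open>Assembling the projections over the coarse elements\<close>

locale coarse_partition = weight \<Omega> \<kappa> for \<Omega> :: "'a::euclidean_space set" and \<kappa> +
  fixes H :: real and N :: nat and K :: "nat \<Rightarrow> 'a set" and P :: "nat \<Rightarrow> 'a set set"
  assumes coarse: "coarse_mesh \<Omega> H N K" and H: "0 < H"
    and P: "\<And>i. i < N \<Longrightarrow> finite (P i) \<and> disjoint (P i) \<and> (\<forall>D\<in>P i. open D \<and> D \<subseteq> K i)"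
begin

lemma K_disjoint: "i < N \<Longrightarrow> j < N \<Longrightarrow> i \<noteq> j \<Longrightarrow> x \<in> K i \<Longrightarrow> x \<notin> K j"
proof -
  assume ij: "i < N" "j < N" "i \<noteq> j" and x: "x \<in> K i"
  have "disjoint_family_on K {..<N}" using coarse by (simp add: coarse_mesh_def)
  from disjoint_family_onD[OF this, of i j] ij x show "x \<notin> K j" by auto
qed

lemma K_open: "i < N \<Longrightarrow> open (K i)" and K_subset: "i < N \<Longrightarrow> K i \<subseteq> \<Omega>"
  and K_cover: "negligible (\<Omega> - (\<Union>i<N. K i))"
  using coarse by (auto simp: coarse_mesh_def)

lemma K_sets: "i < N \<Longrightarrow> K i \<in> sets lebesgue"
  using K_open by (simp add: borel_open)

lemma K_Linf_on: "i < N \<Longrightarrow> Linf_on \<Omega> f \<Longrightarrow> Linf_on (K i) f"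
  using Linf_on_subset K_sets U_sets K_subset by blast

lemma coarse_element: "i < N \<Longrightarrow> coarse_element (K i) \<kappa> (P i)"
proof unfold_locales
  assume i: "i < N"
  show "K i \<in> lmeasurable"
    using fmeasurableI2[OF U K_subset[OF i]] K_sets[OF i] by blast
  show "Linf_on (K i) \<kappa>" using K_Linf_on[OF i \<kappa>] .
  show "AE x in lebesgue_on (K i). 0 < \<kappa> x"
    using AE_lebesgue_on_subset[OF K_sets[OF i] U_sets K_subset[OF i] \<kappa>_pos] .
qed (use P in auto)

lemma AE_coarse_element: "AE x in lebesgue_on \<Omega>. \<exists>i<N. x \<in> K i"
proof -
  have "AE x in lebesgue. x \<notin> \<Omega> - (\<Union>i<N. K i)"
    using AE_not_in K_cover negligible_iff_null_sets by blast
  then show ?thesis using U_sets by (auto simp: AE_restrict_space_iff elim!: eventually_mono)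
qed

lemma sum_at_coarse_element:
  assumes "i < N" "x \<in> K i" "\<And>j. j < N \<Longrightarrow> x \<notin> K j \<Longrightarrow> f j = (0::real)"
  shows "(\<Sum>j<N. f j) = f i"
  using assms K_disjoint by (subst sum.remove[of _ i]) (auto intro!: sum.neutral)

lemma weighted_inner_coarse:
  assumes p: "Linf_on \<Omega> p" and q: "Linf_on \<Omega> q"
  shows "weighted_inner \<kappa> \<Omega> p q = (\<Sum>i<N. weighted_inner \<kappa> (K i) p q)"
proof -
  define f where "f x = \<kappa> x * inner (p x) (q x)" for x
  have f: "Linf_on \<Omega> f" unfolding f_def by (intro Linf_on_mult \<kappa> Linf_on_inner p q)
  have fK: "Linf_on \<Omega> (\<lambda>x. indicat_real (K i) x * f x)" if "i < N" for i
    using K_sets[OF that] by (intro Linf_on_mult Linf_on_indicator f)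
  have "(\<Sum>i<N. weighted_inner \<kappa> (K i) p q)
      = (\<Sum>i<N. integral\<^sup>L (lebesgue_on \<Omega>) (\<lambda>x. indicat_real (K i) x * f x))"
    unfolding weighted_inner_def f_def using K_sets K_subset U_sets
    by (intro sum.cong integral_lebesgue_on_subset) auto
  also have "\<dots> = integral\<^sup>L (lebesgue_on \<Omega>) (\<lambda>x. \<Sum>i<N. indicat_real (K i) x * f x)"
    using fK Linf_on_integrable[OF U] by (intro Bochner_Integration.integral_sum[symmetric]) auto
  also have "\<dots> = integral\<^sup>L (lebesgue_on \<Omega>) f"
  proof (rule integral_cong_AE)
    show "AE x in lebesgue_on \<Omega>. (\<Sum>i<N. indicat_real (K i) x * f x) = f x"
      using AE_coarse_element
    proof eventually_elim
      case (elim x)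
      then obtain i where i: "i < N" "x \<in> K i" by blast
      then show ?case by (subst sum_at_coarse_element[OF i]) auto
    qed
    show "(\<lambda>x. \<Sum>i<N. indicat_real (K i) x * f x) \<in> borel_measurable (lebesgue_on \<Omega>)"
      by (intro Linf_on_measurable Linf_on_sum fK) simp
  qed (rule Linf_on_measurable[OF f])
  finally show ?thesis by (simp add: weighted_inner_def f_def[abs_def])
qed

text \<open>The linear representative of \<open>aux_proj\<close>. The averages vanish outside their
  own elements, so at most one summand is nonzero at each point.\<close>

definition global_average :: "('a \<Rightarrow> real) \<Rightarrow> 'a \<Rightarrow> real" where
  "global_average u x = (\<Sum>i<N. aux_average \<kappa> (K i) (P i) u x)"

lemma global_average_Linf_on: "Linf_on U' (global_average u)"
  unfolding global_average_def[abs_def]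
  using coarse_element.aux_average_Linf_on[OF coarse_element] by (intro Linf_on_sum) auto

lemma global_average_on_element:
  assumes "i < N" "x \<in> K i" shows "global_average u x = aux_average \<kappa> (K i) (P i) u x"
  unfolding global_average_def using coarse_element.aux_space_outside[OF coarse_element]
    coarse_element.aux_average_in_aux_space[OF coarse_element]
  by (intro sum_at_coarse_element[OF assms]) blast

lemma global_average_sum:
  assumes "\<And>i. i \<in> I \<Longrightarrow> Linf_on \<Omega> (u i)"
  shows "global_average (\<lambda>x. \<Sum>i\<in>I. c i *\<^sub>R u i x) = (\<lambda>x. \<Sum>i\<in>I. c i *\<^sub>R global_average (u i) x)"
proof
  fix x
  have "global_average (\<lambda>x. \<Sum>i\<in>I. c i *\<^sub>R u i x) x
      = (\<Sum>j<N. \<Sum>i\<in>I. c i *\<^sub>R aux_average \<kappa> (K j) (P j) (u i) x)"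
    unfolding global_average_def
  proof (intro sum.cong refl)
    fix j assume "j \<in> {..<N}"
    then have j: "j < N" by simp
    show "aux_average \<kappa> (K j) (P j) (\<lambda>x. \<Sum>i\<in>I. c i *\<^sub>R u i x) x
        = (\<Sum>i\<in>I. c i *\<^sub>R aux_average \<kappa> (K j) (P j) (u i) x)"
      using coarse_element.aux_average_sum[OF coarse_element[OF j] K_Linf_on[OF j assms]] by (rule fun_cong)
  qed
  also have "\<dots> = (\<Sum>i\<in>I. c i *\<^sub>R global_average (u i) x)"
    unfolding global_average_def scaleR_sum_right by (rule sum.swap)
  finally show "global_average (\<lambda>x. \<Sum>i\<in>I. c i *\<^sub>R u i x) x = (\<Sum>i\<in>I. c i *\<^sub>R global_average (u i) x)" .
qed

lemma aux_proj_eq_global_average: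
  assumes u: "Linf_on \<Omega> u"
  shows "AE x in lebesgue_on \<Omega>. aux_proj \<kappa> H N K P u x = global_average u x"
proof -
  have H0: "H \<noteq> 0" using H by simp
  have "AE x in lebesgue_on \<Omega>. x \<in> K i \<longrightarrow> aux_proj_elem \<kappa> H (K i) (P i) u x = aux_average \<kappa> (K i) (P i) u x"
    if i: "i < N" for i
    using coarse_element.aux_proj_elem_eq_average(2)[OF coarse_element[OF i] K_Linf_on[OF i u] H0]
      K_sets[OF i] U_sets by (auto simp: AE_restrict_space_iff elim!: eventually_mono)
  then have "AE x in lebesgue_on \<Omega>. \<forall>i\<in>{..<N}. x \<in> K i \<longrightarrow>
      aux_proj_elem \<kappa> H (K i) (P i) u x = aux_average \<kappa> (K i) (P i) u x"
    by (intro AE_finite_allI) auto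
  with AE_coarse_element show ?thesis
  proof eventually_elim
    case (elim x)
    then obtain i where i: "i < N" "x \<in> K i" by blast
    have "aux_proj \<kappa> H N K P u x = aux_proj_elem \<kappa> H (K i) (P i) u x"
      unfolding aux_proj_def
      using coarse_element.aux_space_outside[OF coarse_element]
        coarse_element.aux_proj_elem_eq_average(1)[OF coarse_element K_Linf_on[OF _ u] H0]
      by (intro sum_at_coarse_element[OF i]) blast
    then show ?case using elim i global_average_on_element[OF i] by auto
  qed
qed

text \<open>Integrals do not see null sets, so the entries of the matrix S can be computed with the
  linear representative of the projection.\<close>

lemma s_form_aux_proj:
  assumes "Linf_on \<Omega> u" "Linf_on \<Omega> v"
  shows "s_form \<kappa> H \<Omega> (aux_proj \<kappa> H N K P u) (aux_proj \<kappa> H N K P v)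
    = weighted_inner \<kappa> \<Omega> (global_average u) (global_average v) / H\<^sup>2"
  unfolding s_form_weighted
  using weighted_inner_cong[OF global_average_Linf_on global_average_Linf_on, of u "aux_proj \<kappa> H N K P u" v
      "aux_proj \<kappa> H N K P v"] aux_proj_eq_global_average[OF assms(1)] aux_proj_eq_global_average[OF assms(2)]
  by (simp add: eq_commute)

lemma weighted_inner_global_average_coarse:
  "weighted_inner \<kappa> \<Omega> (global_average u) (global_average u)
    = (\<Sum>i<N. weighted_inner \<kappa> (K i) (aux_average \<kappa> (K i) (P i) u) (aux_average \<kappa> (K i) (P i) u))"
  unfolding weighted_inner_coarse[OF global_average_Linf_on global_average_Linf_on]
  unfolding weighted_inner_def
  by (intro sum.cong Bochner_Integration.integral_cong) (auto simp: global_average_on_element)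

lemma global_average_contraction:
  assumes "Linf_on \<Omega> u"
  shows "weighted_inner \<kappa> \<Omega> (global_average u) (global_average u) \<le> weighted_inner \<kappa> \<Omega> u u"
  unfolding weighted_inner_global_average_coarse weighted_inner_coarse[OF assms assms]
proof (rule sum_mono)
  fix i assume "i \<in> {..<N}"
  then have i: "i < N" by simp
  interpret E: coarse_element "K i" \<kappa> "P i" using coarse_element[OF i] .
  show "weighted_inner \<kappa> (K i) (aux_average \<kappa> (K i) (P i) u) (aux_average \<kappa> (K i) (P i) u)
      \<le> weighted_inner \<kappa> (K i) u u"
    using E.aux_average_pythagoras[OF K_Linf_on[OF i assms]] E.weighted_inner_nonneg by simp
qed

text \<open>On every coarse element the Pythagorean identity splits the mass into projection and
  defect, and the approximation property bounds the defect. The absolute value keeps the constant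
  nonnegative whatever the sign of C\<pi>.\<close>

lemma mass_le_energy_plus_average:
  assumes u: "Linf_on \<Omega> u" and g: "Linf_on \<Omega> g"
    and H1: "\<And>i. i < N \<Longrightarrow> H1_on (K i) u g"
    and approx: "\<And>i. i < N \<Longrightarrow> aux_approximation \<kappa> H C\<pi> (K i) (P i)"
  shows "weighted_inner \<kappa> \<Omega> u u / H\<^sup>2 \<le> \<bar>C\<pi>\<bar> * weighted_inner \<kappa> \<Omega> g g
    + weighted_inner \<kappa> \<Omega> (global_average u) (global_average u) / H\<^sup>2"
proof -
  have "weighted_inner \<kappa> (K i) u u / H\<^sup>2 \<le> \<bar>C\<pi>\<bar> * weighted_inner \<kappa> (K i) g g
      + weighted_inner \<kappa> (K i) (aux_average \<kappa> (K i) (P i) u) (aux_average \<kappa> (K i) (P i) u) / H\<^sup>2"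
    if i: "i < N" for i
  proof -
    interpret E: coarse_element "K i" \<kappa> "P i" using coarse_element[OF i] .
    note uK = K_Linf_on[OF i u]
    let ?a = "aux_average \<kappa> (K i) (P i) u" and ?w = "aux_proj_elem \<kappa> H (K i) (P i) u"
    have H0: "H \<noteq> 0" using H by simp
    have ae: "AE x in lebesgue_on (K i). u x - ?a x = u x - ?w x"
      using E.aux_proj_elem_eq_average(2)[OF uK H0] by eventually_elim simp
    have L: "Linf_on (K i) (\<lambda>x. u x - ?a x)" by (intro Linf_on_diff uK E.aux_average_Linf_on)
    have "weighted_inner \<kappa> (K i) (\<lambda>x. u x - ?a x) (\<lambda>x. u x - ?a x) / H\<^sup>2
        = s_form \<kappa> H (K i) (\<lambda>x. u x - ?w x) (\<lambda>x. u x - ?w x)"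
      using E.weighted_inner_cong[OF L L ae ae] by (simp add: s_form_weighted)
    also have "\<dots> = (s_norm \<kappa> H (K i) (\<lambda>x. u x - ?w x))\<^sup>2"
      by (simp add: s_norm_def s_form_weighted E.weighted_inner_nonneg)
    also have "\<dots> \<le> C\<pi> * weighted_inner \<kappa> (K i) g g"
      using approx[OF i] H1[OF i] by (simp add: aux_approximation_def weighted_inner_def power2_norm_eq_inner)
    also have "\<dots> \<le> \<bar>C\<pi>\<bar> * weighted_inner \<kappa> (K i) g g"
      using E.weighted_inner_nonneg by (intro mult_right_mono) auto
    finally show ?thesis
      using E.aux_average_pythagoras[OF uK] by (simp add: add_divide_distrib)
  qed
  then have "(\<Sum>i<N. weighted_inner \<kappa> (K i) u u / H\<^sup>2) \<le> (\<Sum>i<N. \<bar>C\<pi>\<bar> * weighted_inner \<kappa> (K i) g g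
      + weighted_inner \<kappa> (K i) (aux_average \<kappa> (K i) (P i) u) (aux_average \<kappa> (K i) (P i) u) / H\<^sup>2)"
    by (intro sum_mono) auto
  then show ?thesis
    unfolding weighted_inner_global_average_coarse weighted_inner_coarse[OF u u] weighted_inner_coarse[OF g g]
    by (simp add: sum.distrib sum_divide_distrib sum_distrib_left)
qed

end

section \<open>Stable decomposition and finite overlap\<close>

locale schwarz_setting = fe_mesh \<Omega> h \<T> + coarse_partition \<Omega> \<kappa> H N K P
  for \<Omega> :: "'a::euclidean_space set" and h \<T> \<kappa> H N K P +
  fixes C\<pi> C\<theta> CI :: real and M :: nat and m :: "nat \<Rightarrow> nat" and \<omega> :: "nat \<Rightarrow> 'a set"
    and \<theta> :: "nat \<Rightarrow> 'a \<Rightarrow> real" and xs :: "'a list"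
  assumes approx: "\<And>i. i < N \<Longrightarrow> aux_approximation \<kappa> H C\<pi> (K i) (P i)"
    and subdom: "\<And>i. i < N \<Longrightarrow> 1 \<le> m i \<and> \<omega> i = subdomain \<Omega> \<T> (K i) (m i)"
    and cover: "overlapping_cover \<Omega> M N \<omega>"
    and pou: "partition_of_unity \<Omega> \<T> H C\<theta> N \<omega> \<theta>"
    and stable: "interpolation_stable \<kappa> H \<Omega> \<T> CI"
    and xs: "distinct xs" "set xs = nodes \<T> \<inter> \<Omega>"
begin

definition mass :: "('a \<Rightarrow> real) \<Rightarrow> real" where
  "mass u = weighted_inner \<kappa> \<Omega> u u / H\<^sup>2"

text \<open>The function-space version of the bilinear form of A + S; the average replaces the
  projection so that the second term is bilinear.\<close>

definition energy :: "('a \<Rightarrow> real) \<Rightarrow> ('a \<Rightarrow> real) \<Rightarrow> real" where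
  "energy u v = a_form \<kappa> \<Omega> u v + weighted_inner \<kappa> \<Omega> (global_average u) (global_average v) / H\<^sup>2"

lemma mass_nonneg: "0 \<le> mass u"
  by (simp add: mass_def weighted_inner_nonneg)

lemma a_form_nonneg: "0 \<le> a_form \<kappa> \<Omega> u u"
  by (simp add: a_form_weighted weighted_inner_nonneg)

lemma a_form_le_energy: "a_form \<kappa> \<Omega> u u \<le> energy u u"
  by (simp add: energy_def weighted_inner_nonneg)

lemma energy_nonneg: "0 \<le> energy u u"
  using a_form_nonneg a_form_le_energy order_trans by blast

lemma energy_le: "Linf_on \<Omega> u \<Longrightarrow> energy u u \<le> a_form \<kappa> \<Omega> u u + mass u"
  unfolding energy_def mass_def by (intro add_left_mono divide_right_mono global_average_contraction) auto

text \<open>The summand \<bar>C\<pi>\<bar> pays for the projection defect and the summand 1 for the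
  projected part, each of them measured by the full energy.\<close>

lemma mass_le_energy:
  assumes "u \<in> P1 \<T>" shows "mass u \<le> (\<bar>C\<pi>\<bar> + 1) * energy u u"
proof -
  have "mass u \<le> \<bar>C\<pi>\<bar> * a_form \<kappa> \<Omega> u u + weighted_inner \<kappa> \<Omega> (global_average u) (global_average u) / H\<^sup>2"
    unfolding mass_def a_form_weighted
    by (rule mass_le_energy_plus_average[OF P1_Linf_on[OF assms] grad_P1_Linf_on[OF assms]
          H1_on_P1[OF assms K_open K_subset] approx])
  also have "\<dots> \<le> \<bar>C\<pi>\<bar> * energy u u + energy u u"
    using a_form_le_energy[of u] a_form_nonneg[of u]
    by (intro add_mono mult_left_mono) (auto simp: energy_def)
  finally show ?thesis by (simp add: algebra_simps)
qed

text \<open>The set of points of \<Omega> with nonzero value is open by continuity and null by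
  positivity of \<kappa>, hence empty. Together with \<open>mass_le_energy\<close> this yields
  positive definiteness of A + S.\<close>

lemma P1_zero_of_mass_zero:
  assumes u: "u \<in> P1 \<T>" and "mass u \<le> 0" and x: "x \<in> \<Omega>"
  shows "u x = 0"
proof (rule ccontr)
  assume ux: "u x \<noteq> 0"
  have "weighted_inner \<kappa> \<Omega> u u = 0"
    using assms(2) mass_nonneg[of u] H by (simp add: mass_def)
  then have "AE x in lebesgue_on \<Omega>. u x = 0"
    using weighted_inner_zero P1_Linf_on[OF u] by blast
  then have "AE x in lebesgue. x \<notin> {x \<in> \<Omega>. u x \<noteq> 0}"
    using U_sets by (auto simp: AE_restrict_space_iff elim!: eventually_mono)
  moreover have "continuous_on (closure \<Omega>) u"
    using u Union_mesh by (simp add: P1_def)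
  then have "continuous_on \<Omega> u"
    by (rule continuous_on_subset) (rule closure_subset)
  then have op: "open {x \<in> \<Omega>. u x \<noteq> 0}"
  proof -
    assume "continuous_on \<Omega> u"
    then have "open (\<Omega> \<inter> u -` (- {0}))"
      by (intro continuous_open_preimage open_dom) (simp_all add: open_Compl)
    also have "\<Omega> \<inter> u -` (- {0}) = {x \<in> \<Omega>. u x \<noteq> 0}" by auto
    finally show ?thesis .
  qed
  ultimately have "{x \<in> \<Omega>. u x \<noteq> 0} \<in> null_sets lebesgue"
    by (subst (asm) AE_iff_null_sets[symmetric]) (auto simp: borel_open)
  then show False
    using open_not_negligible[OF op] ux x by (auto simp: negligible_iff_null_sets)
qed

section \<open>Coefficient vectors and the functions they represent\<close>

abbreviation "n \<equiv> length xs"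

definition fe_function :: "real Matrix.vec \<Rightarrow> 'a \<Rightarrow> real" where
  "fe_function c x = (\<Sum>j<n. vec_index c j *\<^sub>R nodal_basis \<T> \<Omega> (xs ! j) x)"

lemma xs_node: "j < n \<Longrightarrow> xs ! j \<in> nodes \<T> \<inter> \<Omega>"
  using xs(2) nth_mem by blast

lemma nodal_basis_P1: "j < n \<Longrightarrow> nodal_basis \<T> \<Omega> (xs ! j) \<in> P1 \<T>"
  using nodal_basis_eq(2)[OF mesh_resolves_domain xs_node] by (simp add: P1_0_def)

lemma fe_function_P1: "fe_function c \<in> P1 \<T>"
  unfolding fe_function_def[abs_def] real_scaleR_def by (intro P1_sum P1_scale nodal_basis_P1) simp

lemma fe_function_node: "j < n \<Longrightarrow> fe_function c (xs ! j) = vec_index c j"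
proof -
  assume j: "j < n"
  have "nodal_basis \<T> \<Omega> (xs ! k) (xs ! j) = (if k = j then 1 else 0)" if "k < n" for k
    using nodal_basis_eq(1)[OF mesh_resolves_domain xs_node[OF that]] nodal_interpolant(2) xs_node[OF j]
      nth_eq_iff_index_eq[OF xs(1)] that j by auto
  then have "fe_function c (xs ! j) = (\<Sum>k<n. vec_index c k * (if k = j then 1 else 0))"
    unfolding fe_function_def by (intro sum.cong) auto
  also have "\<dots> = vec_index c j" using j by (simp add: if_distrib cong: if_cong)
  finally show ?thesis .
qed

lemma fe_function_outside: "x \<notin> \<Omega> \<Longrightarrow> fe_function c x = 0"
  using nodal_basis_eq(2)[OF mesh_resolves_domain xs_node]
  by (auto simp: fe_function_def P1_0_def intro!: sum.neutral)

lemma fe_function_eqI: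
  assumes "w \<in> P1 \<T>" "\<And>z. z \<in> nodes \<T> \<Longrightarrow> z \<notin> \<Omega> \<Longrightarrow> w z = 0" "\<And>j. j < n \<Longrightarrow> w (xs ! j) = vec_index c j"
  shows "fe_function c = w"
proof (rule P1_eqI[OF fe_function_P1 assms(1)])
  fix z assume z: "z \<in> nodes \<T>"
  show "fe_function c z = w z"
  proof (cases "z \<in> \<Omega>")
    case True
    then obtain j where "j < n" "z = xs ! j" using xs(2) z by (metis IntI in_set_conv_nth)
    then show ?thesis using assms(3) fe_function_node by simp
  qed (use assms(2) z fe_function_outside in auto)
qed

lemma fe_function_sum:
  "fe_function (vec_family_sum n N y) = (\<lambda>x. \<Sum>i<N. fe_function (y i) x)"
  by (rule fe_function_eqI)
    (auto intro!: P1_sum fe_function_P1 simp: fe_function_outside fe_function_node vec_family_sum_def)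

lemma AE_grad_sum:
  assumes "\<And>i. i \<in> I \<Longrightarrow> u i \<in> P1 \<T>"
  shows "AE x in lebesgue_on \<Omega>. grad (\<lambda>x. \<Sum>i\<in>I. c i *\<^sub>R u i x) x = (\<Sum>i\<in>I. c i *\<^sub>R grad (u i) x)"
  using AE_element_interior
proof eventually_elim
  case (elim x)
  then obtain T where T: "T \<in> \<T>" "x \<in> interior T" by blast
  have "(u i has_derivative (\<lambda>h. inner h (grad (u i) x))) (at x)" if "i \<in> I" for i
    using P1_gderiv_grad[OF assms[OF that] T] by (simp add: gderiv_def)
  then have "((\<lambda>x. \<Sum>i\<in>I. c i *\<^sub>R u i x) has_derivative (\<lambda>h. \<Sum>i\<in>I. c i *\<^sub>R inner h (grad (u i) x))) (at x)"
    by (intro has_derivative_sum has_derivative_scaleR_right)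
  then have "GDERIV (\<lambda>x. \<Sum>i\<in>I. c i *\<^sub>R u i x) x :> (\<Sum>i\<in>I. c i *\<^sub>R grad (u i) x)"
    by (simp add: gderiv_def inner_sum_right)
  then show ?case by (rule grad_eqI)
qed

text \<open>Bilinear expansion in the nodal basis: for gradients it holds almost everywhere, for
  averages everywhere. All later estimates can therefore be made on functions instead of
  matrices.\<close>

lemma matrix_energy:
  assumes "c \<in> carrier_vec n" "d \<in> carrier_vec n"
  shows "scalar_prod c (mult_mat_vec (A_mat \<kappa> \<Omega> \<T> xs + S_mat \<kappa> H \<Omega> \<T> N K P xs) d)
    = energy (fe_function c) (fe_function d)"
proof -
  define v where "v j = nodal_basis \<T> \<Omega> (xs ! j)" for j
  have v: "v j \<in> P1 \<T>" if "j < n" for j using nodal_basis_P1[OF that] by (simp add: v_def)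
  have fe: "fe_function c = (\<lambda>x. \<Sum>j<n. vec_index c j *\<^sub>R v j x)" for c
    by (simp add: fe_function_def[abs_def] v_def)
  define e where "e j i = weighted_inner \<kappa> \<Omega> (grad (v j)) (grad (v i))
      + weighted_inner \<kappa> \<Omega> (global_average (v j)) (global_average (v i)) / H\<^sup>2" for j i
  have grad_fe: "AE x in lebesgue_on \<Omega>. (\<Sum>j<n. vec_index c j *\<^sub>R grad (v j) x) = grad (fe_function c) x" for c
  proof -
    have "AE x in lebesgue_on \<Omega>. grad (fe_function c) x = (\<Sum>j<n. vec_index c j *\<^sub>R grad (v j) x)"
      unfolding fe using v by (intro AE_grad_sum) simp
    then show ?thesis by eventually_elim (rule sym)
  qed
  have gL: "Linf_on \<Omega> (\<lambda>x. \<Sum>j<n. vec_index c j *\<^sub>R grad (v j) x)" for c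
    using v by (intro Linf_on_sum Linf_on_cmult grad_P1_Linf_on) simp
  have "a_form \<kappa> \<Omega> (fe_function c) (fe_function d)
      = weighted_inner \<kappa> \<Omega> (\<lambda>x. \<Sum>j<n. vec_index c j *\<^sub>R grad (v j) x) (\<lambda>x. \<Sum>i<n. vec_index d i *\<^sub>R grad (v i) x)"
    unfolding a_form_weighted by (rule weighted_inner_cong[OF gL gL grad_fe grad_fe, symmetric])
  also have "\<dots> = (\<Sum>j<n. \<Sum>i<n. vec_index c j * vec_index d i * weighted_inner \<kappa> \<Omega> (grad (v j)) (grad (v i)))"
    using v by (intro weighted_inner_double_sum grad_P1_Linf_on) auto
  finally have a: "a_form \<kappa> \<Omega> (fe_function c) (fe_function d)
      = (\<Sum>j<n. \<Sum>i<n. vec_index c j * vec_index d i * weighted_inner \<kappa> \<Omega> (grad (v j)) (grad (v i)))" .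
  have ga: "global_average (fe_function c) = (\<lambda>x. \<Sum>j<n. vec_index c j *\<^sub>R global_average (v j) x)" for c
    unfolding fe using v by (intro global_average_sum P1_Linf_on) simp
  have "weighted_inner \<kappa> \<Omega> (global_average (fe_function c)) (global_average (fe_function d))
      = (\<Sum>j<n. \<Sum>i<n. vec_index c j * vec_index d i * weighted_inner \<kappa> \<Omega> (global_average (v j)) (global_average (v i)))"
    unfolding ga by (intro weighted_inner_double_sum global_average_Linf_on) simp
  with a have energy: "energy (fe_function c) (fe_function d) = (\<Sum>j<n. \<Sum>i<n. vec_index c j * vec_index d i * e j i)"
    by (simp add: energy_def e_def distrib_left sum.distrib sum_divide_distrib)
  have "(A_mat \<kappa> \<Omega> \<T> xs + S_mat \<kappa> H \<Omega> \<T> N K P xs) $$ (j, i) = e j i" if "j < n" "i < n" for j i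
    using that s_form_aux_proj[OF P1_Linf_on P1_Linf_on, OF v v] 
    by (simp add: A_mat_def S_mat_def e_def a_form_weighted weighted_inner_commute flip: v_def)
  then have "scalar_prod c (mult_mat_vec (A_mat \<kappa> \<Omega> \<T> xs + S_mat \<kappa> H \<Omega> \<T> N K P xs) d)
      = (\<Sum>j<n. vec_index c j * (\<Sum>i<n. e j i * vec_index d i))"
    using assms by (simp add: scalar_prod_def atLeast0LessThan A_mat_def S_mat_def)
  then show ?thesis unfolding energy by (simp add: sum_distrib_left mult_ac)
qed

lemma subdomain_resolved: "i < N \<Longrightarrow> mesh_resolves \<T> (\<omega> i)"
  using mesh_resolves_subdomain subdom by simp

section \<open>Extension by zero in coordinates\<close>

abbreviation "RT i \<equiv> RT_mat \<T> (\<omega> i) xs"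
abbreviation "dofs i \<equiv> filter (\<lambda>x. x \<in> \<omega> i) xs"

lemma RT_carrier: "RT i \<in> carrier_mat n (length (dofs i))"
  by (simp add: RT_mat_def Let_def)

text \<open>The local basis function of a node is the global hat function, so the extension matrix
  only selects nodes.\<close>

lemma RT_index:
  assumes "i < N" "j < n" "k < length (dofs i)"
  shows "RT i $$ (j, k) = (if xs ! j = dofs i ! k then 1 else 0)"
proof -
  have "dofs i ! k \<in> set (dofs i)" using assms(3) by (rule nth_mem)
  then have "dofs i ! k \<in> nodes \<T> \<inter> \<omega> i" using xs(2) by auto
  from nodal_basis_eq(1)[OF subdomain_resolved[OF assms(1)] this] show ?thesis
    using assms nodal_interpolant(2) xs_node[OF assms(2)] by (simp add: RT_mat_def Let_def)
qed

lemma RT_apply: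
  assumes i: "i < N" and j: "j < n" and z: "z \<in> carrier_vec (length (dofs i))"
  shows "k < length (dofs i) \<Longrightarrow> xs ! j = dofs i ! k \<Longrightarrow> vec_index (mult_mat_vec (RT i) z) j = vec_index z k"
    and "xs ! j \<notin> \<omega> i \<Longrightarrow> vec_index (mult_mat_vec (RT i) z) j = 0"
proof -
  have eq: "vec_index (mult_mat_vec (RT i) z) j
      = (\<Sum>l<length (dofs i). (if xs ! j = dofs i ! l then 1 else 0) * vec_index z l)"
    using z j carrier_matD[OF RT_carrier[of i]]
    by (auto simp: scalar_prod_def atLeast0LessThan RT_index[OF i j] intro!: sum.cong)
  show "vec_index (mult_mat_vec (RT i) z) j = vec_index z k" if "k < length (dofs i)" "xs ! j = dofs i ! k"
  proof -
    have "distinct (dofs i)" using xs(1) by simp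
    then have "(\<Sum>l<length (dofs i). (if xs ! j = dofs i ! l then 1 else 0) * vec_index z l)
        = (\<Sum>l<length (dofs i). (if k = l then 1 else 0) * vec_index z l)"
      using that nth_eq_iff_index_eq by (intro sum.cong) auto
    also have "\<dots> = vec_index z k"
      by (subst sum.remove[of _ k]) (use that in \<open>auto intro!: sum.neutral\<close>)
    finally show ?thesis unfolding eq .
  qed
  show "vec_index (mult_mat_vec (RT i) z) j = 0" if "xs ! j \<notin> \<omega> i"
  proof -
    have "xs ! j \<noteq> dofs i ! l" if "l < length (dofs i)" for l
      using nth_mem[OF that] \<open>xs ! j \<notin> \<omega> i\<close> by auto
    then show ?thesis unfolding eq by (intro sum.neutral) auto
  qed
qed

lemma RT_injective:
  assumes i: "i < N" and z: "z \<in> carrier_vec (length (dofs i))" and "mult_mat_vec (RT i) z = 0\<^sub>v n"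
  shows "z = 0\<^sub>v (length (dofs i))"
proof (rule eq_vecI)
  fix k assume "k < dim_vec (0\<^sub>v (length (dofs i)) :: real Matrix.vec)"
  then have k: "k < length (dofs i)" by simp
  then have "dofs i ! k \<in> set xs" using nth_mem by fastforce
  then obtain j where j: "j < n" "xs ! j = dofs i ! k" by (metis in_set_conv_nth)
  have "vec_index z k = vec_index (mult_mat_vec (RT i) z) j" using RT_apply(1)[OF i j(1) z k j(2)] by simp
  then show "vec_index z k = vec_index (0\<^sub>v (length (dofs i))) k" using assms(3) j k by simp
qed (use z in simp)

lemma RT_range:
  assumes i: "i < N" and c: "c \<in> carrier_vec n" and zero: "\<And>j. j < n \<Longrightarrow> xs ! j \<notin> \<omega> i \<Longrightarrow> vec_index c j = 0"
  obtains z where "z \<in> carrier_vec (length (dofs i))" "mult_mat_vec (RT i) z = c"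
proof -
  \<comment> \<open>Evaluating the finite element function at a local node reads off its coefficient
    without a search for the position of the node in \<open>xs\<close>.\<close>
  define z where "z = Matrix.vec (length (dofs i)) (\<lambda>k. fe_function c (dofs i ! k))"
  have z: "z \<in> carrier_vec (length (dofs i))" by (simp add: z_def)
  have "mult_mat_vec (RT i) z = c"
  proof (rule eq_vecI)
    fix j assume "j < dim_vec c"
    then have j: "j < n" using c by simp
    show "vec_index (mult_mat_vec (RT i) z) j = vec_index c j"
    proof (cases "xs ! j \<in> \<omega> i")
      case True
      then have "xs ! j \<in> set (dofs i)" using j by simp
      then obtain k where k: "k < length (dofs i)" "xs ! j = dofs i ! k" by (metis in_set_conv_nth)
      have "vec_index z k = fe_function c (xs ! j)" using k by (simp add: z_def)
      then show ?thesis using RT_apply(1)[OF i j z k] fe_function_node[OF j] by simp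
    qed (use RT_apply(2)[OF i j z] zero[OF j] in simp)
  qed (use c RT_carrier[of i] in auto)
  with z that show thesis by blast
qed

lemma fe_function_RT_outside:
  assumes i: "i < N" and z: "z \<in> carrier_vec (length (dofs i))" and x: "x \<notin> \<omega> i"
  shows "fe_function (mult_mat_vec (RT i) z) x = 0"
proof -
  have "fe_function (mult_mat_vec (RT i) z) y = 0" if y: "y \<in> nodes \<T> - \<omega> i" for y
  proof (cases "y \<in> \<Omega>")
    case True
    then obtain j where "j < n" "y = xs ! j" using xs(2) y by (metis DiffD1 IntI in_set_conv_nth)
    then show ?thesis using RT_apply(2)[OF i _ z] fe_function_node y by simp
  qed (use fe_function_outside in simp)
  then show ?thesis
    using subdomain_resolved[OF i] fe_function_P1 x unfolding mesh_resolves_def by blast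
qed

section \<open>Finite overlap\<close>

lemma card_subdomains: "x \<in> \<Omega> \<Longrightarrow> card {i. i < N \<and> x \<in> \<omega> i} \<le> M"
  using cover by (simp add: overlapping_cover_def)

lemma grad_zero_off_subdomain:
  assumes "i < N" "T \<in> \<T>" "x \<in> interior T" "x \<in> \<Omega>" "x \<notin> \<omega> i"
    and zero: "\<And>y. y \<in> \<Omega> - \<omega> i \<Longrightarrow> f y = 0"
  shows "grad f x = 0"
proof -
  obtain B where "open B" "x \<in> B" "B \<subseteq> \<Omega> - \<omega> i"
    using off_subdomain[of "m i" T x "K i"] subdom[OF assms(1)] assms(2-5) by metis
  then show ?thesis using grad_zero_if_locally_zero[of B x f] zero by blast
qed

text \<open>In an element interior, a point off \<open>\<omega> i\<close> has a neighbourhood in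
  which \<open>f i\<close> vanishes, so gradients overlap no more than the subdomains do. The
  remaining points lie on element boundaries and form a null set.\<close>

lemma AE_card_grad_le:
  assumes "\<And>i y. i < N \<Longrightarrow> y \<in> \<Omega> - \<omega> i \<Longrightarrow> f i y = 0"
  shows "AE x in lebesgue_on \<Omega>. card {i\<in>{..<N}. grad (f i) x \<noteq> 0} \<le> M"
proof -
  have "AE x in lebesgue_on \<Omega>. x \<in> \<Omega>" by (rule AE_I2) simp
  with AE_element_interior show ?thesis
  proof eventually_elim
    case (elim x)
    then have "{i\<in>{..<N}. grad (f i) x \<noteq> 0} \<subseteq> {i. i < N \<and> x \<in> \<omega> i}"
      using grad_zero_off_subdomain assms by blast
    then have "card {i\<in>{..<N}. grad (f i) x \<noteq> 0} \<le> card {i. i < N \<and> x \<in> \<omega> i}"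
      by (intro card_mono) auto
    then show ?case using card_subdomains elim by fastforce
  qed
qed

text \<open>The factor \<open>M\<close> is the pointwise overlap, used for gradients and for values.
  The factor \<bar>C\<pi>\<bar> + 2 is the price for returning from energy plus mass to
  \<open>energy\<close>: 1 for \<open>a_form\<close> and \<bar>C\<pi>\<bar> + 1 for
  \<open>mass\<close>.\<close>

lemma energy_overlap:
  assumes u: "\<And>i. i < N \<Longrightarrow> u i \<in> P1 \<T>" and zero: "\<And>i x. i < N \<Longrightarrow> x \<notin> \<omega> i \<Longrightarrow> u i x = 0"
  shows "energy (\<lambda>x. \<Sum>i<N. u i x) (\<lambda>x. \<Sum>i<N. u i x)
    \<le> real M * (\<bar>C\<pi>\<bar> + 2) * (\<Sum>i<N. energy (u i) (u i))"
proof -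
  let ?w = "\<lambda>x. \<Sum>i<N. u i x"
  have w: "?w \<in> P1 \<T>" using u by (intro P1_sum) simp
  have ae: "AE x in lebesgue_on \<Omega>. (\<Sum>i<N. grad (u i) x) = grad ?w x"
  proof -
    have "AE x in lebesgue_on \<Omega>. grad (\<lambda>x. \<Sum>i<N. 1 *\<^sub>R u i x) x = (\<Sum>i<N. 1 *\<^sub>R grad (u i) x)"
      using u by (intro AE_grad_sum) simp
    then show ?thesis by eventually_elim simp
  qed
  have gL: "Linf_on \<Omega> (\<lambda>x. \<Sum>i<N. grad (u i) x)" using u by (intro Linf_on_sum grad_P1_Linf_on) simp
  have "a_form \<kappa> \<Omega> ?w ?w = weighted_inner \<kappa> \<Omega> (\<lambda>x. \<Sum>i<N. grad (u i) x) (\<lambda>x. \<Sum>i<N. grad (u i) x)"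
    unfolding a_form_weighted by (rule weighted_inner_cong[OF gL gL ae ae, symmetric])
  also have "\<dots> \<le> real M * (\<Sum>i<N. weighted_inner \<kappa> \<Omega> (grad (u i)) (grad (u i)))"
    using u zero by (intro weighted_inner_overlap grad_P1_Linf_on AE_card_grad_le) auto
  finally have a: "a_form \<kappa> \<Omega> ?w ?w \<le> real M * (\<Sum>i<N. a_form \<kappa> \<Omega> (u i) (u i))"
    by (simp add: a_form_weighted)
  have "weighted_inner \<kappa> \<Omega> ?w ?w \<le> real M * (\<Sum>i<N. weighted_inner \<kappa> \<Omega> (u i) (u i))"
  proof (rule weighted_inner_overlap)
    show "AE x in lebesgue_on \<Omega>. card {i\<in>{..<N}. u i x \<noteq> 0} \<le> M"
    proof (rule AE_I2)
      fix x assume "x \<in> space (lebesgue_on \<Omega>)"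
      then have "x \<in> \<Omega>" by simp
      have "card {i\<in>{..<N}. u i x \<noteq> 0} \<le> card {i. i < N \<and> x \<in> \<omega> i}"
        using zero by (intro card_mono) auto
      then show "card {i\<in>{..<N}. u i x \<noteq> 0} \<le> M" using card_subdomains[OF \<open>x \<in> \<Omega>\<close>] by linarith
    qed
  qed (use u P1_Linf_on in auto)
  then have "mass ?w \<le> real M * (\<Sum>i<N. weighted_inner \<kappa> \<Omega> (u i) (u i)) / H\<^sup>2"
    unfolding mass_def by (intro divide_right_mono) auto
  then have mass: "mass ?w \<le> real M * (\<Sum>i<N. mass (u i))"
    by (simp add: mass_def flip: sum_divide_distrib)
  have "energy ?w ?w \<le> a_form \<kappa> \<Omega> ?w ?w + mass ?w" by (rule energy_le[OF P1_Linf_on[OF w]])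
  also have "\<dots> \<le> real M * (\<Sum>i<N. a_form \<kappa> \<Omega> (u i) (u i) + mass (u i))"
    using a mass by (simp add: sum.distrib distrib_left)
  also have "\<dots> \<le> real M * (\<Sum>i<N. (\<bar>C\<pi>\<bar> + 2) * energy (u i) (u i))"
  proof (intro mult_left_mono sum_mono)
    fix i assume "i \<in> {..<N}"
    then have "mass (u i) \<le> (\<bar>C\<pi>\<bar> + 1) * energy (u i) (u i)" using mass_le_energy u by simp
    then show "a_form \<kappa> \<Omega> (u i) (u i) + mass (u i) \<le> (\<bar>C\<pi>\<bar> + 2) * energy (u i) (u i)"
      using a_form_le_energy[of "u i"] by (simp add: algebra_simps)
  qed simp
  also have "\<dots> = real M * (\<bar>C\<pi>\<bar> + 2) * (\<Sum>i<N. energy (u i) (u i))"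
    by (simp add: sum_distrib_left mult.assoc)
  finally show ?thesis .
qed

section \<open>Products with the partition of unity\<close>

lemma \<theta>_P1: "i < N \<Longrightarrow> \<theta> i \<in> P1 \<T>"
  and \<theta>_zero: "i < N \<Longrightarrow> x \<in> \<Omega> - \<omega> i \<Longrightarrow> \<theta> i x = 0"
  and \<theta>_grad: "i < N \<Longrightarrow> AE x in lebesgue_on \<Omega>. norm (grad (\<theta> i) x) \<le> C\<theta> / H"
  and \<theta>_sum: "x \<in> \<Omega> \<Longrightarrow> (\<Sum>i<N. \<theta> i x) = 1"
  and \<theta>_sum_squares: "x \<in> \<Omega> \<Longrightarrow> (\<Sum>i<N. (\<theta> i x)\<^sup>2) \<le> 1"
  using pou by (auto simp: partition_of_unity_def)

lemma P1_mult_grad: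
  assumes u: "u \<in> P1 \<T>" and v: "v \<in> P1 \<T>"
  shows "AE x in lebesgue_on \<Omega>. u x *\<^sub>R grad v x + v x *\<^sub>R grad u x = grad (\<lambda>x. u x * v x) x"
    and "Linf_on \<Omega> (grad (\<lambda>x. u x * v x))"
proof -
  show "AE x in lebesgue_on \<Omega>. u x *\<^sub>R grad v x + v x *\<^sub>R grad u x = grad (\<lambda>x. u x * v x) x"
    using AE_element_interior
  proof eventually_elim
    case (elim x)
    then obtain T where T: "T \<in> \<T>" "x \<in> interior T" by blast
    from GDERIV_mult[OF P1_gderiv_grad[OF u T] P1_gderiv_grad[OF v T]] show ?case
      using grad_eqI by metis
  qed
  moreover have "Linf_on \<Omega> (\<lambda>x. u x *\<^sub>R grad v x + v x *\<^sub>R grad u x)"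
    by (intro Linf_on_add Linf_on_scaleR P1_Linf_on grad_P1_Linf_on u v)
  ultimately show "Linf_on \<Omega> (grad (\<lambda>x. u x * v x))"
    using Linf_on_AE_cong U_sets by blast
qed

lemma P1_mult_continuous_quadratic:
  assumes u: "u \<in> P1 \<T>" and v: "v \<in> P1 \<T>"
  shows "continuous_on (closure \<Omega>) (\<lambda>x. u x * v x)" and "piecewise_quadratic \<T> (\<lambda>x. u x * v x)"
proof -
  show "continuous_on (closure \<Omega>) (\<lambda>x. u x * v x)"
    using u v Union_mesh unfolding P1_def by (auto intro!: continuous_on_mult)
  show "piecewise_quadratic \<T> (\<lambda>x. u x * v x)"
    unfolding piecewise_quadratic_def
  proof
    fix T assume T: "T \<in> \<T>"
    obtain c b where u: "\<And>x. x \<in> T \<Longrightarrow> u x = c + inner b x" using P1_affine[OF u T] by blast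
    obtain c' b' where v: "\<And>x. x \<in> T \<Longrightarrow> v x = c' + inner b' x" using P1_affine[OF v T] by blast
    \<comment> \<open>The product of the two linear parts is the quadratic form of this rank-one
      map.\<close>
    have "linear (\<lambda>x. inner b' x *\<^sub>R b)"
      by (rule linearI) (auto simp: inner_add_right scaleR_add_left)
    moreover have "\<forall>x\<in>T. u x * v x = c * c' + inner (c' *\<^sub>R b + c *\<^sub>R b') x + inner x (inner b' x *\<^sub>R b)"
      by (auto simp: u v inner_add_left inner_commute[of _ b] algebra_simps)
    ultimately show "\<exists>c b A. linear A \<and> (\<forall>x\<in>T. u x * v x = c + inner b x + inner x (A x))"
      by (intro exI conjI)
  qed
qed

text \<open>The product is only piecewise quadratic, and interpolation brings it back into the
  finite element space. Stability is assumed for norms, whence the square of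
  \<open>CI\<close>.\<close>

lemma interpolation_energy:
  assumes "u \<in> P1 \<T>" "v \<in> P1 \<T>"
  defines "w \<equiv> nodal_interpolant \<T> (\<lambda>x. u x * v x)"
  shows "energy w w \<le> CI\<^sup>2 * (a_form \<kappa> \<Omega> (\<lambda>x. u x * v x) (\<lambda>x. u x * v x) + mass (\<lambda>x. u x * v x))"
proof -
  let ?f = "\<lambda>x. u x * v x"
  have "a_norm \<kappa> \<Omega> w \<le> CI * a_norm \<kappa> \<Omega> ?f" "s_norm \<kappa> H \<Omega> w \<le> CI * s_norm \<kappa> H \<Omega> ?f"
    using stable P1_mult_continuous_quadratic[OF assms(1,2)] unfolding interpolation_stable_def w_def by blast+
  then have "(a_norm \<kappa> \<Omega> w)\<^sup>2 \<le> (CI * a_norm \<kappa> \<Omega> ?f)\<^sup>2" "(s_norm \<kappa> H \<Omega> w)\<^sup>2 \<le> (CI * s_norm \<kappa> H \<Omega> ?f)\<^sup>2"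
    using a_form_nonneg[of w] mass_nonneg[of w]
    by (intro power_mono; simp add: a_norm_def s_norm_def s_form_weighted mass_def)+
  moreover have "(a_norm \<kappa> \<Omega> f)\<^sup>2 = a_form \<kappa> \<Omega> f f" "(s_norm \<kappa> H \<Omega> f)\<^sup>2 = mass f" for f
    using a_form_nonneg[of f] mass_nonneg[of f]
    by (simp_all add: a_norm_def s_norm_def s_form_weighted mass_def)
  ultimately have "a_form \<kappa> \<Omega> w w + mass w \<le> CI\<^sup>2 * (a_form \<kappa> \<Omega> ?f ?f + mass ?f)"
    by (simp add: power_mult_distrib distrib_left)
  then show ?thesis
    using energy_le[OF P1_Linf_on, of w] nodal_interpolant(1) unfolding w_def by (meson order_trans)
qed

text \<open>The Leibniz rule followed by (p + q)^2 \<le> 2 p^2 + 2 q^2 gives the factors 2. Since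
  the squares of the \<theta> sum to at most 1, the terms with the gradient of \<open>u\<close> cost
  nothing more; in the others at most \<open>M\<close> gradients of size C\<theta> / H meet, and
  H^-2 turns the weighted square of \<open>u\<close> into \<open>mass\<close>. The summand 1 is the
  mass of the products.\<close>

lemma partition_energy:
  assumes u: "u \<in> P1 \<T>"
  shows "(\<Sum>i<N. a_form \<kappa> \<Omega> (\<lambda>x. \<theta> i x * u x) (\<lambda>x. \<theta> i x * u x) + mass (\<lambda>x. \<theta> i x * u x))
    \<le> 2 * a_form \<kappa> \<Omega> u u + (2 * real M * C\<theta>\<^sup>2 + 1) * mass u"
proof -
  let ?f = "\<lambda>i x. \<theta> i x * u x"
  have dom: "AE x in lebesgue_on \<Omega>. x \<in> \<Omega>" by (rule AE_I2) simp
  have all: "AE x in lebesgue_on \<Omega>. \<forall>i\<in>{..<N}. norm (grad (\<theta> i) x) \<le> C\<theta> / H"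
    using \<theta>_grad by (intro AE_finite_allI) auto
  have card: "AE x in lebesgue_on \<Omega>. card {i\<in>{..<N}. grad (\<theta> i) x \<noteq> 0} \<le> M"
    using \<theta>_zero by (rule AE_card_grad_le)
  have prod: "AE x in lebesgue_on \<Omega>. \<forall>i\<in>{..<N}. \<theta> i x *\<^sub>R grad u x + u x *\<^sub>R grad (\<theta> i) x = grad (?f i) x"
    using P1_mult_grad(1)[OF \<theta>_P1 u] by (intro AE_finite_allI) auto
  have "AE x in lebesgue_on \<Omega>. (\<Sum>i<N. (norm (grad (?f i) x))\<^sup>2)
      \<le> 2 * (norm (grad u x))\<^sup>2 + (2 * real M * C\<theta>\<^sup>2 / H\<^sup>2) * (norm (u x))\<^sup>2"
    using dom all prod card
  proof eventually_elim
    case (elim x)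
    let ?J = "{i\<in>{..<N}. grad (\<theta> i) x \<noteq> 0}"
    have "(norm (grad (?f i) x))\<^sup>2 \<le> 2 * (norm (grad u x))\<^sup>2 * (\<theta> i x)\<^sup>2 + 2 * (u x)\<^sup>2 * (norm (grad (\<theta> i) x))\<^sup>2"
      if i: "i < N" for i
    proof -
      have "(norm (grad (?f i) x))\<^sup>2 \<le> (norm (\<theta> i x *\<^sub>R grad u x) + norm (u x *\<^sub>R grad (\<theta> i) x))\<^sup>2"
        using elim(3) i norm_triangle_ineq by (metis lessThan_iff norm_ge_zero power_mono)
      also have "\<dots> \<le> 2 * (norm (\<theta> i x *\<^sub>R grad u x))\<^sup>2 + 2 * (norm (u x *\<^sub>R grad (\<theta> i) x))\<^sup>2"
        using sum_squares_bound[of "norm (\<theta> i x *\<^sub>R grad u x)" "norm (u x *\<^sub>R grad (\<theta> i) x)"]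
        by (simp add: power2_sum)
      also have "\<dots> = 2 * (norm (grad u x))\<^sup>2 * (\<theta> i x)\<^sup>2 + 2 * (u x)\<^sup>2 * (norm (grad (\<theta> i) x))\<^sup>2"
        by (simp add: power_mult_distrib)
      finally show ?thesis .
    qed
    then have "(\<Sum>i<N. (norm (grad (?f i) x))\<^sup>2)
        \<le> (\<Sum>i<N. 2 * (norm (grad u x))\<^sup>2 * (\<theta> i x)\<^sup>2 + 2 * (u x)\<^sup>2 * (norm (grad (\<theta> i) x))\<^sup>2)"
      by (intro sum_mono) auto
    also have "\<dots> = 2 * (norm (grad u x))\<^sup>2 * (\<Sum>i<N. (\<theta> i x)\<^sup>2) + 2 * (u x)\<^sup>2 * (\<Sum>i<N. (norm (grad (\<theta> i) x))\<^sup>2)"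
      by (simp add: sum.distrib sum_distrib_left)
    also have "\<dots> \<le> 2 * (norm (grad u x))\<^sup>2 * 1 + 2 * (u x)\<^sup>2 * (real M * (C\<theta>\<^sup>2 / H\<^sup>2))"
    proof (intro add_mono mult_left_mono)
      show "(\<Sum>i<N. (\<theta> i x)\<^sup>2) \<le> 1" using \<theta>_sum_squares elim(1) by blast
      \<comment> \<open>Restricting to nonzero gradients leaves at most \<open>M\<close> indices, so
        the number of subdomains does not enter.\<close>
      have "(\<Sum>i<N. (norm (grad (\<theta> i) x))\<^sup>2) = (\<Sum>i\<in>?J. (norm (grad (\<theta> i) x))\<^sup>2)"
        by (intro sum.mono_neutral_right) auto
      also have "\<dots> \<le> (\<Sum>i\<in>?J. (C\<theta> / H)\<^sup>2)"
        using elim(2) by (intro sum_mono power_mono) auto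
      also have "\<dots> \<le> real M * (C\<theta> / H)\<^sup>2"
        using elim(4) by (simp add: mult_right_mono)
      finally show "(\<Sum>i<N. (norm (grad (\<theta> i) x))\<^sup>2) \<le> real M * (C\<theta>\<^sup>2 / H\<^sup>2)"
        by (simp add: power_divide)
    qed auto
    finally show ?case by (simp add: mult_ac)
  qed
  then have a: "(\<Sum>i<N. a_form \<kappa> \<Omega> (?f i) (?f i))
      \<le> 2 * a_form \<kappa> \<Omega> u u + (2 * real M * C\<theta>\<^sup>2 / H\<^sup>2) * weighted_inner \<kappa> \<Omega> u u"
    unfolding a_form_weighted using P1_mult_grad(2)[OF \<theta>_P1 u] grad_P1_Linf_on[OF u] P1_Linf_on[OF u]
    by (intro weighted_inner_sum_squares_le) auto
  \<comment> \<open>The term with coefficient 0 fits the inequality to the two-term shape of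
    \<open>weighted_inner_sum_squares_le\<close>.\<close>
  have "AE x in lebesgue_on \<Omega>. (\<Sum>i<N. (norm (?f i x))\<^sup>2) \<le> 1 * (norm (u x))\<^sup>2 + 0 * (norm (u x))\<^sup>2"
    using dom
  proof eventually_elim
    case (elim x)
    have "(\<Sum>i<N. (norm (?f i x))\<^sup>2) = (\<Sum>i<N. (\<theta> i x)\<^sup>2) * (u x)\<^sup>2"
      by (simp add: power_mult_distrib sum_distrib_right)
    also have "\<dots> \<le> 1 * (u x)\<^sup>2" using \<theta>_sum_squares[OF elim] by (intro mult_right_mono) auto
    finally show ?case by simp
  qed
  then have "(\<Sum>i<N. weighted_inner \<kappa> \<Omega> (?f i) (?f i)) \<le> 1 * weighted_inner \<kappa> \<Omega> u u + 0 * weighted_inner \<kappa> \<Omega> u u"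
    by (intro weighted_inner_sum_squares_le Linf_on_mult P1_Linf_on \<theta>_P1 u) auto
  then have "(\<Sum>i<N. mass (?f i)) \<le> mass u"
    unfolding mass_def by (simp add: divide_right_mono flip: sum_divide_distrib)
  with a show ?thesis by (simp add: sum.distrib mass_def distrib_right add_divide_distrib)
qed

text \<open>The product of the interpolation factor with the constant of
  \<open>partition_energy\<close>, after the mass is estimated by \<bar>C\<pi>\<bar> + 1 times the
  energy. The final summand 1 guarantees positivity, even for \<open>CI\<close> = 0.\<close>

definition decomposition_constant :: real where
  "decomposition_constant = CI\<^sup>2 * (2 + (2 * real M * C\<theta>\<^sup>2 + 1) * (\<bar>C\<pi>\<bar> + 1)) + 1"

text \<open>The i-th piece has the nodal values of \<theta>_i times the given function, so it is the
  interpolant of this product and vanishes at all nodes outside \<open>\<omega> i\<close>. At each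
  node the values of the \<theta>_i sum to 1, which recovers \<open>c\<close>.\<close>

lemma stable_decomposition:
  assumes c: "c \<in> carrier_vec n"
  shows "\<exists>z. (\<forall>i<N. z i \<in> carrier_vec (length (dofs i))) \<and>
    c = vec_family_sum n N (\<lambda>i. mult_mat_vec (RT i) (z i)) \<and>
    (\<Sum>i<N. energy (fe_function (mult_mat_vec (RT i) (z i))) (fe_function (mult_mat_vec (RT i) (z i))))
      \<le> decomposition_constant * energy (fe_function c) (fe_function c)"
proof -
  let ?u = "fe_function c"
  define d where "d i = Matrix.vec n (\<lambda>j. \<theta> i (xs ! j) * vec_index c j)" for i
  have "\<exists>z. z \<in> carrier_vec (length (dofs i)) \<and> mult_mat_vec (RT i) z = d i" if i: "i < N" for i
  proof -
    have "vec_index (d i) j = 0" if "j < n" "xs ! j \<notin> \<omega> i" for j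
      using that \<theta>_zero[OF i] xs_node by (simp add: d_def)
    then show ?thesis using RT_range[OF i, of "d i"] by (metis d_def vec_carrier)
  qed
  then obtain z where z: "\<And>i. i < N \<Longrightarrow> z i \<in> carrier_vec (length (dofs i))"
    "\<And>i. i < N \<Longrightarrow> mult_mat_vec (RT i) (z i) = d i" by metis
  have "c = vec_family_sum n N (\<lambda>i. mult_mat_vec (RT i) (z i))"
  proof (rule eq_vecI)
    fix j assume "j < dim_vec (vec_family_sum n N (\<lambda>i. mult_mat_vec (RT i) (z i)))"
    then have j: "j < n" by (simp add: vec_family_sum_def)
    then have "vec_index (vec_family_sum n N (\<lambda>i. mult_mat_vec (RT i) (z i))) j
        = (\<Sum>i<N. \<theta> i (xs ! j)) * vec_index c j"
      by (simp add: vec_family_sum_def z(2) d_def sum_distrib_right)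
    then show "vec_index c j = vec_index (vec_family_sum n N (\<lambda>i. mult_mat_vec (RT i) (z i))) j"
      using \<theta>_sum xs_node[OF j] by simp
  qed (use c in \<open>simp add: vec_family_sum_def\<close>)
  moreover have "(\<Sum>i<N. energy (fe_function (mult_mat_vec (RT i) (z i))) (fe_function (mult_mat_vec (RT i) (z i))))
      \<le> decomposition_constant * energy ?u ?u"
  proof -
    have fe: "fe_function (d i) = nodal_interpolant \<T> (\<lambda>x. \<theta> i x * ?u x)" for i
      using nodal_interpolant xs_node
      by (intro fe_function_eqI) (auto simp: d_def fe_function_outside fe_function_node)
    have "(\<Sum>i<N. energy (fe_function (mult_mat_vec (RT i) (z i))) (fe_function (mult_mat_vec (RT i) (z i))))
        \<le> (\<Sum>i<N. CI\<^sup>2 * (a_form \<kappa> \<Omega> (\<lambda>x. \<theta> i x * ?u x) (\<lambda>x. \<theta> i x * ?u x) + mass (\<lambda>x. \<theta> i x * ?u x)))"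
      using interpolation_energy[OF \<theta>_P1 fe_function_P1] by (intro sum_mono) (auto simp: z(2) fe)
    also have "\<dots> \<le> CI\<^sup>2 * (2 * a_form \<kappa> \<Omega> ?u ?u + (2 * real M * C\<theta>\<^sup>2 + 1) * mass ?u)"
      unfolding sum_distrib_left[symmetric]
      by (intro mult_left_mono partition_energy fe_function_P1) simp
    also have "\<dots> \<le> CI\<^sup>2 * (2 * energy ?u ?u + (2 * real M * C\<theta>\<^sup>2 + 1) * ((\<bar>C\<pi>\<bar> + 1) * energy ?u ?u))"
      by (intro mult_left_mono add_mono a_form_le_energy mass_le_energy fe_function_P1) auto
    also have "\<dots> \<le> decomposition_constant * energy ?u ?u"
      using energy_nonneg[of ?u] by (simp add: decomposition_constant_def algebra_simps)
    finally show ?thesis .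
  qed
  ultimately show ?thesis using z(1) by blast
qed

section \<open>The spectral bound for the preconditioned finite element matrix\<close>

lemma schwarz_bound:
  assumes "xs \<noteq> []"
  defines "A \<equiv> A_mat \<kappa> \<Omega> \<T> xs" and "S \<equiv> S_mat \<kappa> H \<Omega> \<T> N K P xs"
  defines "B \<equiv> schwarz_precond \<T> N \<omega> xs A S * (A + S)"
  shows "positive_spectrum B \<and> cond_number B \<le> decomposition_constant * (real M * (\<bar>C\<pi>\<bar> + 2))"
proof (rule schwarz_condition_number[where n = n and N = N and RT = RT and k = "\<lambda>i. length (dofs i)"])
  note energy = matrix_energy[folded A_def S_def]
  have RT_vec: "mult_mat_vec (RT i) z \<in> carrier_vec n" for i z
    using RT_carrier[of i] by (metis carrier_matD(1) carrier_vecI dim_mult_mat_vec)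
  show "0 < n" using assms(1) by simp
  show "A \<in> carrier_mat n n" "S \<in> carrier_mat n n" by (simp_all add: A_def S_def A_mat_def S_mat_def)
  show "transpose_mat (A + S) = A + S"
    by (intro eq_matI) (simp_all add: A_def S_def A_mat_def S_mat_def a_form_weighted s_form_weighted
        weighted_inner_commute)
  show "0 < scalar_prod x (mult_mat_vec (A + S) x)" if x: "x \<in> carrier_vec n" "x \<noteq> 0\<^sub>v n" for x
  proof -
    have "0 < energy (fe_function x) (fe_function x)"
    proof (rule ccontr)
      assume "\<not> ?thesis"
      then have "energy (fe_function x) (fe_function x) = 0" using energy_nonneg[of "fe_function x"] by linarith
      then have "mass (fe_function x) \<le> 0" using mass_le_energy[OF fe_function_P1, of x] by simp
      then have "vec_index x j = 0" if "j < n" for j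
        using P1_zero_of_mass_zero[OF fe_function_P1, of x "xs ! j"] fe_function_node[OF that, of x]
          xs_node[OF that] by simp
      then have "x = 0\<^sub>v n" using x(1) by (intro eq_vecI) auto
      with x(2) show False by simp
    qed
    then show ?thesis using energy x(1) by simp
  qed
  show "RT i \<in> carrier_mat n (length (dofs i))" for i by (rule RT_carrier)
  show "z = 0\<^sub>v (length (dofs i))"
    if "i < N" "z \<in> carrier_vec (length (dofs i))" "mult_mat_vec (RT i) z = 0\<^sub>v n" for i z
    using RT_injective that by blast
  show "B = Matrix.mat n n (\<lambda>(j, l). \<Sum>i<N. local_solver (RT i) A S $$ (j, l)) * (A + S)"
    by (simp add: B_def schwarz_precond_def)
  show "0 < decomposition_constant"
    unfolding decomposition_constant_def by (intro add_nonneg_pos mult_nonneg_nonneg add_nonneg_nonneg) auto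
  show "scalar_prod (vec_family_sum n N (\<lambda>i. mult_mat_vec (RT i) (z i)))
        (mult_mat_vec (A + S) (vec_family_sum n N (\<lambda>i. mult_mat_vec (RT i) (z i))))
      \<le> real M * (\<bar>C\<pi>\<bar> + 2) *
        (\<Sum>i<N. scalar_prod (mult_mat_vec (RT i) (z i)) (mult_mat_vec (A + S) (mult_mat_vec (RT i) (z i))))"
    if z: "\<And>i. i < N \<Longrightarrow> z i \<in> carrier_vec (length (dofs i))" for z
    unfolding energy[OF vec_family_sum_carrier vec_family_sum_carrier] energy[OF RT_vec RT_vec] fe_function_sum
    by (intro energy_overlap fe_function_P1 fe_function_RT_outside z)
  show "\<exists>z. (\<forall>i<N. z i \<in> carrier_vec (length (dofs i))) \<and>
      x = vec_family_sum n N (\<lambda>i. mult_mat_vec (RT i) (z i)) \<and>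
      (\<Sum>i<N. scalar_prod (mult_mat_vec (RT i) (z i)) (mult_mat_vec (A + S) (mult_mat_vec (RT i) (z i))))
      \<le> decomposition_constant * scalar_prod x (mult_mat_vec (A + S) x)" if x: "x \<in> carrier_vec n" for x
    unfolding energy[OF x x] energy[OF RT_vec RT_vec] by (rule stable_decomposition[OF x])
qed

end

text \<open>A coarse element is open and nonempty and so contains a ball, which gives it positive
  diameter; \<open>H\<close> is the largest diameter. Positivity is what makes division by
  \<open>H\<close>^2 harmless.\<close>

lemma coarse_mesh_size_pos:
  fixes \<Omega> :: "'a::euclidean_space set"
  assumes "coarse_mesh \<Omega> H N K" "bounded \<Omega>" "0 < N"
  shows "0 < H"
proof -
  have K: "open (K 0)" "K 0 \<noteq> {}" "bounded (K 0)"
    using assms bounded_subset by (auto simp: coarse_mesh_def)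
  then obtain x e where e: "0 < e" "cball x e \<subseteq> K 0" by (metis ex_in_conv open_contains_cball)
  obtain b :: 'a where b: "b \<in> Basis" using nonempty_Basis by blast
  have "x \<in> K 0" "x + e *\<^sub>R b \<in> K 0" using e b by (auto simp: dist_norm intro!: subsetD[OF e(2)])
  then have "dist x (x + e *\<^sub>R b) \<le> diameter (K 0)" by (rule diameter_bounded_bound[OF K(3)])
  then have "e \<le> diameter (K 0)" using b e(1) by (simp add: dist_norm)
  also have "\<dots> \<le> H"
    using assms by (auto simp: coarse_mesh_def mesh_size_def intro!: Max_ge)
  finally show ?thesis using e(1) by simp
qed

theorem theorem1:
  fixes \<Omega> :: "'a::euclidean_space set"
    and C\<pi> \<eta>0 CP C\<theta> CI :: real
    and M :: nat
  assumes "DIM('a) = 2 \<or> DIM('a) = 3"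
    and "open \<Omega>" and "connected \<Omega>" and "bounded \<Omega>" and "\<Omega> \<noteq> {}"
  shows "\<exists>C::real. \<forall>(\<kappa> :: 'a \<Rightarrow> real) \<kappa>min \<kappa>max \<kappa>0 h H \<T> N (K :: nat \<Rightarrow> 'a set) P m \<omega> \<theta> xs A S B.
     coefficient \<Omega> \<kappa>min \<kappa>max \<kappa> \<longrightarrow>
     fine_mesh \<Omega> h \<T> \<longrightarrow>
     coarse_mesh \<Omega> H N K \<longrightarrow>
     (\<forall>i<N. high_components \<kappa> H \<eta>0 \<kappa>0 CP (K i) (P i)) \<longrightarrow>
     (\<forall>i<N. aux_approximation \<kappa> H C\<pi> (K i) (P i)) \<longrightarrow>
     (\<forall>i<N. 1 \<le> m i \<and> \<omega> i = subdomain \<Omega> \<T> (K i) (m i)) \<longrightarrow>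
     overlapping_cover \<Omega> M N \<omega> \<longrightarrow>
     partition_of_unity \<Omega> \<T> H C\<theta> N \<omega> \<theta> \<longrightarrow>
     interpolation_stable \<kappa> H \<Omega> \<T> CI \<longrightarrow>
     xs \<noteq> [] \<longrightarrow> distinct xs \<longrightarrow> set xs = nodes \<T> \<inter> \<Omega> \<longrightarrow>
     A = A_mat \<kappa> \<Omega> \<T> xs \<longrightarrow>
     S = S_mat \<kappa> H \<Omega> \<T> N K P xs \<longrightarrow>
     B = schwarz_precond \<T> N \<omega> xs A S * (A + S) \<longrightarrow>
     positive_spectrum B \<and> cond_number B \<le> C"
proof (intro exI allI impI)
  fix \<kappa> :: "'a \<Rightarrow> real" and \<kappa>min \<kappa>max \<kappa>0 h H \<T> N and K :: "nat \<Rightarrow> 'a set" and P m \<omega> \<theta> xs A S B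
  assume \<kappa>: "coefficient \<Omega> \<kappa>min \<kappa>max \<kappa>" and mesh: "fine_mesh \<Omega> h \<T>" and coarse: "coarse_mesh \<Omega> H N K"
    and high: "\<forall>i<N. high_components \<kappa> H \<eta>0 \<kappa>0 CP (K i) (P i)"
    and approx: "\<forall>i<N. aux_approximation \<kappa> H C\<pi> (K i) (P i)"
    and subdom: "\<forall>i<N. 1 \<le> m i \<and> \<omega> i = subdomain \<Omega> \<T> (K i) (m i)"
    and cover: "overlapping_cover \<Omega> M N \<omega>" and pou: "partition_of_unity \<Omega> \<T> H C\<theta> N \<omega> \<theta>"
    and stable: "interpolation_stable \<kappa> H \<Omega> \<T> CI"
    and nonempty: "xs \<noteq> []" and enum: "distinct xs" "set xs = nodes \<T> \<inter> \<Omega>"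
    and AS: "A = A_mat \<kappa> \<Omega> \<T> xs" "S = S_mat \<kappa> H \<Omega> \<T> N K P xs"
    and B: "B = schwarz_precond \<T> N \<omega> xs A S * (A + S)"
  have meas: "\<kappa> \<in> borel_measurable (lebesgue_on \<Omega>)" and pos: "0 < \<kappa>min"
    and bds: "AE x in lebesgue_on \<Omega>. \<kappa>min \<le> \<kappa> x \<and> \<kappa> x \<le> \<kappa>max"
    using \<kappa> by (auto simp: coefficient_def)
  \<comment> \<open>A nonempty domain cannot be covered by an empty family; hence \<open>H\<close>
    is the maximum of a nonempty finite set.\<close>
  have "0 < N" using cover \<open>\<Omega> \<noteq> {}\<close> by (cases N) (auto simp: overlapping_cover_def)
  interpret schwarz_setting \<Omega> h \<T> \<kappa> H N K P C\<pi> C\<theta> CI M m \<omega> \<theta> xs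
  proof unfold_locales
    show "\<Omega> \<in> lmeasurable" using assms lmeasurable_open by blast
    show "AE x in lebesgue_on \<Omega>. 0 < \<kappa> x" using bds by eventually_elim (use pos in auto)
    have "AE x in lebesgue_on \<Omega>. norm (\<kappa> x) \<le> \<kappa>max" using bds by eventually_elim (use pos in auto)
    then show "Linf_on \<Omega> \<kappa>" using meas by (rule Linf_onI[rotated])
    show "0 < H" using coarse_mesh_size_pos coarse \<open>bounded \<Omega>\<close> \<open>0 < N\<close> by blast
    show "finite (P i) \<and> disjoint (P i) \<and> (\<forall>D\<in>P i. open D \<and> D \<subseteq> K i)" if "i < N" for i
      using high that by (auto simp: high_components_def lipschitz_domain_def)
  qed (use assms mesh coarse approx subdom cover pou stable enum in auto)
  \<comment> \<open>The schematic witness is instantiated here and may contain only the constants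
    fixed before the coefficient and the meshes; writing out \<open>decomposition_constant\<close>
    makes this visible.\<close>
  show "positive_spectrum B \<and> cond_number B
      \<le> (CI\<^sup>2 * (2 + (2 * real M * C\<theta>\<^sup>2 + 1) * (\<bar>C\<pi>\<bar> + 1)) + 1) * (real M * (\<bar>C\<pi>\<bar> + 2))"
    using schwarz_bound[OF nonempty] unfolding B AS decomposition_constant_def .
qed

end
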